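(* Assume that $W(0)=0$. The coefficient functions $\Theta_n(z),\Theta^*_n(z),\Omega_n(z),\Omega^*_n(z)$ are polynomials in $z$ of degree $m-2$, $m-2$, $m-1$, $m-1$ respectively. Specifically, writing $\rho=\sum_{j=1}^m\rho_j$, $S=\sum_{j=1}^mz_j$, $R=\sum_{j=1}^m\rho_jz_j$, they have leading and trailing expansions (in descending powers of $z$ from the top, respectively ascending powers of $z$ from $z^0$) of the form: $$\Theta_n(z)=(n+1+\rho)\frac{\kappa_n}{\kappa_{n+1}}z^{m-2}+\Big\{-[(n+1+\rho)S-R]\frac{\kappa_n}{\kappa_{n+1}}+(n+2+\rho)\frac{\kappa_n^3}{\kappa_{n+1}^2\kappa_{n+2}}\frac{\phi_{n+2}(0)}{\phi_{n+1}(0)}-(n+\rho)\frac{\phi_{n+1}(0)\bar\phi_n(0)}{\kappa_{n+1}^2}-2\frac{\kappa_nl_{n+1}}{\kappa_{n+1}^2}\Big\}z^{m-3}+\mathrm O(z^{m-4}),$$ $$\Theta_n(z)=[2V(0)-nW'(0)]\frac{\phi_n(0)}{\phi_{n+1}(0)}+\Big\{[2V'(0)-\tfrac12nW''(0)]\frac{\phi_n(0)}{\phi_{n+1}(0)}+[2V(0)-(n-1)W'(0)]\frac{\kappa_n\phi_{n-1}(0)}{\kappa_{n-1}\phi_{n+1}(0)}+\Big([(n+1)W'(0)-2V(0)]\frac{\bar l_{n+1}}{\kappa_{n+1}}-[(n-1)W'(0)-2V(0)]\frac{\bar l_{n-1}}{\kappa_{n-1}}\Big)\frac{\phi_n(0)}{\phi_{n+1}(0)}\Big\}z+\mathrm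 O(z^2),$$ $$\Theta^*_n(z)=-(n+\rho)\frac{\bar\phi_n(0)}{\bar\phi_{n+1}(0)}z^{m-2}+\Big\{[(n+\rho)S-R]\frac{\bar\phi_n(0)}{\bar\phi_{n+1}(0)}+(n+1+\rho)\frac{\bar\phi_n(0)}{\bar\phi_{n+1}(0)}\frac{l_{n+1}}{\kappa_{n+1}}-(n-1+\rho)\frac{\kappa_n\bar\phi_{n-1}(0)+\bar\phi_n(0)l_{n-1}}{\kappa_{n-1}\bar\phi_{n+1}(0)}\Big\}z^{m-3}+\mathrm O(z^{m-4}),$$ $$\Theta^*_n(z)=-[2V(0)-(n+1)W'(0)]\frac{\kappa_n}{\kappa_{n+1}}+\Big\{-[2V'(0)-\tfrac12(n+1)W''(0)]\frac{\kappa_n}{\kappa_{n+1}}-[2V(0)-nW'(0)]\frac{\bar l_n}{\kappa_{n+1}}+[(n+2)W'(0)-2V(0)]\Big(\frac{\kappa_n^3}{\kappa_{n+2}\kappa_{n+1}^2}\frac{\bar\phi_{n+2}(0)}{\bar\phi_{n+1}(0)}-\frac{\kappa_n}{\kappa_{n+1}}\frac{\bar l_{n+1}}{\kappa_{n+1}}\Big)\Big\}z+\mathrm O(z^2),$$ $$\Omega_n(z)=(1+\tfrac12\rho)z^{m-1}+\Big\{-\tfrac12\rho S+\tfrac12R-S+(n+2+\rho)\frac{\kappa_n^2}{\kappa_{n+2}\kappa_{n+1}}\frac{\phi_{n+2}(0)}{\phi_{n+1}(0)}-\frac{l_{n+1}}{\kappa_{n+1}}\Big\}z^{m-2}+\mathrm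 O(z^{m-3}),$$ $$\Omega_n(z)=V(0)-nW'(0)+\Big\{V'(0)-\tfrac12nW''(0)+\Big(V(0)\frac{\kappa_n}{\kappa_{n+1}}+[V(0)-nW'(0)]\frac{\kappa_{n+1}}{\kappa_n}\Big)\frac{\phi_n(0)}{\phi_{n+1}(0)}+[V(0)-nW'(0)]\frac{\bar l_n}{\kappa_n}-[V(0)-(n+1)W'(0)]\frac{\bar l_{n+1}}{\kappa_{n+1}}\Big\}z+\mathrm O(z^2),$$ $$\Omega^*_n(z)=-\tfrac12\rho z^{m-1}+\Big\{\tfrac12\rho S-\tfrac12R-(n+\rho)\frac{\kappa_n}{\kappa_{n+1}}\frac{\bar\phi_n(0)}{\bar\phi_{n+1}(0)}+\frac{l_{n+1}}{\kappa_{n+1}}\Big\}z^{m-2}+\mathrm O(z^{m-3}),$$ $$\Omega^*_n(z)=(n+1)W'(0)-V(0)+\Big\{\tfrac12(n+1)W''(0)-V'(0)+[(n+2)W'(0)-2V(0)]\frac{\kappa_n^2}{\kappa_{n+2}\kappa_{n+1}}\frac{\bar\phi_{n+2}(0)}{\bar\phi_{n+1}(0)}-W'(0)\frac{\bar l_{n+1}}{\kappa_{n+1}}\Big\}z+\mathrm O(z^2).$$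
   Context: Regular semi-classical weight: $w(z)=\prod_{j=1}^m(z-z_j)^{\rho_j}$ with $m\ge2$ distinct points $z_j\in\mathbb C$ and exponents $\rho_j\in\mathbb C\setminus\mathbb Z_{\ge0}$. Put $W(z)=\prod_{j=1}^m(z-z_j)$ and $\frac{2V(z)}{W(z)}=\sum_{j=1}^m\frac{\rho_j}{z-z_j}$, so that $W w'=2Vw$ with $V,W$ polynomials, $\deg V<\deg W=m$, and $\rho_j=2V(z_j)/W'(z_j)$. The weight is analytic in a cut complex plane and has Fourier coefficients $w_k=\int_{\mathbb T}\frac{d\zeta}{2\pi i\zeta}w(\zeta)\zeta^{-k}$, where $\mathbb T=\{|\zeta|=1\}$, $\zeta=e^{i\theta}$, $\theta\in(-\pi,\pi]$; it is assumed that $z^jw(z),z^jw'(z)\in L^1(\mathbb T)$ for all $j\in\mathbb Z$. The bi-orthonormal polynomials, whose existence is assumed, are $\phi_n(z)=\kappa_nz^n+l_nz^{n-1}+\dots+\phi_n(0)$ and $\bar\phi_n(z)=\kappa_nz^n+\bar l_nz^{n-1}+\dots+\bar\phi_n(0)$ (leading coefficients chosen equal), satisfying $\int_{\mathbb T}\frac{d\zeta}{2\pi i\zeta}w(\zeta)\phi_k(\zeta)\bar\phi_n(\bar\zeta)=\delta_{k,n}$, where $\bar\zeta=\zeta^{-1}$ on $\mathbb T$. The bars on $\bar\phi_n,\bar l_n$ are notation and do not mean complex conjugation. The reciprocal polynomial is $\phi^*_n(z)=z^n\bar\phi_n(1/z)$. Let $F(z)=\int_{\mathbb T}\frac{d\zeta}{2\pi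 i\zeta}\frac{\zeta+z}{\zeta-z}w(\zeta)$. For $n\ge1$ let $\psi_n(z)=\int_{\mathbb T}\frac{d\zeta}{2\pi i\zeta}\frac{\zeta+z}{\zeta-z}w(\zeta)[\phi_n(\zeta)-\phi_n(z)]$ and $\psi^*_n(z)=-\int_{\mathbb T}\frac{d\zeta}{2\pi i\zeta}\frac{\zeta+z}{\zeta-z}w(\zeta)[z^n\bar\phi_n(\bar\zeta)-\phi^*_n(z)]$, with $\psi_0=\psi^*_0=1/\kappa_0$. The associated functions are $\epsilon_n=\psi_n+F\phi_n$ and $\epsilon^*_n=\psi^*_n-F\phi^*_n$. The coefficient functions $\Theta_n,\Omega_n,\Theta^*_n,\Omega^*_n$ are those appearing in the derivative relations ($'=d/dz$) $W\phi'_n=\Theta_n\phi_{n+1}-(\Omega_n+V)\phi_n$, $W\epsilon'_n=\Theta_n\epsilon_{n+1}-(\Omega_n-V)\epsilon_n$, $W\phi^{*\prime}_n=-\Theta^*_n\phi^*_{n+1}+(\Omega^*_n-V)\phi^*_n$, $W\epsilon^{*\prime}_n=-\Theta^*_n\epsilon^*_{n+1}+(\Omega^*_n+V)\epsilon^*_n$.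
   Formalization: The cuts of w may meet the unit circle only at points z_j; φ_{n+1}(0) and φ̄_{n+1}(0) are nonzero; the degrees are exact only if the displayed leading coefficient is nonzero; expansions with index n−1 need n≥1; coefficient functions are identified for |z|≠1, z≠0. *)

theory Defs
  imports "HOL-Analysis.Analysis" "HOL-Library.Landau_Symbols"
begin

definition W_poly :: "nat \<Rightarrow> (nat \<Rightarrow> complex) \<Rightarrow> complex poly" where
  "W_poly m zs = (\<Prod>j=1..m. [:- zs j, 1:])"

(* Clearing denominators in 2 V / W = sum_j rho_j / (z - z_j); see two_V_over_W below. *)
definition V_poly :: "nat \<Rightarrow> (nat \<Rightarrow> complex) \<Rightarrow> (nat \<Rightarrow> complex) \<Rightarrow> complex poly" where
  "V_poly m zs \<rho> = smult (1/2) (\<Sum>j=1..m. smult (\<rho> j) (\<Prod>i\<in>{1..m} - {j}. [:- zs i, 1:]))"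

lemma two_V_over_W:
  assumes "z \<notin> zs ` {1..m}"
  shows "2 * poly (V_poly m zs \<rho>) z / poly (W_poly m zs) z = (\<Sum>j=1..m. \<rho> j / (z - zs j))"
proof -
  have nz: "z - zs j \<noteq> 0" if "j \<in> {1..m}" for j
    using assms that by auto
  have W: "poly (W_poly m zs) z = (z - zs j) * (\<Prod>i\<in>{1..m} - {j}. (z - zs i))"
    if "j \<in> {1..m}" for j
    using prod.remove[of "{1..m}" j "\<lambda>i. z - zs i"] that by (simp add: W_poly_def poly_prod)
  have W0: "poly (W_poly m zs) z \<noteq> 0"
    using nz by (auto simp: W_poly_def poly_prod)
  have "2 * poly (V_poly m zs \<rho>) z / poly (W_poly m zs) z
      = (\<Sum>j=1..m. \<rho> j * (\<Prod>i\<in>{1..m} - {j}. (z - zs i)) / poly (W_poly m zs) z)"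
    by (simp add: V_poly_def poly_sum poly_prod sum_divide_distrib sum_distrib_left)
  also have "\<dots> = (\<Sum>j=1..m. \<rho> j / (z - zs j))"
  proof (rule sum.cong[OF refl])
    fix j assume j: "j \<in> {1..m}"
    show "\<rho> j * (\<Prod>i\<in>{1..m} - {j}. (z - zs i)) / poly (W_poly m zs) z = \<rho> j / (z - zs j)"
      using W0 nz[OF j] unfolding W[OF j] by simp
  qed
  finally show ?thesis .
qed

(* w is a holomorphic branch on D of the multivalued function prod_j (z - z_j)^(rho_j): l j is
   some value of log (z - z_j), chosen pointwise, and holomorphy of w makes the choice coherent.
   In particular every z_j lies outside D. *)
definition holomorphic_branch ::
  "nat \<Rightarrow> (nat \<Rightarrow> complex) \<Rightarrow> (nat \<Rightarrow> complex) \<Rightarrow> (complex \<Rightarrow> complex) \<Rightarrow> complex set \<Rightarrow> bool" where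
  "holomorphic_branch m zs \<rho> w D \<longleftrightarrow>
     w holomorphic_on D \<and>
     (\<forall>z\<in>D. \<exists>l. (\<forall>j\<in>{1..m}. exp (l j) = z - zs j) \<and> w z = (\<Prod>j=1..m. exp (\<rho> j * l j)))"

(* D is the domain left after removing the cuts. The cuts may meet the unit circle only at the
   points z_j: a jump of w elsewhere on the circle would destroy W w' = 2 V w as an identity for
   the weight on the circle. *)
definition semi_classical_weight ::
  "nat \<Rightarrow> (nat \<Rightarrow> complex) \<Rightarrow> (nat \<Rightarrow> complex) \<Rightarrow> (complex \<Rightarrow> complex) \<Rightarrow> bool" where
  "semi_classical_weight m zs \<rho> w \<longleftrightarrow>
     2 \<le> m \<and> inj_on zs {1..m} \<and> (\<forall>j\<in>{1..m}. \<rho> j \<notin> \<nat>) \<and>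
     (\<exists>D. open D \<and> sphere 0 1 - zs ` {1..m} \<subseteq> D \<and> holomorphic_branch m zs \<rho> w D) \<and>
     (\<forall>k::int. set_integrable lborel {-pi<..pi} (\<lambda>\<theta>. cis \<theta> powi k * w (cis \<theta>)) \<and>
               set_integrable lborel {-pi<..pi} (\<lambda>\<theta>. cis \<theta> powi k * deriv w (cis \<theta>)))"

(* The integral of f against d zeta / (2 pi i zeta) over the unit circle. *)
definition circle_mean :: "(complex \<Rightarrow> complex) \<Rightarrow> complex" where
  "circle_mean f = (LINT \<theta>:{-pi<..pi}|lborel. f (cis \<theta>)) / of_real (2 * pi)"

(* phib n is the polynomial written phi_n with a bar, independent of phi n up to the common
   leading coefficient; on the unit circle its argument is 1 / zeta. *)
definition biorthonormal ::
  "(complex \<Rightarrow> complex) \<Rightarrow> (nat \<Rightarrow> complex poly) \<Rightarrow> (nat \<Rightarrow> complex poly) \<Rightarrow> bool" where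
  "biorthonormal w \<phi> \<phi>b \<longleftrightarrow>
     (\<forall>n. degree (\<phi> n) = n \<and> degree (\<phi>b n) = n \<and> lead_coeff (\<phi> n) = lead_coeff (\<phi>b n)) \<and>
     (\<forall>k n. circle_mean (\<lambda>\<zeta>. w \<zeta> * poly (\<phi> k) \<zeta> * poly (\<phi>b n) (1 / \<zeta>)) = (if k = n then 1 else 0))"

(* z^n phib_n (1/z), including the value at z = 0, because phib n has degree exactly n. *)
definition recip :: "(nat \<Rightarrow> complex poly) \<Rightarrow> nat \<Rightarrow> complex poly" where
  "recip \<phi>b n = reflect_poly (\<phi>b n)"

(* The coefficient of z^(n-1) in the n-th polynomial; it vanishes for n = 0. *)
definition sub_coeff :: "(nat \<Rightarrow> complex poly) \<Rightarrow> nat \<Rightarrow> complex" where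
  "sub_coeff p n = (if n = 0 then 0 else coeff (p n) (n - 1))"

definition F_fun :: "(complex \<Rightarrow> complex) \<Rightarrow> complex \<Rightarrow> complex" where
  "F_fun w z = circle_mean (\<lambda>\<zeta>. (\<zeta> + z) / (\<zeta> - z) * w \<zeta>)"

definition psi ::
  "(complex \<Rightarrow> complex) \<Rightarrow> (nat \<Rightarrow> complex poly) \<Rightarrow> nat \<Rightarrow> complex \<Rightarrow> complex" where
  "psi w \<phi> n z =
     (if n = 0 then 1 / lead_coeff (\<phi> 0)
      else circle_mean (\<lambda>\<zeta>. (\<zeta> + z) / (\<zeta> - z) * w \<zeta> * (poly (\<phi> n) \<zeta> - poly (\<phi> n) z)))"

definition psi_star ::
  "(complex \<Rightarrow> complex) \<Rightarrow> (nat \<Rightarrow> complex poly) \<Rightarrow> nat \<Rightarrow> complex \<Rightarrow> complex" where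
  "psi_star w \<phi>b n z =
     (if n = 0 then 1 / lead_coeff (\<phi>b 0)
      else - circle_mean (\<lambda>\<zeta>. (\<zeta> + z) / (\<zeta> - z) * w \<zeta> *
                (z ^ n * poly (\<phi>b n) (1 / \<zeta>) - poly (recip \<phi>b n) z)))"

definition eps ::
  "(complex \<Rightarrow> complex) \<Rightarrow> (nat \<Rightarrow> complex poly) \<Rightarrow> nat \<Rightarrow> complex \<Rightarrow> complex" where
  "eps w \<phi> n z = psi w \<phi> n z + F_fun w z * poly (\<phi> n) z"

definition eps_star ::
  "(complex \<Rightarrow> complex) \<Rightarrow> (nat \<Rightarrow> complex poly) \<Rightarrow> nat \<Rightarrow> complex \<Rightarrow> complex" where
  "eps_star w \<phi>b n z = psi_star w \<phi>b n z - F_fun w z * poly (recip \<phi>b n) z"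

(* The four relations of index n, off the unit circle, where F and the eps functions live. *)
definition derivative_relations ::
  "(complex \<Rightarrow> complex) \<Rightarrow> (nat \<Rightarrow> complex poly) \<Rightarrow> (nat \<Rightarrow> complex poly) \<Rightarrow>
   complex poly \<Rightarrow> complex poly \<Rightarrow> nat \<Rightarrow>
   (complex \<Rightarrow> complex) \<Rightarrow> (complex \<Rightarrow> complex) \<Rightarrow> (complex \<Rightarrow> complex) \<Rightarrow> (complex \<Rightarrow> complex) \<Rightarrow> bool" where
  "derivative_relations w \<phi> \<phi>b W V n \<Theta> \<Omega> \<Theta>s \<Omega>s \<longleftrightarrow>
     (\<forall>z. cmod z \<noteq> 1 \<longrightarrow>
        poly W z * poly (pderiv (\<phi> n)) z
          = \<Theta> z * poly (\<phi> (n + 1)) z - (\<Omega> z + poly V z) * poly (\<phi> n) z \<and>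
        poly W z * deriv (eps w \<phi> n) z
          = \<Theta> z * eps w \<phi> (n + 1) z - (\<Omega> z - poly V z) * eps w \<phi> n z \<and>
        poly W z * poly (pderiv (recip \<phi>b n)) z
          = - \<Theta>s z * poly (recip \<phi>b (n + 1)) z + (\<Omega>s z - poly V z) * poly (recip \<phi>b n) z \<and>
        poly W z * deriv (eps_star w \<phi>b n) z
          = - \<Theta>s z * eps_star w \<phi>b (n + 1) z + (\<Omega>s z + poly V z) * eps_star w \<phi>b n z)"

(* f(z) = a z^d + b z^(d-1) + O(z^(d-2)) at infinity. The exponents are integers and may be
   negative; for a polynomial f the corresponding coefficient is then claimed to be 0. *)
definition top_expansion :: "(complex \<Rightarrow> complex) \<Rightarrow> int \<Rightarrow> complex \<Rightarrow> complex \<Rightarrow> bool" where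
  "top_expansion f d a b \<longleftrightarrow>
     (\<lambda>z. f z - (a * z powi d + b * z powi (d - 1))) \<in> O[at_infinity](\<lambda>z. z powi (d - 2))"

definition low_expansion :: "(complex \<Rightarrow> complex) \<Rightarrow> complex \<Rightarrow> complex \<Rightarrow> bool" where
  "low_expansion f a b \<longleftrightarrow> (\<lambda>z. f z - (a + b * z)) \<in> O[at 0](\<lambda>z. z ^ 2)"

(* Degree d in the generic sense: the coefficient c of z^d may vanish for special parameters,
   and the degree is exactly d as soon as it does not. *)
definition degree_lead :: "complex poly \<Rightarrow> nat \<Rightarrow> complex \<Rightarrow> bool" where
  "degree_lead p d c \<longleftrightarrow> degree p \<le> d \<and> coeff p d = c \<and> (c \<noteq> 0 \<longrightarrow> degree p = d)"

end

theory Submission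
  imports Defs "HOL-Complex_Analysis.Complex_Analysis"
begin

text \<open>Why the statement holds. Write \<open>L g\<close> for the mean of \<open>w g\<close> over the unit circle and \<open>C g (z)\<close>
for the Cauchy transform \<open>L (\<lambda>\<zeta>. g \<zeta> / (\<zeta> - z))\<close>. Only two properties of the weight enter: \<open>L\<close> is a bounded
linear functional on the continuous functions on the circle, and \<open>W w' = 2 V w\<close> can be integrated
by parts against the kernel \<open>1 / (\<zeta> - z)\<close>. The latter (\<open>weighted_integration_by_parts\<close>) needs no boundary
terms, because integrability of \<open>w'\<close> keeps \<open>w\<close> bounded near each \<open>z\<^sub>j\<close> on the circle, where \<open>W\<close> vanishes.

Existence of polynomial coefficients. The function \<open>\<epsilon>\<^sub>n\<close> differs from \<open>F \<phi>\<^sub>n\<close> by a polynomial, and integration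
by parts makes \<open>W F' - 2 V F\<close> a polynomial. Solving the two derivative relations for \<open>\<Theta>\<^sub>n\<close> and \<open>\<Omega>\<^sub>n\<close> by
Cramer's rule, \<open>F\<close> cancels from both numerators and from the determinant \<open>\<phi>\<^sub>n\<^sub>+\<^sub>1 \<epsilon>\<^sub>n - \<phi>\<^sub>n \<epsilon>\<^sub>n\<^sub>+\<^sub>1\<close>, so all
three are polynomials. By orthogonality \<open>\<epsilon>\<^sub>n\<close> is \<open>O(z\<^sup>n)\<close> at the origin and \<open>O(1/z)\<close> at infinity. This forces
the determinant to be \<open>c z\<^sup>n\<close>, with \<open>c\<close> proportional to \<open>\<phi>\<^sub>n\<^sub>+\<^sub>1(0)\<close>; since \<open>W\<close> vanishes at \<open>0\<close>, multiplication by
\<open>W\<close> compensates for the order lost in \<open>\<epsilon>\<^sub>n'\<close>, so \<open>z\<^sup>n\<close> divides both numerators, and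
the behaviour at infinity bounds their degrees. The determinant does not vanish off the origin, which
also gives uniqueness: the given functions agree with these polynomials.

Expansions. Comparing two-term expansions of the relations at \<open>0\<close> and at \<open>\<infinity>\<close> determines the
coefficients in a triangular way. In the \<open>\<epsilon>\<close>-relation \<open>\<epsilon>\<^sub>n\<^sub>+\<^sub>1\<close> is one order smaller at \<open>0\<close>, and its product with
\<open>\<Theta>\<^sub>n\<close> is one order smaller at \<open>\<infinity>\<close>, so it yields \<open>\<Omega>\<^sub>n\<close> to first order; the \<open>\<phi>\<close>-relation then yields \<open>\<Theta>\<^sub>n\<close> to first
order, and the same two steps repeat at second order. The expansion
coefficients of \<open>\<epsilon>\<^sub>n\<close> are the moments \<open>L (\<lambda>\<zeta>. \<zeta>\<^sup>k \<phi>\<^sub>n)\<close> with \<open>k\<close> in \<open>{-n-1, -n, 1, 2}\<close>, which follow from orthogonality and the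
recurrence \<open>\<kappa>\<^sub>n \<phi>\<^sub>n\<^sub>+\<^sub>1 = \<kappa>\<^sub>n\<^sub>+\<^sub>1 z \<phi>\<^sub>n + \<phi>\<^sub>n\<^sub>+\<^sub>1(0) \<phi>\<^sub>n\<^sup>*\<close>.

The starred system. The reflection \<open>\<zeta> \<mapsto> 1/\<zeta>\<close> turns \<open>L\<close> into a functional for which the two families change
places. If \<open>e\<^sub>n\<close> is the function of the second kind of the reflected pair, then \<open>\<epsilon>\<^sub>n\<^sup>*(z) = z\<^sup>n e\<^sub>n(1/z)\<close>, so its behaviour
at \<open>0\<close> is the behaviour of \<open>e\<^sub>n\<close> at infinity and conversely. The locale \<open>derivative_pair\<close> records what
both systems share: for the starred one \<open>F\<close> is replaced by \<open>- F\<close> and the coefficients by their negatives, and \<open>\<epsilon>\<^sub>n\<^sup>*\<close>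
has order \<open>n + 1\<close> at \<open>0\<close> and order \<open>0\<close> at infinity.\<close>

section \<open>Bounded functionals on the unit circle and their Cauchy transforms\<close>

abbreviation circle :: "complex set" where "circle \<equiv> sphere 0 1"

locale circle_functional =
  fixes L :: "(complex \<Rightarrow> complex) \<Rightarrow> complex"
  assumes add: "continuous_on circle f \<Longrightarrow> continuous_on circle g \<Longrightarrow> L (\<lambda>\<zeta>. f \<zeta> + g \<zeta>) = L f + L g"
    and scale: "continuous_on circle f \<Longrightarrow> L (\<lambda>\<zeta>. c * f \<zeta>) = c * L f"
    and bounded: "\<exists>M. \<forall>f B. continuous_on circle f \<longrightarrow> (\<forall>\<zeta>\<in>circle. norm (f \<zeta>) \<le> B) \<longrightarrow> norm (L f) \<le> M * B"

definition cauchy :: "((complex \<Rightarrow> complex) \<Rightarrow> complex) \<Rightarrow> (complex \<Rightarrow> complex) \<Rightarrow> complex \<Rightarrow> complex" where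
  "cauchy L g z = L (\<lambda>\<zeta>. g \<zeta> / (\<zeta> - z))"

text \<open>The functional that corresponds to the weight \<open>w (1/\<zeta>)\<close>, since the circle mean is invariant under
\<open>\<zeta> \<mapsto> 1/\<zeta>\<close>.\<close>
definition reflected :: "((complex \<Rightarrow> complex) \<Rightarrow> complex) \<Rightarrow> (complex \<Rightarrow> complex) \<Rightarrow> complex" where
  "reflected L g = L (\<lambda>\<zeta>. g (1 / \<zeta>))"

lemma continuous_on_circle_reflect:
  assumes "continuous_on circle g"
  shows "continuous_on circle (\<lambda>\<zeta>. g (1 / \<zeta>))"
proof -
  have "continuous_on circle (\<lambda>\<zeta>::complex. 1 / \<zeta>)"
    by (intro continuous_intros) auto
  then show ?thesis
    by (rule continuous_on_compose2[OF assms]) (auto simp: norm_divide)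
qed

lemma continuous_on_circle_kernel:
  assumes "continuous_on circle g" "norm z \<noteq> 1"
  shows "continuous_on circle (\<lambda>\<zeta>. g \<zeta> / (\<zeta> - z))"
  using assms by (intro continuous_intros) auto

lemma continuous_on_circle_quotient:
  assumes "continuous_on circle g"
  shows "continuous_on circle (\<lambda>\<zeta>. g \<zeta> / \<zeta> ^ k)"
  using assms by (intro continuous_intros) auto

context circle_functional
begin

lemma diff:
  assumes "continuous_on circle f" "continuous_on circle g"
  shows "L (\<lambda>\<zeta>. f \<zeta> - g \<zeta>) = L f - L g"
proof -
  have "L (\<lambda>\<zeta>. f \<zeta> + (-1) * g \<zeta>) = L f + (-1) * L g"
    using assms by (subst add) (auto intro!: continuous_intros scale simp: scale[of g "-1", simplified])
  then show ?thesis by simp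
qed

lemma L_cong:
  assumes "continuous_on circle f" "\<And>\<zeta>. norm \<zeta> = 1 \<Longrightarrow> f \<zeta> = g \<zeta>"
  shows "L f = L g"
proof -
  obtain M where M: "\<And>f B. continuous_on circle f \<Longrightarrow> (\<forall>\<zeta>\<in>circle. norm (f \<zeta>) \<le> B) \<Longrightarrow> norm (L f) \<le> M * B"
    using bounded by blast
  have g: "continuous_on circle g"
    using assms by (subst continuous_on_cong[OF refl, of _ _ f]) auto
  have "norm (L (\<lambda>\<zeta>. f \<zeta> - g \<zeta>)) \<le> M * 0"
    using assms g by (intro M continuous_intros) auto
  then show ?thesis
    by (simp add: diff assms(1) g)
qed

lemma L_sum:
  assumes "finite I" "\<And>i. i \<in> I \<Longrightarrow> continuous_on circle (f i)"
  shows "L (\<lambda>\<zeta>. \<Sum>i\<in>I. c i * f i \<zeta>) = (\<Sum>i\<in>I. c i * L (f i))"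
  using assms
proof (induction I rule: finite_induct)
  case empty
  then show ?case using scale[of "\<lambda>_. 0" 0] by simp
next
  case (insert i I)
  then have "L (\<lambda>\<zeta>. c i * f i \<zeta> + (\<Sum>i\<in>I. c i * f i \<zeta>)) = c i * L (f i) + L (\<lambda>\<zeta>. \<Sum>i\<in>I. c i * f i \<zeta>)"
    by (subst add) (auto intro!: continuous_intros scale)
  with insert show ?case by simp
qed

lemma reflected_functional: "circle_functional (reflected L)"
proof
  show "reflected L (\<lambda>\<zeta>. f \<zeta> + g \<zeta>) = reflected L f + reflected L g"
    if "continuous_on circle f" "continuous_on circle g" for f g
    using that by (simp add: reflected_def add continuous_on_circle_reflect)
  show "reflected L (\<lambda>\<zeta>. c * f \<zeta>) = c * reflected L f"
    if "continuous_on circle f" for f c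
    using that by (simp add: reflected_def scale continuous_on_circle_reflect)
  obtain M where M: "\<And>f B. continuous_on circle f \<Longrightarrow> (\<forall>\<zeta>\<in>circle. norm (f \<zeta>) \<le> B) \<Longrightarrow> norm (L f) \<le> M * B"
    using bounded by blast
  have "norm (reflected L f) \<le> M * B"
    if "continuous_on circle f" "\<forall>\<zeta>\<in>circle. norm (f \<zeta>) \<le> B" for f B
    unfolding reflected_def using that
    by (intro M continuous_on_circle_reflect) (auto simp: norm_divide)
  then show "\<exists>M. \<forall>f B. continuous_on circle f \<longrightarrow> (\<forall>\<zeta>\<in>circle. norm (f \<zeta>) \<le> B) \<longrightarrow>
        norm (reflected L f) \<le> M * B"
    by blast
qed

text \<open>The identity \<open>\<zeta> / (\<zeta> - z) = z / (\<zeta> - z) + 1\<close>. Iterated, it lets polynomial factors pass through the Cauchy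
transform up to polynomials, and it produces the expansions at \<open>0\<close> and at infinity.\<close>
lemma cauchy_mult_var:
  assumes "continuous_on circle g" "norm z \<noteq> 1"
  shows "cauchy L (\<lambda>\<zeta>. \<zeta> * g \<zeta>) z = z * cauchy L g z + L g"
proof -
  note k = continuous_on_circle_kernel[OF assms]
  have "cauchy L (\<lambda>\<zeta>. \<zeta> * g \<zeta>) z = L (\<lambda>\<zeta>. z * (g \<zeta> / (\<zeta> - z)) + g \<zeta>)"
    unfolding cauchy_def
  proof (rule L_cong)
    show "continuous_on circle (\<lambda>\<zeta>. \<zeta> * g \<zeta> / (\<zeta> - z))"
      using assms by (intro continuous_intros) auto
    fix \<zeta> :: complex assume "norm \<zeta> = 1"
    then have "\<zeta> - z \<noteq> 0" using assms by auto
    then show "\<zeta> * g \<zeta> / (\<zeta> - z) = z * (g \<zeta> / (\<zeta> - z)) + g \<zeta>"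
      by (simp add: field_simps)
  qed
  also have "\<dots> = z * cauchy L g z + L g"
    unfolding cauchy_def using assms k
    by (subst add) (auto intro!: continuous_intros simp del: times_divide_eq_right simp: scale)
  finally show ?thesis .
qed

lemma cauchy_add:
  assumes "continuous_on circle f" "continuous_on circle g" "norm z \<noteq> 1"
  shows "cauchy L (\<lambda>\<zeta>. f \<zeta> + g \<zeta>) z = cauchy L f z + cauchy L g z"
  unfolding cauchy_def using assms
  by (simp add: add_divide_distrib add continuous_on_circle_kernel)

lemma cauchy_scale:
  assumes "continuous_on circle f" "norm z \<noteq> 1"
  shows "cauchy L (\<lambda>\<zeta>. c * f \<zeta>) z = c * cauchy L f z"
  using scale[OF continuous_on_circle_kernel[OF assms], of c]
  unfolding cauchy_def by simp

lemma cauchy_mult_poly: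
  assumes "continuous_on circle g"
  shows "\<exists>U. \<forall>z. norm z \<noteq> 1 \<longrightarrow>
    cauchy L (\<lambda>\<zeta>. poly A \<zeta> * g \<zeta>) z = poly A z * cauchy L g z + poly U z"
proof (induction A)
  case 0
  show ?case
    using cauchy_scale[OF assms, of _ 0] by (intro exI[of _ 0]) simp
next
  case (pCons a A)
  then obtain U where U: "\<And>z. norm z \<noteq> 1 \<Longrightarrow>
    cauchy L (\<lambda>\<zeta>. poly A \<zeta> * g \<zeta>) z = poly A z * cauchy L g z + poly U z" by blast
  have cA: "continuous_on circle (\<lambda>\<zeta>. poly A \<zeta> * g \<zeta>)"
    using assms by (intro continuous_intros)
  have "cauchy L (\<lambda>\<zeta>. poly (pCons a A) \<zeta> * g \<zeta>) z
      = poly (pCons a A) z * cauchy L g z + poly (pCons (L (\<lambda>\<zeta>. poly A \<zeta> * g \<zeta>)) U) z"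
    if z: "norm z \<noteq> 1" for z
  proof -
    have "cauchy L (\<lambda>\<zeta>. poly (pCons a A) \<zeta> * g \<zeta>) z
        = cauchy L (\<lambda>\<zeta>. a * g \<zeta> + \<zeta> * (poly A \<zeta> * g \<zeta>)) z"
      by (simp add: algebra_simps)
    also have "\<dots> = a * cauchy L g z + (z * cauchy L (\<lambda>\<zeta>. poly A \<zeta> * g \<zeta>) z + L (\<lambda>\<zeta>. poly A \<zeta> * g \<zeta>))"
      using assms cA z
      by (subst cauchy_add) (auto intro!: continuous_intros simp: cauchy_scale cauchy_mult_var)
    finally show ?thesis unfolding U[OF z] by (simp add: distrib_left distrib_right mult.assoc)
  qed
  then show ?case by blast
qed

text \<open>The geometric expansion of the kernel at \<open>0\<close>: vanishing moments become a zero of the Cauchy transform.\<close>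
lemma cauchy_factor_power:
  assumes g: "continuous_on circle g" and z: "norm z \<noteq> 1"
    and van: "\<And>k. k < n \<Longrightarrow> L (\<lambda>\<zeta>. g \<zeta> / \<zeta> ^ Suc k) = 0"
  shows "cauchy L g z = z ^ n * cauchy L (\<lambda>\<zeta>. g \<zeta> / \<zeta> ^ n) z"
  using van
proof (induction n)
  case (Suc n)
  have "cauchy L (\<lambda>\<zeta>. g \<zeta> / \<zeta> ^ n) z = cauchy L (\<lambda>\<zeta>. \<zeta> * (g \<zeta> / \<zeta> ^ Suc n)) z"
    unfolding cauchy_def
    using z by (intro L_cong continuous_on_circle_kernel continuous_on_circle_quotient g) auto
  also have "\<dots> = z * cauchy L (\<lambda>\<zeta>. g \<zeta> / \<zeta> ^ Suc n) z"
    unfolding cauchy_mult_var[OF continuous_on_circle_quotient[OF g] z] Suc.prems[OF lessI] by simp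
  finally show ?case using Suc by simp
qed simp

lemma cauchy_polynomial_tail:
  assumes g: "continuous_on circle g"
  shows "\<exists>U. \<forall>z. norm z \<noteq> 1 \<longrightarrow>
     z ^ n * cauchy L (\<lambda>\<zeta>. g \<zeta> / \<zeta> ^ n) z = cauchy L g z + poly U z"
proof (induction n)
  case 0
  show ?case by (intro exI[of _ 0]) simp
next
  case (Suc n)
  then obtain U where U: "\<And>z. norm z \<noteq> 1 \<Longrightarrow>
     z ^ n * cauchy L (\<lambda>\<zeta>. g \<zeta> / \<zeta> ^ n) z = cauchy L g z + poly U z" by blast
  define c where "c = L (\<lambda>\<zeta>. g \<zeta> / \<zeta> ^ Suc n)"
  have "z ^ Suc n * cauchy L (\<lambda>\<zeta>. g \<zeta> / \<zeta> ^ Suc n) z = cauchy L g z + poly (U - monom c n) z"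
    if z: "norm z \<noteq> 1" for z
  proof -
    have "cauchy L (\<lambda>\<zeta>. g \<zeta> / \<zeta> ^ n) z = cauchy L (\<lambda>\<zeta>. \<zeta> * (g \<zeta> / \<zeta> ^ Suc n)) z"
      unfolding cauchy_def
      using z by (intro L_cong continuous_on_circle_kernel continuous_on_circle_quotient g) auto
    also have "\<dots> = z * cauchy L (\<lambda>\<zeta>. g \<zeta> / \<zeta> ^ Suc n) z + c"
      unfolding c_def by (rule cauchy_mult_var[OF continuous_on_circle_quotient[OF g] z])
    finally have "z * cauchy L (\<lambda>\<zeta>. g \<zeta> / \<zeta> ^ Suc n) z = cauchy L (\<lambda>\<zeta>. g \<zeta> / \<zeta> ^ n) z - c"
      by simp
    then have "z ^ n * (z * cauchy L (\<lambda>\<zeta>. g \<zeta> / \<zeta> ^ Suc n) z)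
        = z ^ n * cauchy L (\<lambda>\<zeta>. g \<zeta> / \<zeta> ^ n) z - z ^ n * c"
      by (simp add: right_diff_distrib)
    then show ?thesis
      by (simp add: U[OF z] poly_monom mult_ac)
  qed
  then show ?case by blast
qed

text \<open>Differentiation under the functional uses only boundedness. The difference quotient of \<open>C g\<close> at \<open>z\<close> is itself a
Cauchy transform, of \<open>g / (\<zeta> - z)\<close>, so differentiability reduces to continuity of Cauchy transforms, and continuity
follows from the same quotient formula once these transforms are bounded near \<open>z\<close>.\<close>
lemma cauchy_has_field_derivative:
  assumes g: "continuous_on circle g" and z: "norm z \<noteq> 1"
  shows "(cauchy L g has_field_derivative L (\<lambda>\<zeta>. g \<zeta> / (\<zeta> - z)\<^sup>2)) (at z)"
proof -
  have diffq: "cauchy L h v = cauchy L h z + (v - z) * cauchy L (\<lambda>\<zeta>. h \<zeta> / (\<zeta> - z)) v"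
    if h: "continuous_on circle h" and v: "norm v \<noteq> 1" for h v
  proof -
    have "cauchy L h v = cauchy L (\<lambda>\<zeta>. \<zeta> * (h \<zeta> / (\<zeta> - z)) + (- z) * (h \<zeta> / (\<zeta> - z))) v"
      unfolding cauchy_def
    proof (rule L_cong)
      show "continuous_on circle (\<lambda>\<zeta>. h \<zeta> / (\<zeta> - v))"
        by (rule continuous_on_circle_kernel[OF h v])
      fix \<zeta> :: complex assume "norm \<zeta> = 1"
      then have "\<zeta> - z \<noteq> 0" using z by auto
      moreover have "\<zeta> * (h \<zeta> / (\<zeta> - z)) + (- z) * (h \<zeta> / (\<zeta> - z)) = (\<zeta> - z) * (h \<zeta> / (\<zeta> - z))"
        by (simp only: distrib_right[symmetric] add_uminus_conv_diff)
      ultimately have "\<zeta> * (h \<zeta> / (\<zeta> - z)) + (- z) * (h \<zeta> / (\<zeta> - z)) = h \<zeta>"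
        by simp
      then show "h \<zeta> / (\<zeta> - v) = (\<zeta> * (h \<zeta> / (\<zeta> - z)) + (- z) * (h \<zeta> / (\<zeta> - z))) / (\<zeta> - v)"
        by simp
    qed
    also have "\<dots> = cauchy L (\<lambda>\<zeta>. \<zeta> * (h \<zeta> / (\<zeta> - z))) v + (- z) * cauchy L (\<lambda>\<zeta>. h \<zeta> / (\<zeta> - z)) v"
      unfolding cauchy_scale[OF continuous_on_circle_kernel[OF h z] v, symmetric]
      by (intro cauchy_add v continuous_on_mult continuous_on_circle_kernel h z continuous_intros)
    also have "\<dots> = v * cauchy L (\<lambda>\<zeta>. h \<zeta> / (\<zeta> - z)) v + L (\<lambda>\<zeta>. h \<zeta> / (\<zeta> - z))
        + (- z) * cauchy L (\<lambda>\<zeta>. h \<zeta> / (\<zeta> - z)) v"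
      using cauchy_mult_var[OF continuous_on_circle_kernel[OF h z] v] by simp
    finally show ?thesis
      by (simp add: cauchy_def algebra_simps)
  qed
  \<comment> \<open>Half the distance from \<open>z\<close> to the circle; points within \<open>\<delta>\<close> of \<open>z\<close> keep distance \<open>\<delta>\<close> from it.\<close>
  define \<delta> where "\<delta> = \<bar>1 - norm z\<bar> / 2"
  have \<delta>: "\<delta> > 0" using z by (simp add: \<delta>_def)
  have far: "norm (\<zeta> - v) \<ge> \<delta>" if "norm \<zeta> = 1" "v \<in> ball z \<delta>" for \<zeta> v
  proof -
    have "norm (\<zeta> - z) \<ge> 2 * \<delta>"
      using norm_triangle_ineq3[of \<zeta> z] that by (simp add: \<delta>_def)
    moreover have "norm (z - v) < \<delta>" using that by (simp add: dist_norm)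
    ultimately show ?thesis
      using norm_triangle_ineq[of "\<zeta> - v" "v - z"] by (simp add: norm_minus_commute)
  qed
  have off: "norm v \<noteq> 1" if "v \<in> ball z \<delta>" for v
    using far[of v v] that \<delta> by auto
  have cont: "isCont (cauchy L h) z" if h: "continuous_on circle h" for h
  proof -
    obtain M where M: "\<And>f B. continuous_on circle f \<Longrightarrow> (\<forall>\<zeta>\<in>circle. norm (f \<zeta>) \<le> B) \<Longrightarrow> norm (L f) \<le> M * B"
      using bounded by blast
    note hz = continuous_on_circle_kernel[OF h z]
    have "bounded ((\<lambda>\<zeta>. h \<zeta> / (\<zeta> - z)) ` circle)"
      using hz by (intro compact_imp_bounded compact_continuous_image) auto
    then obtain B where Bpos: "B > 0" and "\<forall>x\<in>(\<lambda>\<zeta>. h \<zeta> / (\<zeta> - z)) ` circle. norm x \<le> B"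
      unfolding bounded_pos by (elim exE conjE)
    then have B: "norm (h \<zeta> / (\<zeta> - z)) \<le> B" if "norm \<zeta> = 1" for \<zeta>
      using that by auto
    have "norm (cauchy L (\<lambda>\<zeta>. h \<zeta> / (\<zeta> - z)) v) \<le> M * (B / \<delta>)" if v: "v \<in> ball z \<delta>" for v
      unfolding cauchy_def
    proof (rule M)
      show "continuous_on circle (\<lambda>\<zeta>. h \<zeta> / (\<zeta> - z) / (\<zeta> - v))"
        by (rule continuous_on_circle_kernel[OF hz off[OF v]])
      show "\<forall>\<zeta>\<in>circle. norm (h \<zeta> / (\<zeta> - z) / (\<zeta> - v)) \<le> B / \<delta>"
      proof
        fix \<zeta> :: complex assume "\<zeta> \<in> circle"
        then have 1: "norm \<zeta> = 1" by simp
        have "norm (h \<zeta> / (\<zeta> - z)) / norm (\<zeta> - v) \<le> B / \<delta>"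
          using Bpos by (intro frac_le B 1 \<delta> far v) simp
        then show "norm (h \<zeta> / (\<zeta> - z) / (\<zeta> - v)) \<le> B / \<delta>"
          by (simp only: norm_divide)
      qed
    qed
    moreover have "\<forall>\<^sub>F v in at z. v \<in> ball z \<delta>"
      using \<delta> eventually_at_ball by (auto intro: eventually_mono)
    ultimately have "\<forall>\<^sub>F v in at z. norm (cauchy L h v - cauchy L h z) \<le> norm (v - z) * (M * (B / \<delta>))"
      using diffq[OF h off]
      by (elim eventually_mono) (simp add: norm_mult mult_left_mono del: times_divide_eq_right)
    moreover have "((\<lambda>v. norm (v - z) * (M * (B / \<delta>))) \<longlongrightarrow> 0) (at z)"
      by (intro tendsto_mult_left_zero) (simp add: LIM_zero_iff tendsto_norm_zero)
    ultimately have "((\<lambda>v. cauchy L h v - cauchy L h z) \<longlongrightarrow> 0) (at z)"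
      by (rule Lim_null_comparison)
    then show ?thesis
      unfolding isCont_def by (subst (asm) LIM_zero_iff)
  qed
  show ?thesis
    unfolding has_field_derivative_iff
  proof (rule Lim_transform_eventually)
    show "((\<lambda>v. cauchy L (\<lambda>\<zeta>. g \<zeta> / (\<zeta> - z)) v) \<longlongrightarrow> L (\<lambda>\<zeta>. g \<zeta> / (\<zeta> - z)\<^sup>2)) (at z)"
      using cont[OF continuous_on_circle_kernel[OF g z]]
      by (simp add: isCont_def cauchy_def[of L _ z] power2_eq_square)
    show "\<forall>\<^sub>F v in at z. cauchy L (\<lambda>\<zeta>. g \<zeta> / (\<zeta> - z)) v = (cauchy L g v - cauchy L g z) / (v - z)"
    proof -
      have "\<forall>\<^sub>F v in at z. v \<in> ball z \<delta>" using \<delta> eventually_at_ball by (auto intro: eventually_mono)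
      moreover have "\<forall>\<^sub>F v in at z. v \<noteq> z" by (simp add: eventually_at_filter)
      ultimately show ?thesis
        by eventually_elim (use diffq[OF g off] in auto)
    qed
  qed
qed

lemma cauchy_holomorphic:
  assumes "continuous_on circle g"
  shows "cauchy L g holomorphic_on - circle"
proof -
  have "open (- circle)" by (auto intro: open_Compl)
  moreover have "\<exists>f'. (cauchy L g has_field_derivative f') (at z)" if "z \<in> - circle" for z
    using cauchy_has_field_derivative[OF assms, of z] that by auto
  ultimately show ?thesis
    by (simp add: holomorphic_on_open)
qed

text \<open>Since \<open>z / (\<zeta> - z) = - \<zeta>\<^sup>-\<^sup>1 / (\<zeta>\<^sup>-\<^sup>1 - z\<^sup>-\<^sup>1)\<close>, a Cauchy transform near infinity is one of the reflected
functional near \<open>0\<close>. All expansions at infinity are obtained through this identity.\<close>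
lemma cauchy_reflected:
  assumes g: "continuous_on circle g" and z: "norm z \<noteq> 1" "z \<noteq> 0"
  shows "z * cauchy L g z = - cauchy (reflected L) (\<lambda>\<zeta>. \<zeta> * g (1 / \<zeta>)) (1 / z)"
proof -
  have "z * cauchy L g z = L (\<lambda>\<zeta>. z * (g \<zeta> / (\<zeta> - z)))"
    unfolding cauchy_def by (rule scale[symmetric]) (rule continuous_on_circle_kernel[OF g z(1)])
  also have "\<dots> = L (\<lambda>\<zeta>. (-1) * (1 / \<zeta> * g (1 / (1 / \<zeta>)) / (1 / \<zeta> - 1 / z)))"
  proof (rule L_cong)
    show "continuous_on circle (\<lambda>\<zeta>. z * (g \<zeta> / (\<zeta> - z)))"
      by (intro continuous_intros continuous_on_circle_kernel g z)
    fix \<zeta> :: complex assume "norm \<zeta> = 1"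
    then have "\<zeta> \<noteq> 0" "\<zeta> - z \<noteq> 0" "z - \<zeta> \<noteq> 0" using z by auto
    then show "z * (g \<zeta> / (\<zeta> - z)) = (-1) * (1 / \<zeta> * g (1 / (1 / \<zeta>)) / (1 / \<zeta> - 1 / z))"
      using z(2) by (simp add: divide_simps) (simp add: algebra_simps)
  qed
  also have "\<dots> = - cauchy (reflected L) (\<lambda>\<zeta>. \<zeta> * g (1 / \<zeta>)) (1 / z)"
  proof -
    have "continuous_on circle (\<lambda>\<zeta>. \<zeta> * g (1 / \<zeta>))"
      by (intro continuous_intros continuous_on_circle_reflect g)
    then have "continuous_on circle (\<lambda>\<zeta>. \<zeta> * g (1 / \<zeta>) / (\<zeta> - 1 / z))"
      using z by (intro continuous_on_circle_kernel) (auto simp: norm_divide)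
    from continuous_on_circle_reflect[OF this] show ?thesis
      unfolding cauchy_def reflected_def by (subst scale) simp_all
  qed
  finally show ?thesis .
qed

end

section \<open>Biorthogonal polynomials and functions of the second kind\<close>

text \<open>Here \<open>p n\<close> and \<open>q n\<close> stand for \<open>\<phi>\<^sub>n\<close> and its barred companion.\<close>
locale biorthogonal_pair = circle_functional L for L +
  fixes p q :: "nat \<Rightarrow> complex poly"
  assumes degree_p: "degree (p n) = n"
    and degree_q: "degree (q n) = n"
    and lead_coeff_eq: "lead_coeff (p n) = lead_coeff (q n)"
    and biorthonormal: "L (\<lambda>\<zeta>. poly (p k) \<zeta> * poly (q n) (1 / \<zeta>)) = (if k = n then 1 else 0)"
begin

abbreviation \<kappa> :: "nat \<Rightarrow> complex" where "\<kappa> n \<equiv> lead_coeff (p n)"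

text \<open>The symmetry that exchanges the two families and thereby halves the work below.\<close>
lemma reflected_pair: "biorthogonal_pair (reflected L) q p"
proof -
  interpret R: circle_functional "reflected L" by (rule reflected_functional)
  show ?thesis
  proof
    show "degree (q n) = n" "degree (p n) = n" "lead_coeff (q n) = lead_coeff (p n)" for n
      by (rule degree_q degree_p lead_coeff_eq[symmetric])+
    show "reflected L (\<lambda>\<zeta>. poly (q k) \<zeta> * poly (p n) (1 / \<zeta>)) = (if k = n then 1 else 0)" for k n
      using biorthonormal[of n k] by (simp add: reflected_def mult.commute)
  qed
qed

lemma \<kappa>_nonzero: "\<kappa> n \<noteq> 0"
proof
  assume "\<kappa> n = 0"
  then have "p n = 0" by simp
  then show False
    using biorthonormal[of n n] scale[of "\<lambda>_. 0" 0] by simp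
qed

lemma coeff_q_top: "coeff (q n) n = \<kappa> n"
  using lead_coeff_eq[of n] by (simp add: degree_p degree_q)

lemma L_mult_reflected_poly:
  assumes g: "continuous_on circle g" and "degree A \<le> N"
  shows "L (\<lambda>\<zeta>. g \<zeta> * poly A (1 / \<zeta>)) = (\<Sum>i\<le>N. coeff A i * L (\<lambda>\<zeta>. g \<zeta> / \<zeta> ^ i))"
proof -
  have "g \<zeta> * poly A (1 / \<zeta>) = (\<Sum>i\<le>N. coeff A i * (g \<zeta> / \<zeta> ^ i))" for \<zeta>
  proof -
    have "poly A (1 / \<zeta>) = (\<Sum>i\<le>N. coeff A i * (1 / \<zeta>) ^ i)"
      unfolding poly_altdef
      using assms by (intro sum.mono_neutral_left) (auto simp: coeff_eq_0)
    then show ?thesis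
      by (simp add: sum_distrib_left power_divide mult.commute)
  qed
  then show ?thesis
    by (simp only:) (intro L_sum finite_atMost continuous_on_circle_quotient g)
qed

lemma continuous_on_circle_poly: "continuous_on circle (poly A)"
  by (intro continuous_intros)

lemma continuous_on_circle_poly_reflect: "continuous_on circle (\<lambda>\<zeta>. poly A (1 / \<zeta>))"
  by (intro continuous_on_circle_reflect continuous_on_circle_poly)

text \<open>The functions \<open>q j (1/\<zeta>)\<close> with \<open>j \<le> k\<close> span the same space as the monomials \<open>\<zeta>\<^sup>-\<^sup>j\<close> with \<open>j \<le> k\<close>.\<close>
lemma orthogonal_lower:
  assumes "k < n"
  shows "L (\<lambda>\<zeta>. poly (p n) \<zeta> / \<zeta> ^ k) = 0"
  using assms
proof (induction k rule: less_induct)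
  case (less k)
  have "0 = L (\<lambda>\<zeta>. poly (p n) \<zeta> * poly (q k) (1 / \<zeta>))"
    using less.prems biorthonormal[of n k] by simp
  also have "\<dots> = (\<Sum>i\<le>k. coeff (q k) i * L (\<lambda>\<zeta>. poly (p n) \<zeta> / \<zeta> ^ i))"
    by (intro L_mult_reflected_poly continuous_on_circle_poly) (simp add: degree_q)
  also have "\<dots> = (\<Sum>i\<in>{k}. coeff (q k) i * L (\<lambda>\<zeta>. poly (p n) \<zeta> / \<zeta> ^ i))"
    using less by (intro sum.mono_neutral_right) auto
  finally show ?case
    using \<kappa>_nonzero[of k] by (simp add: coeff_q_top)
qed

lemma orthogonal_top: "L (\<lambda>\<zeta>. poly (p n) \<zeta> / \<zeta> ^ n) = 1 / \<kappa> n"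
proof -
  have "1 = L (\<lambda>\<zeta>. poly (p n) \<zeta> * poly (q n) (1 / \<zeta>))"
    using biorthonormal[of n n] by simp
  also have "\<dots> = (\<Sum>i\<le>n. coeff (q n) i * L (\<lambda>\<zeta>. poly (p n) \<zeta> / \<zeta> ^ i))"
    by (intro L_mult_reflected_poly continuous_on_circle_poly) (simp add: degree_q)
  also have "\<dots> = (\<Sum>i\<in>{n}. coeff (q n) i * L (\<lambda>\<zeta>. poly (p n) \<zeta> / \<zeta> ^ i))"
    by (intro sum.mono_neutral_right) (auto simp: orthogonal_lower)
  finally show ?thesis
    using \<kappa>_nonzero[of n] by (simp add: coeff_q_top field_simps)
qed

text \<open>The first moment beyond the orthogonality range: pair \<open>p n\<close> with \<open>q (n + 1)\<close>; only the two highest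
coefficients of the latter contribute.\<close>
lemma orthogonal_beyond:
  "L (\<lambda>\<zeta>. poly (p n) \<zeta> / \<zeta> ^ Suc n) = - coeff (q (Suc n)) n / (\<kappa> n * \<kappa> (Suc n))"
proof -
  have "0 = L (\<lambda>\<zeta>. poly (p n) \<zeta> * poly (q (Suc n)) (1 / \<zeta>))"
    using biorthonormal[of n "Suc n"] by simp
  also have "\<dots> = (\<Sum>i\<le>Suc n. coeff (q (Suc n)) i * L (\<lambda>\<zeta>. poly (p n) \<zeta> / \<zeta> ^ i))"
    by (intro L_mult_reflected_poly continuous_on_circle_poly) (simp add: degree_q)
  also have "\<dots> = (\<Sum>i\<in>{n, Suc n}. coeff (q (Suc n)) i * L (\<lambda>\<zeta>. poly (p n) \<zeta> / \<zeta> ^ i))"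
    by (intro sum.mono_neutral_right) (auto simp: orthogonal_lower)
  finally show ?thesis
    using \<kappa>_nonzero[of n] \<kappa>_nonzero[of "Suc n"]
    by (simp add: coeff_q_top orthogonal_top field_simps add_eq_0_iff)
qed

lemma reflected_orthogonal:
  "k < n \<Longrightarrow> L (\<lambda>\<zeta>. \<zeta> ^ k * poly (q n) (1 / \<zeta>)) = 0"
  "L (\<lambda>\<zeta>. \<zeta> ^ n * poly (q n) (1 / \<zeta>)) = 1 / \<kappa> n" (is ?second_solution)
  "L (\<lambda>\<zeta>. \<zeta> ^ Suc n * poly (q n) (1 / \<zeta>)) = - coeff (p (Suc n)) n / (\<kappa> n * \<kappa> (Suc n))" (is ?third)
proof -
  interpret R: biorthogonal_pair "reflected L" q p by (rule reflected_pair)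
  have eq: "L (\<lambda>\<zeta>. \<zeta> ^ k * poly (q n) (1 / \<zeta>)) = reflected L (\<lambda>\<zeta>. poly (q n) \<zeta> / \<zeta> ^ k)" for k
    unfolding reflected_def by (simp add: power_divide mult.commute)
  show "k < n \<Longrightarrow> L (\<lambda>\<zeta>. \<zeta> ^ k * poly (q n) (1 / \<zeta>)) = 0"
    unfolding eq by (rule R.orthogonal_lower)
  show ?second_solution
    unfolding eq by (simp only: R.orthogonal_top lead_coeff_eq)
  show ?third
    unfolding eq by (simp only: R.orthogonal_beyond lead_coeff_eq)
qed

text \<open>Otherwise pairing \<open>A\<close> with \<open>q D (1/\<zeta>)\<close>, where \<open>D = degree A\<close>, gives both \<open>0\<close> and the leading coefficient
of \<open>A\<close> divided by \<open>\<kappa> D\<close>.\<close>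
lemma orthogonal_imp_zero:
  assumes "\<And>j. j \<le> degree A \<Longrightarrow> L (\<lambda>\<zeta>. poly A \<zeta> / \<zeta> ^ j) = 0"
  shows "A = 0"
proof -
  define D where "D = degree A"
  have "0 = L (\<lambda>\<zeta>. poly A \<zeta> * poly (q D) (1 / \<zeta>))"
    by (subst L_mult_reflected_poly[of _ _ D])
       (auto simp: continuous_on_circle_poly degree_q assms D_def)
  also have "\<dots> = L (\<lambda>\<zeta>. \<Sum>i\<le>D. coeff A i * (\<zeta> ^ i * poly (q D) (1 / \<zeta>)))"
    by (subst poly_altdef) (simp add: sum_distrib_right D_def mult.assoc)
  also have "\<dots> = (\<Sum>i\<le>D. coeff A i * L (\<lambda>\<zeta>. \<zeta> ^ i * poly (q D) (1 / \<zeta>)))"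
    by (intro L_sum finite_atMost continuous_intros continuous_on_circle_poly_reflect continuous_on_circle_poly)
  also have "\<dots> = (\<Sum>i\<in>{D}. coeff A i * L (\<lambda>\<zeta>. \<zeta> ^ i * poly (q D) (1 / \<zeta>)))"
    by (intro sum.mono_neutral_right) (auto simp: reflected_orthogonal)
  finally have "coeff A D = 0"
    using \<kappa>_nonzero[of D] by (simp add: reflected_orthogonal)
  then show ?thesis by (simp add: D_def)
qed

lemma poly_reflect_q:
  "\<zeta> \<noteq> 0 \<Longrightarrow> poly (reflect_poly (q n)) \<zeta> = \<zeta> ^ n * poly (q n) (1 / \<zeta>)"
  by (subst poly_reflect_poly_nz) (auto simp: degree_q inverse_eq_divide)

text \<open>The Szego recurrence. The difference \<open>X\<close> of the two sides has degree at most \<open>n\<close> and vanishes at \<open>0\<close>, because the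
leading terms and the constant terms cancel; and \<open>X / \<zeta>\<close> is orthogonal to \<open>\<zeta>\<^sup>j\<close> for \<open>j < n\<close>, so it vanishes.\<close>
lemma recurrence:
  "smult (\<kappa> n) (p (Suc n))
     = smult (\<kappa> (Suc n)) (pCons 0 (p n)) + smult (coeff (p (Suc n)) 0) (reflect_poly (q n))"
proof -
  define X where "X = smult (\<kappa> n) (p (Suc n)) - smult (\<kappa> (Suc n)) (pCons 0 (p n))
     - smult (coeff (p (Suc n)) 0) (reflect_poly (q n))"
  have "coeff X 0 = 0"
    by (simp add: X_def coeff_q_top degree_q)
  then obtain Y where Y: "X = pCons 0 Y"
    by (metis pCons_cases coeff_pCons_0)
  have "coeff X i = 0" if "i > n" for i
  proof (cases "i = Suc n")
    case True
    then show ?thesis by (simp add: X_def coeff_reflect_poly degree_p degree_q)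
  next
    case False
    with that have "i > Suc n" by simp
    then have "coeff (p (Suc n)) i = 0" "coeff (p n) (i - 1) = 0"
      by (auto intro!: coeff_eq_0 simp: degree_p)
    then show ?thesis
      using that by (cases i) (simp_all add: X_def coeff_reflect_poly degree_q)
  qed
  then have Y0: "coeff Y i = 0" if "i \<ge> n" for i
    using \<open>\<And>i. i > n \<Longrightarrow> coeff X i = 0\<close>[of "Suc i"] that by (simp add: Y)
  have "Y = 0"
  proof (cases n)
    case 0
    then show ?thesis using Y0 by (intro poly_eqI) simp
  next
    case (Suc n')
    then have dY: "degree Y < n"
      using Y0 by (metis degree_le le_imp_less_Suc less_Suc_eq_le not_less_eq)
    show ?thesis
    proof (rule orthogonal_imp_zero)
      fix j assume "j \<le> degree Y"
      with dY have j: "j < n" by simp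
      have "L (\<lambda>\<zeta>. poly Y \<zeta> / \<zeta> ^ j) = L (\<lambda>\<zeta>. \<kappa> n * (poly (p (Suc n)) \<zeta> / \<zeta> ^ Suc j)
          - (\<kappa> (Suc n) * (poly (p n) \<zeta> / \<zeta> ^ j)
          + coeff (p (Suc n)) 0 * (\<zeta> ^ (n - Suc j) * poly (q n) (1 / \<zeta>))))"
      proof (rule L_cong)
        show "continuous_on circle (\<lambda>\<zeta>. poly Y \<zeta> / \<zeta> ^ j)"
          by (intro continuous_on_circle_quotient continuous_on_circle_poly)
        fix \<zeta> :: complex assume "norm \<zeta> = 1"
        then have nz: "\<zeta> \<noteq> 0" by auto
        have "poly Y \<zeta> / \<zeta> ^ j = poly X \<zeta> / \<zeta> ^ Suc j"
          using nz by (simp add: Y)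
        also have "poly X \<zeta> = \<kappa> n * poly (p (Suc n)) \<zeta> - \<kappa> (Suc n) * (\<zeta> * poly (p n) \<zeta>)
            - coeff (p (Suc n)) 0 * (\<zeta> ^ (n - Suc j) * \<zeta> ^ Suc j * poly (q n) (1 / \<zeta>))"
          using nz j unfolding power_add[symmetric] by (simp add: X_def poly_reflect_q)
        finally show "poly Y \<zeta> / \<zeta> ^ j = \<kappa> n * (poly (p (Suc n)) \<zeta> / \<zeta> ^ Suc j)
          - (\<kappa> (Suc n) * (poly (p n) \<zeta> / \<zeta> ^ j)
          + coeff (p (Suc n)) 0 * (\<zeta> ^ (n - Suc j) * poly (q n) (1 / \<zeta>)))"
          using nz by (simp add: field_simps)
      qed
      also have "\<dots> = L (\<lambda>\<zeta>. \<kappa> n * (poly (p (Suc n)) \<zeta> / \<zeta> ^ Suc j))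
          - (L (\<lambda>\<zeta>. \<kappa> (Suc n) * (poly (p n) \<zeta> / \<zeta> ^ j))
          + L (\<lambda>\<zeta>. coeff (p (Suc n)) 0 * (\<zeta> ^ (n - Suc j) * poly (q n) (1 / \<zeta>))))"
        by (subst diff add; (intro continuous_intros continuous_on_circle_poly_reflect continuous_on_circle_poly; auto)?)+ simp
      also have "L (\<lambda>\<zeta>. \<kappa> n * (poly (p (Suc n)) \<zeta> / \<zeta> ^ Suc j)) = 0"
        unfolding scale[OF continuous_on_circle_quotient[OF continuous_on_circle_poly]]
        using j orthogonal_lower[of "Suc j" "Suc n"] by simp
      also have "L (\<lambda>\<zeta>. \<kappa> (Suc n) * (poly (p n) \<zeta> / \<zeta> ^ j)) = 0"
        unfolding scale[OF continuous_on_circle_quotient[OF continuous_on_circle_poly]]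
        using j orthogonal_lower by simp
      also have "L (\<lambda>\<zeta>. coeff (p (Suc n)) 0 * (\<zeta> ^ (n - Suc j) * poly (q n) (1 / \<zeta>))) = 0"
        by (subst scale)
           (use j reflected_orthogonal(1)[of "n - Suc j" n] in
             \<open>auto intro!: continuous_intros continuous_on_circle_poly_reflect continuous_on_circle_poly\<close>)
      finally show "L (\<lambda>\<zeta>. poly Y \<zeta> / \<zeta> ^ j) = 0" by simp
    qed
  qed
  then have "X = 0" by (simp add: Y)
  then show ?thesis by (simp add: X_def algebra_simps)
qed

lemma coeff_recurrence:
  "\<kappa> n * coeff (p (Suc n)) 1 = \<kappa> (Suc n) * coeff (p n) 0 + coeff (p (Suc n)) 0 * sub_coeff q n" (is ?first)
  "\<kappa> n * sub_coeff p (Suc n) = \<kappa> (Suc n) * sub_coeff p n + coeff (p (Suc n)) 0 * coeff (q n) 0" (is ?second_solution)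
proof -
  have "coeff (reflect_poly (q n)) 1 = sub_coeff q n"
    by (auto simp: coeff_reflect_poly degree_q sub_coeff_def)
  then show ?first
    using arg_cong[OF recurrence[of n], of "\<lambda>a. coeff a 1"] by simp
  show ?second_solution
    using arg_cong[OF recurrence[of n], of "\<lambda>a. coeff a n"]
    by (cases n) (auto simp: coeff_reflect_poly degree_q sub_coeff_def)
qed

lemma L_recurrence:
  assumes g: "continuous_on circle g"
  shows "\<kappa> n * L (\<lambda>\<zeta>. g \<zeta> * poly (p (Suc n)) \<zeta>)
     = \<kappa> (Suc n) * L (\<lambda>\<zeta>. g \<zeta> * \<zeta> * poly (p n) \<zeta>)
       + coeff (p (Suc n)) 0 * L (\<lambda>\<zeta>. g \<zeta> * (\<zeta> ^ n * poly (q n) (1 / \<zeta>)))"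
proof -
  note [continuous_intros] = continuous_on_circle_poly_reflect continuous_on_circle_poly g
  have "\<kappa> n * L (\<lambda>\<zeta>. g \<zeta> * poly (p (Suc n)) \<zeta>) = L (\<lambda>\<zeta>. \<kappa> n * (g \<zeta> * poly (p (Suc n)) \<zeta>))"
    by (rule scale[symmetric]) (intro continuous_intros)
  also have "\<dots> = L (\<lambda>\<zeta>. \<kappa> (Suc n) * (g \<zeta> * \<zeta> * poly (p n) \<zeta>)
       + coeff (p (Suc n)) 0 * (g \<zeta> * (\<zeta> ^ n * poly (q n) (1 / \<zeta>))))"
  proof (rule L_cong)
    show "continuous_on circle (\<lambda>\<zeta>. \<kappa> n * (g \<zeta> * poly (p (Suc n)) \<zeta>))"
      by (intro continuous_intros)
    fix \<zeta> :: complex assume "norm \<zeta> = 1"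
    then have nz: "\<zeta> \<noteq> 0" by auto
    have "\<kappa> n * poly (p (Suc n)) \<zeta> = \<kappa> (Suc n) * (\<zeta> * poly (p n) \<zeta>)
        + coeff (p (Suc n)) 0 * (\<zeta> ^ n * poly (q n) (1 / \<zeta>))"
      using arg_cong[OF recurrence[of n], of "\<lambda>a. poly a \<zeta>"] nz by (simp add: poly_reflect_q)
    then have "g \<zeta> * (\<kappa> n * poly (p (Suc n)) \<zeta>) = g \<zeta> * (\<kappa> (Suc n) * (\<zeta> * poly (p n) \<zeta>)
        + coeff (p (Suc n)) 0 * (\<zeta> ^ n * poly (q n) (1 / \<zeta>)))" by simp
    then show "\<kappa> n * (g \<zeta> * poly (p (Suc n)) \<zeta>) = \<kappa> (Suc n) * (g \<zeta> * \<zeta> * poly (p n) \<zeta>)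
       + coeff (p (Suc n)) 0 * (g \<zeta> * (\<zeta> ^ n * poly (q n) (1 / \<zeta>)))"
      by (simp add: algebra_simps)
  qed
  also have "\<dots> = \<kappa> (Suc n) * L (\<lambda>\<zeta>. g \<zeta> * \<zeta> * poly (p n) \<zeta>)
       + coeff (p (Suc n)) 0 * L (\<lambda>\<zeta>. g \<zeta> * (\<zeta> ^ n * poly (q n) (1 / \<zeta>)))"
  proof -
    have c: "continuous_on circle (\<lambda>\<zeta>. g \<zeta> * \<zeta> * poly (p n) \<zeta>)"
      "continuous_on circle (\<lambda>\<zeta>. g \<zeta> * (\<zeta> ^ n * poly (q n) (1 / \<zeta>)))"
      by (intro continuous_intros)+
    show ?thesis
      unfolding scale[OF c(1), symmetric] scale[OF c(2), symmetric]
      by (intro add continuous_intros)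
  qed
  finally show ?thesis .
qed

lemma L_shift: "L (\<lambda>\<zeta>. \<zeta> * poly (p n) \<zeta>) = - coeff (p (Suc n)) 0 / (\<kappa> n * \<kappa> (Suc n))"
  using L_recurrence[of "\<lambda>_. 1" n] orthogonal_lower[of 0 "Suc n"] reflected_orthogonal(2)[of n]
    \<kappa>_nonzero[of n] \<kappa>_nonzero[of "Suc n"]
  by (simp add: field_simps add_eq_0_iff)

text \<open>Multiply the recurrence by \<open>\<zeta>\<close> and apply \<open>L\<close>: the moment of the reversed polynomial lies just beyond its
orthogonality range and brings in the subleading coefficient.\<close>
lemma L_shift2:
  "L (\<lambda>\<zeta>. \<zeta> * \<zeta> * poly (p n) \<zeta>)
     = (coeff (p (Suc n)) 0 * sub_coeff p (Suc n) / (\<kappa> n * \<kappa> (Suc n))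
        - \<kappa> n * coeff (p (Suc (Suc n))) 0 / (\<kappa> (Suc n) * \<kappa> (Suc (Suc n)))) / \<kappa> (Suc n)"
proof -
  have "\<kappa> n * L (\<lambda>\<zeta>. \<zeta> * poly (p (Suc n)) \<zeta>) = \<kappa> (Suc n) * L (\<lambda>\<zeta>. \<zeta> * \<zeta> * poly (p n) \<zeta>)
     + coeff (p (Suc n)) 0 * L (\<lambda>\<zeta>. \<zeta> ^ Suc n * poly (q n) (1 / \<zeta>))"
    using L_recurrence[of "\<lambda>\<zeta>. \<zeta>" n] by (simp add: mult.assoc)
  then have "\<kappa> (Suc n) * L (\<lambda>\<zeta>. \<zeta> * \<zeta> * poly (p n) \<zeta>)
     = coeff (p (Suc n)) 0 * sub_coeff p (Suc n) / (\<kappa> n * \<kappa> (Suc n))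
        - \<kappa> n * coeff (p (Suc (Suc n))) 0 / (\<kappa> (Suc n) * \<kappa> (Suc (Suc n)))"
    unfolding L_shift reflected_orthogonal(3) by (simp add: sub_coeff_def eq_diff_eq)
  then show ?thesis
    using \<kappa>_nonzero[of "Suc n"] by (simp add: eq_divide_eq mult.commute)
qed

text \<open>The recurrence tested against \<open>\<zeta>\<^sup>-\<^sup>n\<^sup>-\<^sup>1\<close>.\<close>
lemma \<kappa>_square: "\<kappa> (Suc n) ^ 2 - \<kappa> n ^ 2 = coeff (p (Suc n)) 0 * coeff (q (Suc n)) 0"
proof -
  interpret R: biorthogonal_pair "reflected L" q p by (rule reflected_pair)
  have c: "continuous_on circle (\<lambda>\<zeta>. 1 / \<zeta> ^ Suc n)"
    by (intro continuous_on_circle_quotient continuous_intros)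
  have "\<kappa> n * L (\<lambda>\<zeta>. poly (p (Suc n)) \<zeta> / \<zeta> ^ Suc n)
     = \<kappa> (Suc n) * L (\<lambda>\<zeta>. 1 / \<zeta> ^ Suc n * \<zeta> * poly (p n) \<zeta>)
      + coeff (p (Suc n)) 0 * L (\<lambda>\<zeta>. 1 / \<zeta> ^ Suc n * (\<zeta> ^ n * poly (q n) (1 / \<zeta>)))"
    using L_recurrence[OF c, of n] by simp
  also have "L (\<lambda>\<zeta>. 1 / \<zeta> ^ Suc n * \<zeta> * poly (p n) \<zeta>) = L (\<lambda>\<zeta>. poly (p n) \<zeta> / \<zeta> ^ n)"
    by (rule L_cong, intro continuous_intros) auto
  also have "\<dots> = 1 / \<kappa> n" by (rule orthogonal_top)
  also have "L (\<lambda>\<zeta>. 1 / \<zeta> ^ Suc n * (\<zeta> ^ n * poly (q n) (1 / \<zeta>))) = L (\<lambda>\<zeta>. 1 / \<zeta> * poly (q n) (1 / \<zeta>))"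
    by (rule L_cong, intro continuous_intros continuous_on_circle_poly_reflect) auto
  also have "\<dots> = - coeff (q (Suc n)) 0 / (\<kappa> n * \<kappa> (Suc n))"
    using R.L_shift[of n] by (simp only: reflected_def lead_coeff_eq)
  also note orthogonal_top[of "Suc n"]
  finally have "\<kappa> n * (\<kappa> (Suc n) ^ 2 - \<kappa> n ^ 2) = \<kappa> n * (coeff (p (Suc n)) 0 * coeff (q (Suc n)) 0)"
    using \<kappa>_nonzero[of n] \<kappa>_nonzero[of "Suc n"]
    by (simp add: field_simps power2_eq_square)
  then show ?thesis
    using \<kappa>_nonzero[of n] mult_cancel_left by blast
qed

text \<open>For \<open>n \<ge> 1\<close> the kernel \<open>(\<zeta> + z) / (\<zeta> - z) = 2 \<zeta> / (\<zeta> - z) - 1\<close> may lose its constant, since \<open>L (p n) = 0\<close>;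
with the convention for \<open>n = 0\<close> this gives \<open>\<epsilon>\<^sub>n\<close> for every \<open>n\<close>.\<close>
definition second_solution :: "nat \<Rightarrow> complex \<Rightarrow> complex" where
  "second_solution n z = 2 * cauchy L (\<lambda>\<zeta>. \<zeta> * poly (p n) \<zeta>) z"

lemma continuous_on_circle_id_mult_poly: "continuous_on circle (\<lambda>\<zeta>. \<zeta> * poly (p n) \<zeta>)"
  by (intro continuous_intros)

text \<open>Orthogonality to \<open>\<zeta>\<^sup>k\<close> for \<open>k < n\<close> gives a zero of order \<open>n\<close> at \<open>0\<close>; the next two moments are the first two
coefficients. The factor \<open>E\<close> is a Cauchy transform and therefore holomorphic on both sides of the circle.\<close>
lemma second_solution_at_zero:
  obtains E where "E holomorphic_on - circle" "\<And>z. norm z \<noteq> 1 \<Longrightarrow> second_solution n z = z ^ n * E z"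
    "E 0 = 2 / \<kappa> n" "deriv E 0 = - 2 * sub_coeff q (Suc n) / (\<kappa> n * \<kappa> (Suc n))"
proof
  let ?g = "\<lambda>\<zeta>. \<zeta> * poly (p n) \<zeta> / \<zeta> ^ n"
  have g: "continuous_on circle ?g"
    by (intro continuous_on_circle_quotient continuous_on_circle_id_mult_poly)
  let ?E = "\<lambda>z. 2 * cauchy L ?g z"
  show "?E holomorphic_on - circle"
    by (intro holomorphic_intros cauchy_holomorphic g)
  have shift: "L (\<lambda>\<zeta>. \<zeta> * poly (p n) \<zeta> / \<zeta> ^ Suc k) = L (\<lambda>\<zeta>. poly (p n) \<zeta> / \<zeta> ^ k)" for k
    by (rule L_cong, intro continuous_intros) auto
  show "second_solution n z = z ^ n * ?E z" if "norm z \<noteq> 1" for z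
    unfolding second_solution_def
    by (subst cauchy_factor_power[of _ _ n, OF continuous_on_circle_id_mult_poly that])
       (simp_all only: shift orthogonal_lower mult.left_commute)
  have "cauchy L ?g 0 = L (\<lambda>\<zeta>. poly (p n) \<zeta> / \<zeta> ^ n)"
    unfolding cauchy_def by (rule L_cong, intro continuous_intros) auto
  then show "?E 0 = 2 / \<kappa> n" by (simp add: orthogonal_top)
  have "(cauchy L ?g has_field_derivative L (\<lambda>\<zeta>. ?g \<zeta> / (\<zeta> - 0)\<^sup>2)) (at 0)"
    by (rule cauchy_has_field_derivative[OF g]) simp
  moreover have "L (\<lambda>\<zeta>. ?g \<zeta> / (\<zeta> - 0)\<^sup>2) = L (\<lambda>\<zeta>. poly (p n) \<zeta> / \<zeta> ^ Suc n)"
    by (rule L_cong, intro continuous_intros) (auto simp: power2_eq_square)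
  ultimately have "(?E has_field_derivative 2 * L (\<lambda>\<zeta>. poly (p n) \<zeta> / \<zeta> ^ Suc n)) (at 0)"
    by (auto intro!: derivative_eq_intros)
  then show "deriv ?E 0 = - 2 * sub_coeff q (Suc n) / (\<kappa> n * \<kappa> (Suc n))"
    unfolding orthogonal_beyond by (auto dest!: DERIV_imp_deriv simp: sub_coeff_def)
qed

text \<open>The moments of \<open>\<zeta> p n\<close> and \<open>\<zeta>\<^sup>2 p n\<close>, read off from the reflected functional.\<close>
lemma second_solution_at_infinity:
  obtains T where "T holomorphic_on - circle"
    "\<And>z. norm z \<noteq> 1 \<Longrightarrow> z \<noteq> 0 \<Longrightarrow> z * second_solution n z = T (1 / z)"
    "T 0 = 2 * coeff (p (Suc n)) 0 / (\<kappa> n * \<kappa> (Suc n))"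
    "deriv T 0 = - 2 * (coeff (p (Suc n)) 0 * sub_coeff p (Suc n) / (\<kappa> n * \<kappa> (Suc n))
        - \<kappa> n * coeff (p (Suc (Suc n))) 0 / (\<kappa> (Suc n) * \<kappa> (Suc (Suc n)))) / \<kappa> (Suc n)"
proof
  interpret R: biorthogonal_pair "reflected L" q p by (rule reflected_pair)
  let ?g = "\<lambda>\<zeta>. poly (p n) (1 / \<zeta>)"
  have g: "continuous_on circle ?g"
    by (intro continuous_on_circle_poly_reflect continuous_on_circle_poly)
  let ?T = "\<lambda>z. - 2 * cauchy (reflected L) ?g z"
  show "?T holomorphic_on - circle"
    by (intro holomorphic_intros R.cauchy_holomorphic g)
  show "z * second_solution n z = ?T (1 / z)" if z: "norm z \<noteq> 1" "z \<noteq> 0" for z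
  proof -
    have "z * cauchy L (\<lambda>\<zeta>. \<zeta> * poly (p n) \<zeta>) z
        = - cauchy (reflected L) (\<lambda>\<zeta>. \<zeta> * (1 / \<zeta> * poly (p n) (1 / \<zeta>))) (1 / z)"
      by (rule cauchy_reflected[OF continuous_on_circle_id_mult_poly z])
    also have "cauchy (reflected L) (\<lambda>\<zeta>. \<zeta> * (1 / \<zeta> * poly (p n) (1 / \<zeta>))) (1 / z)
        = cauchy (reflected L) ?g (1 / z)"
      unfolding cauchy_def
    proof (rule sym, rule R.L_cong)
      show "continuous_on circle (\<lambda>\<zeta>. ?g \<zeta> / (\<zeta> - 1 / z))"
        using z by (intro continuous_on_circle_kernel g) (simp add: norm_divide)
      fix \<zeta> :: complex assume "norm \<zeta> = 1"
      then have "\<zeta> \<noteq> 0" by auto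
      then show "?g \<zeta> / (\<zeta> - 1 / z) = \<zeta> * (1 / \<zeta> * ?g \<zeta>) / (\<zeta> - 1 / z)"
        by simp
    qed
    finally have "z * cauchy L (\<lambda>\<zeta>. \<zeta> * poly (p n) \<zeta>) z = - cauchy (reflected L) ?g (1 / z)" .
    then show ?thesis
      unfolding second_solution_def mult.left_commute[of z] by simp
  qed
  have "cauchy (reflected L) ?g 0 = L (\<lambda>\<zeta>. \<zeta> * poly (p n) \<zeta>)"
    by (simp add: cauchy_def reflected_def mult.commute)
  then show "?T 0 = 2 * coeff (p (Suc n)) 0 / (\<kappa> n * \<kappa> (Suc n))" by (simp add: L_shift)
  have "(cauchy (reflected L) ?g has_field_derivative reflected L (\<lambda>\<zeta>. ?g \<zeta> / (\<zeta> - 0)\<^sup>2)) (at 0)"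
    by (rule R.cauchy_has_field_derivative[OF g]) simp
  moreover have "reflected L (\<lambda>\<zeta>. ?g \<zeta> / (\<zeta> - 0)\<^sup>2) = L (\<lambda>\<zeta>. \<zeta> * \<zeta> * poly (p n) \<zeta>)"
    by (simp add: reflected_def power2_eq_square mult.commute)
  ultimately have "(?T has_field_derivative - 2 * L (\<lambda>\<zeta>. \<zeta> * \<zeta> * poly (p n) \<zeta>)) (at 0)"
    by (auto intro!: derivative_eq_intros)
  then show "deriv ?T 0 = - 2 * (coeff (p (Suc n)) 0 * sub_coeff p (Suc n) / (\<kappa> n * \<kappa> (Suc n))
        - \<kappa> n * coeff (p (Suc (Suc n))) 0 / (\<kappa> (Suc n) * \<kappa> (Suc (Suc n)))) / \<kappa> (Suc n)"
    unfolding L_shift2 by (metis DERIV_imp_deriv times_divide_eq_right)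
qed

end

section \<open>The weight: differential equation and integration by parts\<close>

text \<open>The logarithms in the definition of a branch are chosen point by point, so a coherent local choice has to be
recovered. On a small disc around \<open>z\<close> let \<open>u\<close> be the sum of \<open>\<rho>\<^sub>j log ((x - z\<^sub>j) / (z - z\<^sub>j))\<close> with principal
logarithms. The quotient of \<open>w\<close> by \<open>exp u\<close> is continuous and takes values in a countable set, one value for each choice of
integer multiples of \<open>2 \<pi> \<i>\<close>; on a connected disc it is constant. Hence \<open>w' / w = u'\<close>.\<close>
lemma holomorphic_branch_ode:
  assumes br: "holomorphic_branch m zs \<rho> w D" and D: "open D" "z \<in> D"
  shows "poly (W_poly m zs) z * deriv w z = 2 * poly (V_poly m zs \<rho>) z * w z"
proof -
  have hol: "w holomorphic_on D" using br by (simp add: holomorphic_branch_def)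
  have branch: "\<exists>l. (\<forall>j\<in>{1..m}. exp (l j) = x - zs j) \<and> w x = (\<Prod>j=1..m. exp (\<rho> j * l j))"
    if "x \<in> D" for x
    using br that by (simp add: holomorphic_branch_def)
  have avoid: "x \<noteq> zs j" if "x \<in> D" "j \<in> {1..m}" for x j
    using branch[OF that(1)] that(2) by force
  obtain e where e: "e > 0" "ball z e \<subseteq> D"
    using D open_contains_ball by blast
  have dist_zs: "norm (z - zs j) \<ge> e" if "j \<in> {1..m}" for j
  proof (rule ccontr)
    assume "\<not> ?thesis"
    then have "zs j \<in> ball z e" by (simp add: dist_norm)
    then show False using e avoid[of "zs j" j] that by blast
  qed
  define t where "t j x = (x - zs j) / (z - zs j)" for j x
  \<comment> \<open>The quotient lies within distance \<open>1\<close> of \<open>1\<close>, because the disc \<open>ball z e\<close> avoids every \<open>z\<^sub>j\<close>.\<close>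
  have t_right: "t j x \<notin> \<real>\<^sub>\<le>\<^sub>0" if x: "x \<in> ball z e" and j: "j \<in> {1..m}" for j x
  proof -
    have nz: "z - zs j \<noteq> 0" using dist_zs[OF j] e by auto
    have "norm (x - z) < norm (z - zs j)"
      using x dist_zs[OF j] by (simp add: dist_norm norm_minus_commute)
    moreover have "t j x - 1 = (x - z) / (z - zs j)"
      using nz by (simp add: t_def field_simps)
    ultimately have "norm (t j x - 1) < 1"
      using nz by (simp add: norm_divide)
    then have "\<bar>Re (t j x - 1)\<bar> < 1"
      using abs_Re_le_cmod[of "t j x - 1"] by linarith
    then show ?thesis by (auto simp: complex_nonpos_Reals_iff)
  qed
  define u where "u x = (\<Sum>j=1..m. \<rho> j * Ln (t j x))" for x
  define h where "h x = w x * exp (- u x)" for x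
  have u_cont: "continuous_on (ball z e) u"
    unfolding u_def
  proof (intro continuous_intros continuous_on_Ln)
    fix j assume "j \<in> {1..m}"
    then show "continuous_on (ball z e) (t j)"
      using dist_zs[of j] e unfolding t_def[abs_def] by (intro continuous_intros) auto
  qed (use t_right in blast)
  have h_cont: "continuous_on (ball z e) h"
    unfolding h_def using hol e
    by (intro continuous_intros u_cont)
       (auto intro: continuous_on_subset holomorphic_on_imp_continuous_on)
  \<comment> \<open>All values that the locally constant quotient can take.\<close>
  define N where "N = (\<lambda>k. exp (\<Sum>j=1..m. \<rho> j * (Ln (z - zs j) + of_int (2 * k j) * pi * \<i>)))
     ` (PiE {1..m} (\<lambda>_. UNIV :: int set))"
  have "countable N"
    unfolding N_def by (intro countable_image countable_PiE) auto
  have hN: "h x \<in> N" if x: "x \<in> ball z e" for x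
  proof -
    obtain l where l: "\<And>j. j \<in> {1..m} \<Longrightarrow> exp (l j) = x - zs j"
      "w x = (\<Prod>j=1..m. exp (\<rho> j * l j))"
      using branch e x by blast
    have "\<exists>k::int. l j - Ln (t j x) = Ln (z - zs j) + of_int (2 * k) * pi * \<i>" if j: "j \<in> {1..m}" for j
    proof -
      have nz: "z - zs j \<noteq> 0" using dist_zs[OF j] e by auto
      have nx: "x - zs j \<noteq> 0" using avoid[OF _ j, of x] e x by auto
      have "t j x \<noteq> 0" using nx nz by (simp add: t_def)
      then have "exp (l j - Ln (t j x)) = (x - zs j) / t j x"
        by (simp add: exp_diff l(1)[OF j])
      also have "\<dots> = exp (Ln (z - zs j))"
        using nx nz by (simp add: t_def)
      finally show ?thesis by (simp only: exp_eq)
    qed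
    then have "\<exists>k :: nat \<Rightarrow> int. \<forall>j\<in>{1..m}. l j - Ln (t j x) = Ln (z - zs j) + of_int (2 * k j) * pi * \<i>"
      by (intro bchoice) blast
    then obtain k :: "nat \<Rightarrow> int" where
      k: "\<And>j. j \<in> {1..m} \<Longrightarrow> l j - Ln (t j x) = Ln (z - zs j) + of_int (2 * k j) * pi * \<i>"
      by blast
    have "w x = exp (\<Sum>j=1..m. \<rho> j * l j)"
      by (simp only: l(2) exp_sum finite_atLeastAtMost)
    then have "h x = exp ((\<Sum>j=1..m. \<rho> j * l j) + - u x)"
      by (simp only: h_def exp_add)
    also have "(\<Sum>j=1..m. \<rho> j * l j) + - u x = (\<Sum>j=1..m. \<rho> j * l j - \<rho> j * Ln (t j x))"
      by (simp add: u_def sum_subtractf)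
    also have "(\<Sum>j=1..m. \<rho> j * l j - \<rho> j * Ln (t j x))
        = (\<Sum>j=1..m. \<rho> j * (Ln (z - zs j) + of_int (2 * restrict k {1..m} j) * pi * \<i>))"
      by (intro sum.cong refl) (simp only: right_diff_distrib[symmetric] k restrict_apply')
    finally have "h x = exp (\<Sum>j=1..m. \<rho> j * (Ln (z - zs j) + of_int (2 * restrict k {1..m} j) * pi * \<i>))" .
    then show ?thesis
      unfolding N_def by (intro image_eqI[where x = "restrict k {1..m}"], assumption, simp)
  qed
  have h_const: "h x = h z" if x: "x \<in> ball z e" for x
  proof (rule ccontr)
    assume "h x \<noteq> h z"
    then have "uncountable (h ` ball z e)"
      using x e by (intro connected_uncountable[of _ "h x" "h z"] connected_continuous_image h_cont) auto
    moreover have "countable (h ` ball z e)"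
      using hN \<open>countable N\<close> by (meson countable_subset image_subsetI)
    ultimately show False by simp
  qed
  have w_eq: "w x = h z * exp (u x)" if "x \<in> ball z e" for x
    using h_const[OF that] by (simp add: h_def exp_minus field_simps)
  have tz: "t j z = 1" if "j \<in> {1..m}" for j
    using dist_zs[OF that] e by (auto simp: t_def)
  have u_der: "(u has_field_derivative (\<Sum>j=1..m. \<rho> j / (z - zs j))) (at z)"
    unfolding u_def
  proof (rule DERIV_sum)
    fix j assume j: "j \<in> {1..m}"
    have "((\<lambda>x. Ln (t j x)) has_field_derivative 1 / (z - zs j)) (at z)"
    proof -
      have "z - zs j \<noteq> 0" using dist_zs[OF j] e by auto
      then have "(t j has_field_derivative 1 / (z - zs j)) (at z)"
        unfolding t_def[abs_def] by (auto intro!: derivative_eq_intros)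
      then show ?thesis
        using has_field_derivative_Ln[of "t j z"] tz[OF j]
        by (auto intro!: derivative_eq_intros simp: tz[OF j])
    qed
    then show "((\<lambda>x. \<rho> j * Ln (t j x)) has_field_derivative \<rho> j / (z - zs j)) (at z)"
      by (rule DERIV_cmult[where c = "\<rho> j", THEN DERIV_cong]) simp
  qed
  have "((\<lambda>x. h z * exp (u x)) has_field_derivative
      h z * exp (u z) * (\<Sum>j=1..m. \<rho> j / (z - zs j))) (at z)"
    using u_der by (auto intro!: derivative_eq_intros)
  then have "(w has_field_derivative h z * exp (u z) * (\<Sum>j=1..m. \<rho> j / (z - zs j))) (at z)"
    by (rule has_field_derivative_transform_within_open[of _ _ _ "ball z e"]) (use e w_eq in auto)
  then have "deriv w z = w z * (\<Sum>j=1..m. \<rho> j / (z - zs j))"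
    using w_eq[of z] e by (simp add: DERIV_imp_deriv)
  moreover have "poly (W_poly m zs) z \<noteq> 0"
    using avoid[OF D(2)] by (simp add: W_poly_def poly_prod prod_zero_iff)
  moreover have "z \<notin> zs ` {1..m}"
    using avoid[OF D(2)] by blast
  ultimately show ?thesis
    using two_V_over_W[of z zs m \<rho>] by (simp add: field_simps)
qed

definition weighted_mean :: "(complex \<Rightarrow> complex) \<Rightarrow> (complex \<Rightarrow> complex) \<Rightarrow> complex" where
  "weighted_mean w g = circle_mean (\<lambda>\<zeta>. w \<zeta> * g \<zeta>)"

lemma set_integrable_weighted:
  assumes w: "set_integrable lborel {-pi<..pi} (\<lambda>\<theta>. w (cis \<theta>) :: complex)"
    and g: "continuous_on circle g"
  shows "set_integrable lborel {-pi<..pi} (\<lambda>\<theta>. w (cis \<theta>) * g (cis \<theta>))"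
proof -
  have "continuous_on UNIV (\<lambda>\<theta>. g (cis \<theta>))"
    by (rule continuous_on_compose2[OF g]) (auto intro!: continuous_intros)
  then have gm: "(\<lambda>\<theta>. g (cis \<theta>)) \<in> borel_measurable lborel"
    using borel_measurable_continuous_onI by simp
  have "bounded (g ` circle)"
    by (intro compact_imp_bounded compact_continuous_image g) simp
  then obtain B where B: "B > 0" "\<forall>x\<in>g ` circle. norm x \<le> B"
    unfolding bounded_pos by (elim exE conjE)
  have "integrable lborel (\<lambda>\<theta>. (indicator {-pi<..pi} \<theta> *\<^sub>R w (cis \<theta>)) * g (cis \<theta>))"
  proof (rule Bochner_Integration.integrable_bound)
    show "integrable lborel (\<lambda>\<theta>. B *\<^sub>R (indicator {-pi<..pi} \<theta> *\<^sub>R w (cis \<theta>)))"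
      using w unfolding set_integrable_def by (rule integrable_scaleR_right)
    show "(\<lambda>\<theta>. (indicator {-pi<..pi} \<theta> *\<^sub>R w (cis \<theta>)) * g (cis \<theta>)) \<in> borel_measurable lborel"
      using w gm unfolding set_integrable_def by (intro borel_measurable_times) auto
    have "norm (indicator {-pi<..pi} \<theta> *\<^sub>R w (cis \<theta>)) * norm (g (cis \<theta>))
        \<le> norm (indicator {-pi<..pi} \<theta> *\<^sub>R w (cis \<theta>)) * B" for \<theta>
      using B by (intro mult_left_mono) auto
    then show "AE \<theta> in lborel. norm ((indicator {-pi<..pi} \<theta> *\<^sub>R w (cis \<theta>)) * g (cis \<theta>))
        \<le> norm (B *\<^sub>R (indicator {-pi<..pi} \<theta> *\<^sub>R w (cis \<theta>)))"
      using B(1) by (intro AE_I2) (simp only: norm_mult norm_scaleR abs_of_pos mult.commute)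
  qed
  then show ?thesis
    unfolding set_integrable_def by simp
qed

lemma weighted_mean_functional:
  assumes w: "set_integrable lborel {-pi<..pi} (\<lambda>\<theta>. w (cis \<theta>) :: complex)"
  shows "circle_functional (weighted_mean w)"
proof
  note int = set_integrable_weighted[OF w]
  fix f g :: "complex \<Rightarrow> complex" and c :: complex
  assume f: "continuous_on circle f"
  show "weighted_mean w (\<lambda>\<zeta>. c * f \<zeta>) = c * weighted_mean w f"
    by (simp add: weighted_mean_def circle_mean_def mult.left_commute[of _ c])
  assume g: "continuous_on circle g"
  show "weighted_mean w (\<lambda>\<zeta>. f \<zeta> + g \<zeta>) = weighted_mean w f + weighted_mean w g"
    using set_integral_add(2)[OF int[OF f] int[OF g]]
    by (simp add: weighted_mean_def circle_mean_def distrib_left add_divide_distrib)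
next
  define M where "M = (LINT \<theta>:{-pi<..pi}|lborel. norm (w (cis \<theta>))) / (2 * pi)"
  have "norm (weighted_mean w f) \<le> M * B"
    if f: "continuous_on circle f" and B: "\<forall>\<zeta>\<in>circle. norm (f \<zeta>) \<le> B" for f B
  proof -
    note i = set_integrable_weighted[OF w f]
    have "norm (LINT \<theta>:{-pi<..pi}|lborel. w (cis \<theta>) * f (cis \<theta>))
        \<le> (LINT \<theta>:{-pi<..pi}|lborel. norm (w (cis \<theta>) * f (cis \<theta>)))"
      by (rule set_integral_norm_bound[OF i])
    also have "\<dots> \<le> (LINT \<theta>:{-pi<..pi}|lborel. norm (w (cis \<theta>)) * B)"
      using B by (intro set_integral_mono set_integrable_norm i set_integrable_mult_left w)
        (auto simp: norm_mult intro!: mult_left_mono)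
    also have "\<dots> = (LINT \<theta>:{-pi<..pi}|lborel. norm (w (cis \<theta>))) * B"
      by simp
    finally show ?thesis
      by (simp add: weighted_mean_def circle_mean_def M_def norm_divide divide_right_mono)
  qed
  then show "\<exists>M. \<forall>f B. continuous_on circle f \<longrightarrow> (\<forall>\<zeta>\<in>circle. norm (f \<zeta>) \<le> B) \<longrightarrow>
      norm (weighted_mean w f) \<le> M * B"
    by blast
qed

lemma cis_vector_derivative: "(cis has_vector_derivative \<i> * cis \<theta>) (at \<theta>)"
  unfolding has_vector_derivative_def
  by (rule has_derivative_eq_rhs, rule derivative_intros, rule has_derivative_ident)
     (auto simp: scaleR_conv_of_real mult_ac fun_eq_iff)

lemma finite_cis_preimage:
  assumes "finite A"
  shows "finite {\<theta>\<in>{-pi..pi}. cis \<theta> \<in> A}"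
proof -
  have "inj_on cis {-pi<..pi}"
    by (rule inj_on_inverseI[of _ Arg]) (rule Arg_cis)
  then have "finite (cis -` A \<inter> {-pi<..pi})"
    by (rule finite_vimage_IntI[OF assms])
  then have "finite (insert (-pi) (cis -` A \<inter> {-pi<..pi}))" by simp
  then show ?thesis
    by (rule rev_finite_subset) (auto simp: less_le)
qed

context
  fixes m zs \<rho> w
  assumes weight: "semi_classical_weight m zs \<rho> w"
begin

lemma weight_integrable:
  "set_integrable lborel {-pi<..pi} (\<lambda>\<theta>. w (cis \<theta>))"
  "set_integrable lborel {-pi<..pi} (\<lambda>\<theta>. deriv w (cis \<theta>))"
  using weight unfolding semi_classical_weight_def by (auto dest!: spec[of _ "0::int"])

lemma weight_vector_derivative:
  assumes "cis \<theta> \<notin> zs ` {1..m}"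
  shows "(w has_field_derivative deriv w (cis \<theta>)) (at (cis \<theta>))"
    and "poly (W_poly m zs) (cis \<theta>) * deriv w (cis \<theta>) = 2 * poly (V_poly m zs \<rho>) (cis \<theta>) * w (cis \<theta>)"
    and "isCont (deriv w) (cis \<theta>)"
proof -
  obtain D where D: "open D" "circle - zs ` {1..m} \<subseteq> D" "holomorphic_branch m zs \<rho> w D"
    using weight unfolding semi_classical_weight_def by blast
  then have mem: "cis \<theta> \<in> D" and hol: "w holomorphic_on D"
    using assms by (auto simp: holomorphic_branch_def)
  show "(w has_field_derivative deriv w (cis \<theta>)) (at (cis \<theta>))"
    by (rule holomorphic_derivI[OF hol D(1) mem])
  show "poly (W_poly m zs) (cis \<theta>) * deriv w (cis \<theta>) = 2 * poly (V_poly m zs \<rho>) (cis \<theta>) * w (cis \<theta>)"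
    by (rule holomorphic_branch_ode[OF D(3,1) mem])
  show "isCont (deriv w) (cis \<theta>)"
    using holomorphic_deriv[OF hol D(1)] D(1) mem
    by (metis continuous_on_eq_continuous_at holomorphic_on_imp_continuous_on)
qed

text \<open>On an arc without singular points the variation of \<open>w\<close> is at most the total integral of \<open>\<bar>w'\<bar>\<close>, which is finite.
Boundedness is stated within \<open>{-pi..pi}\<close>, so that at the end points only one side is involved.\<close>
lemma weight_bounded_near:
  assumes \<theta>0: "\<theta>0 \<in> {-pi..pi}"
  shows "\<exists>B. \<forall>\<^sub>F \<theta> in at \<theta>0 within {-pi..pi}. norm (w (cis \<theta>)) \<le> B"
proof -
  define K where "K = {\<theta>\<in>{-pi..pi}. cis \<theta> \<in> zs ` {1..m}}"
  have "finite K" unfolding K_def by (intro finite_cis_preimage) simp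
  then obtain \<delta> where \<delta>: "\<delta> > 0" "\<And>x. x \<in> K \<Longrightarrow> x \<noteq> \<theta>0 \<Longrightarrow> \<delta> \<le> dist \<theta>0 x"
    using finite_set_avoid[of K \<theta>0] by blast
  have w': "(\<lambda>\<theta>. norm (deriv w (cis \<theta>))) integrable_on {-pi..pi}"
  proof -
    have "set_integrable lborel {-pi<..pi} (\<lambda>\<theta>. norm (deriv w (cis \<theta>)))"
      by (intro set_integrable_norm weight_integrable)
    then have "(\<lambda>\<theta>. norm (deriv w (cis \<theta>))) integrable_on {-pi<..pi}"
      by (rule set_borel_integral_eq_integral)
    then have "(\<lambda>\<theta>. norm (deriv w (cis \<theta>))) integrable_on insert (-pi) {-pi<..pi}"
      by (simp only: integrable_on_insert_iff)
    moreover have "insert (-pi) {-pi<..pi} = {-pi..pi}" by auto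
    ultimately show ?thesis by simp
  qed
  define C where "C = integral {-pi..pi} (\<lambda>\<theta>. norm (deriv w (cis \<theta>)))"
  have var: "norm (w (cis b) - w (cis a)) \<le> C"
    if ab: "a \<le> b" "{a..b} \<subseteq> {-pi..pi} - K" for a b
  proof -
    have off: "cis \<theta> \<notin> zs ` {1..m}" if "\<theta> \<in> {a..b}" for \<theta>
      using ab that by (auto simp: K_def)
    have ftc: "((\<lambda>\<theta>. \<i> * cis \<theta> * deriv w (cis \<theta>)) has_integral w (cis b) - w (cis a)) {a..b}"
    proof (rule fundamental_theorem_of_calculus[OF ab(1)])
      fix \<theta> assume "\<theta> \<in> {a..b}"
      from field_vector_diff_chain_at[OF cis_vector_derivative weight_vector_derivative(1)[OF off[OF \<open>\<theta> \<in> {a..b}\<close>]]]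
      show "((\<lambda>\<theta>. w (cis \<theta>)) has_vector_derivative \<i> * cis \<theta> * deriv w (cis \<theta>)) (at \<theta> within {a..b})"
        unfolding comp_def by (rule has_vector_derivative_at_within)
    qed
    have "continuous_on {a..b} (\<lambda>\<theta>. deriv w (cis \<theta>))"
      by (intro continuous_at_imp_continuous_on ballI
        isCont_o2[OF has_vector_derivative_continuous[OF cis_vector_derivative]]
        weight_vector_derivative(3) off)
    then have i: "(\<lambda>\<theta>. norm (deriv w (cis \<theta>))) integrable_on {a..b}"
      by (intro integrable_continuous_real continuous_intros)
    have "norm (w (cis b) - w (cis a)) \<le> integral {a..b} (\<lambda>\<theta>. norm (deriv w (cis \<theta>)))"
      unfolding integral_unique[OF ftc, symmetric]
      by (intro integral_norm_bound_integral i has_integral_integrable[OF ftc]) (simp add: norm_mult)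
    also have "\<dots> \<le> C"
      unfolding C_def using ab by (intro integral_subset_le i w') auto
    finally show ?thesis .
  qed
  define a b where "a = max (-pi) (\<theta>0 - \<delta> / 2)" and "b = min pi (\<theta>0 + \<delta> / 2)"
  define B where "B = norm (w (cis a)) + norm (w (cis b)) + C"
  have bound: "norm (w (cis \<theta>)) \<le> B"
    if \<theta>: "\<theta> \<in> {-pi..pi}" "\<theta> \<noteq> \<theta>0" "dist \<theta> \<theta>0 < \<delta> / 2" for \<theta>
  proof (cases "\<theta> > \<theta>0")
    case True
    then have le: "\<theta> \<le> b" using \<theta> by (auto simp: b_def dist_real_def)
    have "{\<theta>..b} \<subseteq> {-pi..pi} - K"
      using \<delta> \<theta> \<theta>0 True by (force simp: b_def dist_real_def)
    from var[OF le this] show ?thesis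
      using norm_triangle_sub[of "w (cis \<theta>)" "w (cis b)"]
        norm_minus_commute[of "w (cis b)" "w (cis \<theta>)"] norm_ge_zero[of "w (cis a)"]
      unfolding B_def by linarith
  next
    case False
    then have le: "a \<le> \<theta>" using \<theta> by (auto simp: a_def dist_real_def)
    have "{a..\<theta>} \<subseteq> {-pi..pi} - K"
      using \<delta> \<theta> \<theta>0 False by (force simp: a_def dist_real_def)
    from var[OF le this] show ?thesis
      using norm_triangle_sub[of "w (cis \<theta>)" "w (cis a)"] norm_ge_zero[of "w (cis b)"]
      unfolding B_def by linarith
  qed
  have "\<forall>\<^sub>F \<theta> in at \<theta>0 within {-pi..pi}. norm (w (cis \<theta>)) \<le> B"
    unfolding eventually_at using \<delta> bound by (intro exI[of _ "\<delta> / 2"]) auto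
  then show ?thesis by blast
qed

text \<open>The integrand is the derivative of \<open>H = W w / (\<zeta> - z)\<close> along the circle, after \<open>W w'\<close> has been replaced by \<open>2 V w\<close>.
At a singular point on the circle \<open>H\<close> has the value \<open>0\<close> whatever value \<open>w\<close> has there, and it is continuous because \<open>w\<close> is
bounded nearby. So \<open>H\<close> is a continuous periodic primitive up to a finite exceptional set.\<close>
lemma weighted_integration_by_parts:
  defines "W \<equiv> W_poly m zs" and "V \<equiv> V_poly m zs \<rho>"
  assumes z: "norm z \<noteq> 1"
  shows "weighted_mean w (\<lambda>\<zeta>. \<zeta> * (poly (pderiv W) \<zeta> / (\<zeta> - z) - poly W \<zeta> / (\<zeta> - z)\<^sup>2
            + 2 * poly V \<zeta> / (\<zeta> - z))) = 0"
proof -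
  define K where "K = {\<theta>\<in>{-pi..pi}. cis \<theta> \<in> zs ` {1..m}}"
  have "finite K" unfolding K_def by (intro finite_cis_preimage) simp
  define k where "k \<zeta> = \<zeta> * (poly (pderiv W) \<zeta> / (\<zeta> - z) - poly W \<zeta> / (\<zeta> - z)\<^sup>2
            + 2 * poly V \<zeta> / (\<zeta> - z))" for \<zeta>
  have k: "continuous_on circle k"
    unfolding k_def using z by (intro continuous_intros) auto
  define H where "H \<theta> = poly W (cis \<theta>) * w (cis \<theta>) / (cis \<theta> - z)" for \<theta>
  have nz: "cis \<theta> - z \<noteq> 0" for \<theta> using z by auto
  have der: "(H has_vector_derivative \<i> * (w (cis \<theta>) * k (cis \<theta>))) (at \<theta>)"
    if "cis \<theta> \<notin> zs ` {1..m}" for \<theta>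
  proof -
    note w' = weight_vector_derivative[OF that, folded W_def V_def]
    let ?n = "poly W (cis \<theta>) * w (cis \<theta>)"
    let ?n' = "poly (pderiv W) (cis \<theta>) * w (cis \<theta>) + poly W (cis \<theta>) * deriv w (cis \<theta>)"
    let ?d = "(poly (pderiv W) (cis \<theta>) * w (cis \<theta>) + poly W (cis \<theta>) * deriv w (cis \<theta>)) / (cis \<theta> - z)
        - poly W (cis \<theta>) * w (cis \<theta>) / (cis \<theta> - z)\<^sup>2"
    have "((\<lambda>\<zeta>. poly W \<zeta> * w \<zeta>) has_field_derivative ?n') (at (cis \<theta>))"
      using w'(1) by (auto intro!: derivative_eq_intros)
    moreover have "((\<lambda>\<zeta>. \<zeta> - z) has_field_derivative 1) (at (cis \<theta>))"
      by (auto intro!: derivative_eq_intros)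
    ultimately have "((\<lambda>\<zeta>. poly W \<zeta> * w \<zeta> / (\<zeta> - z)) has_field_derivative
        (?n' * (cis \<theta> - z) - ?n * 1) / ((cis \<theta> - z) * (cis \<theta> - z))) (at (cis \<theta>))"
      using nz by (rule DERIV_divide)
    moreover have "(?n' * (cis \<theta> - z) - ?n * 1) / ((cis \<theta> - z) * (cis \<theta> - z)) = ?d"
      using nz[of \<theta>] by (simp add: diff_divide_distrib power2_eq_square)
    ultimately have "((\<lambda>\<zeta>. poly W \<zeta> * w \<zeta> / (\<zeta> - z)) has_field_derivative ?d) (at (cis \<theta>))"
      by simp
    from field_vector_diff_chain_at[OF cis_vector_derivative this]
    have "(H has_vector_derivative \<i> * cis \<theta> * ?d) (at \<theta>)"
      by (simp add: comp_def H_def[abs_def])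
    also have "\<i> * cis \<theta> * ?d = \<i> * (w (cis \<theta>) * k (cis \<theta>))"
      unfolding w'(2) k_def
      by (simp add: add_divide_distrib distrib_left distrib_right right_diff_distrib mult_ac)
    finally show ?thesis .
  qed
  have cont: "continuous_on {-pi..pi} H"
    unfolding continuous_on_eq_continuous_within
  proof
    fix \<theta>0 assume \<theta>0: "\<theta>0 \<in> {-pi..pi}"
    show "continuous (at \<theta>0 within {-pi..pi}) H"
    proof (cases "cis \<theta>0 \<in> zs ` {1..m}")
      case False
      then show ?thesis
        using der has_vector_derivative_continuous continuous_at_imp_continuous_within by blast
    next
      case True
      then have W0: "poly W (cis \<theta>0) = 0"
        by (auto simp: W_def W_poly_def poly_prod)
      obtain B where B: "\<forall>\<^sub>F \<theta> in at \<theta>0 within {-pi..pi}. norm (w (cis \<theta>)) \<le> B"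
        using weight_bounded_near[OF \<theta>0] by blast
      have "((\<lambda>\<theta>. norm (poly W (cis \<theta>) / (cis \<theta> - z)) * B) \<longlongrightarrow> norm (poly W (cis \<theta>0) / (cis \<theta>0 - z)) * B)
          (at \<theta>0 within {-pi..pi})"
        using nz by (intro tendsto_intros) auto
      then have lim: "((\<lambda>\<theta>. norm (poly W (cis \<theta>) / (cis \<theta> - z)) * B) \<longlongrightarrow> 0) (at \<theta>0 within {-pi..pi})"
        by (simp add: W0)
      have "\<forall>\<^sub>F \<theta> in at \<theta>0 within {-pi..pi}. norm (H \<theta>) \<le> norm (poly W (cis \<theta>) / (cis \<theta> - z)) * B"
        using B
      proof (rule eventually_mono)
        fix \<theta> assume "norm (w (cis \<theta>)) \<le> B"
        then have "norm (poly W (cis \<theta>) / (cis \<theta> - z)) * norm (w (cis \<theta>))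
            \<le> norm (poly W (cis \<theta>) / (cis \<theta> - z)) * B"
          by (rule mult_left_mono) simp
        then show "norm (H \<theta>) \<le> norm (poly W (cis \<theta>) / (cis \<theta> - z)) * B"
          by (simp add: H_def norm_mult norm_divide)
      qed
      from Lim_null_comparison[OF this lim] show ?thesis
        by (simp add: continuous_within H_def[of \<theta>0] W0)
    qed
  qed
  have "((\<lambda>\<theta>. \<i> * (w (cis \<theta>) * k (cis \<theta>))) has_integral H pi - H (- pi)) {-pi..pi}"
    using der by (intro fundamental_theorem_of_calculus_interior_strong[OF \<open>finite K\<close>] cont)
      (auto simp: K_def)
  moreover have "cis (- pi) = cis pi" by (simp add: complex_eq_iff)
  then have "H pi = H (- pi)" by (simp add: H_def)
  ultimately have "((\<lambda>\<theta>. (- \<i>) * (\<i> * (w (cis \<theta>) * k (cis \<theta>)))) has_integral (- \<i>) * 0) {-pi..pi}"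
    by (intro has_integral_mult_right) simp
  then have "((\<lambda>\<theta>. w (cis \<theta>) * k (cis \<theta>)) has_integral 0) {-pi..pi}"
    by (simp add: mult.assoc[symmetric])
  moreover have "{x \<in> {-pi..pi} - {-pi<..pi}. w (cis x) * k (cis x) \<noteq> 0} \<subseteq> {-pi}"
    "{x \<in> {-pi<..pi} - {-pi..pi}. w (cis x) * k (cis x) \<noteq> 0} \<subseteq> {}" by auto
  ultimately have "((\<lambda>\<theta>. w (cis \<theta>) * k (cis \<theta>)) has_integral 0) {-pi<..pi}"
    by (subst (asm) has_integral_spike_set_eq[of _ "{-pi<..pi}"])
      (auto intro: negligible_subset[of "{-pi}"] negligible_subset[of "{}"])
  then have "(LINT \<theta>:{-pi<..pi}|lborel. w (cis \<theta>) * k (cis \<theta>)) = 0"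
    using set_borel_integral_eq_integral(2)[OF set_integrable_weighted[OF weight_integrable(1) k]]
    by (simp add: integral_unique)
  then show ?thesis
    by (simp add: weighted_mean_def circle_mean_def k_def[abs_def])
qed

end

context circle_functional
begin

text \<open>Each of the three terms in the integration by parts is a polynomial multiple of \<open>C \<zeta>\<close> or of its derivative, up to
polynomials; the terms with \<open>W'\<close> cancel. As \<open>F\<close> is \<open>2 C \<zeta>\<close> minus a constant, this is the first-order
equation for \<open>F\<close>.\<close>
lemma cauchy_first_order_ode:
  assumes parts: "\<And>z. norm z \<noteq> 1 \<Longrightarrow>
      L (\<lambda>\<zeta>. \<zeta> * (poly (pderiv W) \<zeta> / (\<zeta> - z) - poly W \<zeta> / (\<zeta> - z)\<^sup>2 + 2 * poly V \<zeta> / (\<zeta> - z))) = 0"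
  shows "\<exists>U. \<forall>z. norm z \<noteq> 1 \<longrightarrow>
      poly W z * deriv (cauchy L (\<lambda>\<zeta>. \<zeta>)) z = 2 * poly V z * cauchy L (\<lambda>\<zeta>. \<zeta>) z + poly U z"
proof -
  define G where "G = cauchy L (\<lambda>\<zeta>. \<zeta>)"
  have id: "continuous_on circle (\<lambda>\<zeta>. \<zeta>)" by (intro continuous_intros)
  have mult: "\<exists>U. \<forall>z. norm z \<noteq> 1 \<longrightarrow> cauchy L (\<lambda>\<zeta>. poly A \<zeta> * \<zeta>) z = poly A z * G z + poly U z" for A
    unfolding G_def by (rule cauchy_mult_poly[OF id])
  obtain U1 where U1: "\<And>z. norm z \<noteq> 1 \<Longrightarrow> cauchy L (\<lambda>\<zeta>. poly W \<zeta> * \<zeta>) z = poly W z * G z + poly U1 z"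
    using mult by blast
  obtain U2 where U2: "\<And>z. norm z \<noteq> 1 \<Longrightarrow> cauchy L (\<lambda>\<zeta>. poly (pderiv W) \<zeta> * \<zeta>) z = poly (pderiv W) z * G z + poly U2 z"
    using mult by blast
  obtain U3 where U3: "\<And>z. norm z \<noteq> 1 \<Longrightarrow> cauchy L (\<lambda>\<zeta>. poly V \<zeta> * \<zeta>) z = poly V z * G z + poly U3 z"
    using mult by blast
  have "poly W z * deriv G z = 2 * poly V z * G z + poly (U2 - pderiv U1 + smult 2 U3) z"
    if z: "norm z \<noteq> 1" for z
  proof -
    have G': "(G has_field_derivative deriv G z) (at z)"
      unfolding G_def using cauchy_has_field_derivative[OF id z] DERIV_imp_deriv by fastforce
    have "((\<lambda>x. poly W x * G x + poly U1 x) has_field_derivative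
        poly (pderiv W) z * G z + poly W z * deriv G z + poly (pderiv U1) z) (at z)"
      using G' by (auto intro!: derivative_eq_intros)
    then have "(cauchy L (\<lambda>\<zeta>. poly W \<zeta> * \<zeta>) has_field_derivative
        poly (pderiv W) z * G z + poly W z * deriv G z + poly (pderiv U1) z) (at z)"
      by (rule has_field_derivative_transform_within_open[of _ _ _ "- circle"])
         (use z U1 in \<open>auto intro: open_Compl\<close>)
    moreover have cW: "continuous_on circle (\<lambda>\<zeta>. poly W \<zeta> * \<zeta>)" by (intro continuous_intros)
    ultimately have d: "L (\<lambda>\<zeta>. poly W \<zeta> * \<zeta> / (\<zeta> - z)\<^sup>2)
        = poly (pderiv W) z * G z + poly W z * deriv G z + poly (pderiv U1) z"
      using cauchy_has_field_derivative[OF cW z] DERIV_unique by blast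
    have c: "continuous_on circle (\<lambda>\<zeta>. poly (pderiv W) \<zeta> * \<zeta> / (\<zeta> - z))"
      "continuous_on circle (\<lambda>\<zeta>. poly W \<zeta> * \<zeta> / (\<zeta> - z)\<^sup>2)"
      "continuous_on circle (\<lambda>\<zeta>. poly V \<zeta> * \<zeta> / (\<zeta> - z))"
      using z by (intro continuous_intros; auto)+
    have "0 = L (\<lambda>\<zeta>. \<zeta> * (poly (pderiv W) \<zeta> / (\<zeta> - z) - poly W \<zeta> / (\<zeta> - z)\<^sup>2 + 2 * poly V \<zeta> / (\<zeta> - z)))"
      using parts[OF z] by simp
    also have "\<dots> = L (\<lambda>\<zeta>. (poly (pderiv W) \<zeta> * \<zeta> / (\<zeta> - z) - poly W \<zeta> * \<zeta> / (\<zeta> - z)\<^sup>2)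
        + 2 * (poly V \<zeta> * \<zeta> / (\<zeta> - z)))"
      by (simp add: distrib_left right_diff_distrib mult_ac)
    also have "\<dots> = cauchy L (\<lambda>\<zeta>. poly (pderiv W) \<zeta> * \<zeta>) z - L (\<lambda>\<zeta>. poly W \<zeta> * \<zeta> / (\<zeta> - z)\<^sup>2)
        + 2 * cauchy L (\<lambda>\<zeta>. poly V \<zeta> * \<zeta>) z"
      unfolding cauchy_def scale[OF c(3), symmetric] diff[OF c(1,2), symmetric]
      by (intro add continuous_intros c)
    finally show ?thesis
      unfolding d U2[OF z] U3[OF z] by (simp add: algebra_simps)
  qed
  then show ?thesis unfolding G_def by blast
qed

end

section \<open>Two-term expansions and polynomial coefficients of derivative relations\<close>

text \<open>Two-term expansion at \<open>0\<close> of a function that is complex differentiable there. Expansions at infinity are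
expansions at \<open>0\<close> in the variable \<open>u = 1/z\<close>.\<close>
definition jet :: "(complex \<Rightarrow> complex) \<Rightarrow> complex \<Rightarrow> complex \<Rightarrow> bool" where
  "jet f a b \<longleftrightarrow> f 0 = a \<and> (f has_field_derivative b) (at 0)"

lemma jet_add: "jet f a b \<Longrightarrow> jet g a' b' \<Longrightarrow> jet (\<lambda>u. f u + g u) (a + a') (b + b')"
  by (auto simp: jet_def intro!: derivative_eq_intros)

lemma jet_diff: "jet f a b \<Longrightarrow> jet g a' b' \<Longrightarrow> jet (\<lambda>u. f u - g u) (a - a') (b - b')"
  by (auto simp: jet_def intro!: derivative_eq_intros)

lemma jet_mult: "jet f a b \<Longrightarrow> jet g a' b' \<Longrightarrow> jet (\<lambda>u. f u * g u) (a * a') (a * b' + a' * b)"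
  by (auto simp: jet_def intro!: derivative_eq_intros)

lemma jet_const: "jet (\<lambda>u. c) c 0"
  by (auto simp: jet_def)

lemma jet_ident: "jet (\<lambda>u. u) 0 1"
  by (auto simp: jet_def)

lemma jet_poly: "jet (poly A) (coeff A 0) (coeff A 1)"
  by (simp add: jet_def poly_0_coeff_0 poly_DERIV[THEN DERIV_cong] coeff_pderiv)

lemma jet_holomorphic: "f holomorphic_on - circle \<Longrightarrow> jet f (f 0) (deriv f 0)"
  by (auto simp: jet_def intro!: holomorphic_derivI[of f "- circle"] open_Compl)

text \<open>The term \<open>z E'\<close> comes from differentiating \<open>z\<^sup>d E\<close>.\<close>
lemma jet_euler:
  assumes "f holomorphic_on - circle"
  shows "jet (\<lambda>u. u * deriv f u) 0 (deriv f 0)"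
proof -
  have "deriv f holomorphic_on - circle"
    using assms by (intro holomorphic_deriv open_Compl) auto
  from jet_mult[OF jet_ident jet_holomorphic[OF this]] show ?thesis by simp
qed

lemmas jet_intros = jet_add jet_diff jet_mult jet_const jet_ident jet_poly jet_holomorphic jet_euler

lemma jet_tendsto: "jet f a b \<Longrightarrow> (f \<longlongrightarrow> a) (at 0)"
  unfolding jet_def using DERIV_isCont isCont_def by blast

lemma jet_unique:
  assumes f: "jet f a b" and g: "jet g a' b'" and eq: "\<And>u. u \<noteq> 0 \<Longrightarrow> norm u < 1 \<Longrightarrow> f u = g u"
  shows "a = a' \<and> b = b'"
proof -
  have ev: "\<forall>\<^sub>F u in at 0. f u = g u"
    unfolding eventually_at using eq by (intro exI[of _ 1]) auto
  have "(g \<longlongrightarrow> a) (at 0)"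
    by (rule Lim_transform_eventually[OF jet_tendsto[OF f] ev])
  then have a: "a = a'"
    using jet_tendsto[OF g] tendsto_unique by (metis trivial_limit_at)
  have "f u = g u" if "norm u < 1" for u
    using eq[of u] that a f g by (cases "u = 0") (auto simp: jet_def)
  then have "(g has_field_derivative b) (at 0)"
    using f unfolding jet_def
    by (intro has_field_derivative_transform_within_open[of f b 0 "ball 0 1" g]) auto
  then have "b = b'"
    using g unfolding jet_def by (auto intro: DERIV_unique)
  with a show ?thesis by simp
qed

text \<open>Reversal with respect to a prescribed degree bound \<open>N\<close> rather than the actual degree. The coefficients \<open>0\<close> and \<open>1\<close> of
\<open>flip N A\<close> are those of \<open>z\<^sup>N\<close> and \<open>z\<^sup>N\<^sup>-\<^sup>1\<close> in \<open>A\<close>, and the second one is \<open>0\<close> if \<open>N = 0\<close>; this is the correct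
convention for a top expansion whose second exponent is negative.\<close>
definition flip :: "nat \<Rightarrow> complex poly \<Rightarrow> complex poly" where
  "flip N A = (\<Sum>i\<le>N. monom (coeff A (N - i)) i)"

abbreviation lead :: "nat \<Rightarrow> complex poly \<Rightarrow> nat \<Rightarrow> complex" where
  "lead N A i \<equiv> coeff (flip N A) i"

lemma coeff_flip: "lead N A i = (if i \<le> N then coeff A (N - i) else 0)"
  by (simp add: flip_def coeff_sum coeff_monom if_distrib cong: if_cong)

lemma poly_flip:
  assumes "degree A \<le> N" "u \<noteq> 0"
  shows "poly (flip N A) u = u ^ N * poly A (1 / u)"
proof -
  have "poly A (1 / u) = (\<Sum>i\<le>N. coeff A i * (1 / u) ^ i)"
    unfolding poly_altdef
    using assms by (intro sum.mono_neutral_left) (auto simp: coeff_eq_0)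
  then have "u ^ N * poly A (1 / u) = (\<Sum>i\<le>N. coeff A i * u ^ (N - i))"
    using assms(2) by (auto simp: sum_distrib_left power_diff power_divide intro!: sum.cong)
  also have "\<dots> = (\<Sum>i\<le>N. coeff A (N - i) * u ^ i)"
    by (rule sum.reindex_bij_witness[of _ "\<lambda>i. N - i" "\<lambda>i. N - i"]) auto
  finally show ?thesis
    by (simp add: flip_def poly_sum poly_monom)
qed

lemma degree_le_from_infinity:
  fixes A :: "complex poly"
  assumes eq: "\<And>u. u \<noteq> 0 \<Longrightarrow> norm u < 1 \<Longrightarrow> u ^ N * poly A (1 / u) = h u"
    and lim: "(h \<longlongrightarrow> c) (at 0)"
  shows "degree A \<le> N \<and> coeff A N = c"
proof -
  define M where "M = max N (degree A)"
  have "(poly (flip M A) \<longlongrightarrow> coeff A M) (at 0)"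
    using jet_tendsto[OF jet_poly[of "flip M A"]] by (simp add: coeff_flip)
  moreover have "((\<lambda>u. u ^ (M - N) * h u) \<longlongrightarrow> 0 ^ (M - N) * c) (at 0)"
    by (intro tendsto_intros lim)
  moreover have "\<forall>\<^sub>F u in at 0. u ^ (M - N) * h u = poly (flip M A) u"
    unfolding eventually_at
  proof (intro exI[of _ 1] conjI ballI impI)
    fix u :: complex assume "u \<noteq> 0 \<and> dist u 0 < 1"
    then have u: "u \<noteq> 0" "norm u < 1" by auto
    have "u ^ M = u ^ (M - N) * u ^ N"
      unfolding power_add[symmetric] by (simp add: M_def)
    then show "u ^ (M - N) * h u = poly (flip M A) u"
      using poly_flip[OF _ u(1), of A M] eq[OF u, symmetric] by (simp add: M_def mult.assoc)
  qed simp
  ultimately have key: "coeff A M = 0 ^ (M - N) * c"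
    using tendsto_unique[OF trivial_limit_at _ Lim_transform_eventually] by blast
  have "degree A \<le> N"
  proof (rule ccontr)
    assume "\<not> degree A \<le> N"
    then have "M = degree A" "M - N > 0" by (auto simp: M_def)
    then have "lead_coeff A = 0" using key by (simp add: power_0_left)
    then show False using \<open>\<not> degree A \<le> N\<close> by simp
  qed
  then show ?thesis using key by (simp add: M_def)
qed

lemma monom_factor_from_zero:
  fixes A :: "complex poly"
  assumes "\<And>z. z \<noteq> 0 \<Longrightarrow> norm z < 1 \<Longrightarrow> poly A z = z ^ N * h z"
    and "(h \<longlongrightarrow> c) (at 0)"
  shows "\<exists>B. A = monom 1 N * B"
  using assms(1)
proof (induction N arbitrary: A)
  case (Suc N)
  have "((\<lambda>z. z ^ Suc N * h z) \<longlongrightarrow> 0 ^ Suc N * c) (at 0)"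
    by (intro tendsto_mult tendsto_power tendsto_ident_at assms(2))
  moreover have "\<forall>\<^sub>F z in at 0. z ^ Suc N * h z = poly A z"
    unfolding eventually_at using Suc.prems by (intro exI[of _ 1]) auto
  ultimately have "(poly A \<longlongrightarrow> 0) (at 0)"
    using Lim_transform_eventually by fastforce
  then have "coeff A 0 = 0"
    using jet_tendsto[OF jet_poly[of A]] by (metis tendsto_unique trivial_limit_at)
  then obtain A1 where A1: "A = pCons 0 A1"
    by (metis pCons_cases coeff_pCons_0)
  have "poly A1 z = z ^ N * h z" if "z \<noteq> 0" "norm z < 1" for z
    using Suc.prems[OF that] that by (simp add: A1)
  from Suc.IH[OF this] obtain B where "A1 = monom 1 N * B" by blast
  then have "A = monom 1 (Suc N) * B" by (simp add: A1 monom_Suc)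
  then show ?case by blast
qed simp

text \<open>The common structure of both systems. The pairs \<open>(p, e)\<close> and \<open>(q, f)\<close> are two consecutive polynomials with their
associated functions; \<open>e\<close> has order \<open>d\<close> at \<open>0\<close> and order \<open>k\<close> at infinity (in \<open>1/z\<close>), with the local factors \<open>E\<close> and \<open>T\<close>;
\<open>f\<close> has one order more at \<open>0\<close> and the same order at infinity. The relation \<open>d + k = n + 1\<close> makes the determinant a monomial.\<close>
locale derivative_pair =
  fixes W V U p q \<psi> \<psi>2 :: "complex poly"
    and G e f E E2 T T2 :: "complex \<Rightarrow> complex"
    and m n d k :: nat
  assumes m: "m \<ge> 2"
    and W: "degree W = m" "lead_coeff W = 1" "poly W 0 = 0"
    and V: "degree V \<le> m - 1"
    and p: "degree p \<le> n" and q: "degree q \<le> Suc n"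
    and dk: "d + k = Suc n"
    and G: "G holomorphic_on - circle"
    and G_ode: "norm z \<noteq> 1 \<Longrightarrow> poly W z * deriv G z = 2 * poly V z * G z + poly U z"
    and e: "norm z \<noteq> 1 \<Longrightarrow> e z = poly \<psi> z + G z * poly p z"
    and f: "norm z \<noteq> 1 \<Longrightarrow> f z = poly \<psi>2 z + G z * poly q z"
    and hol: "E holomorphic_on - circle" "E2 holomorphic_on - circle"
      "T holomorphic_on - circle" "T2 holomorphic_on - circle"
    and e0: "norm z \<noteq> 1 \<Longrightarrow> e z = z ^ d * E z"
    and f0: "norm z \<noteq> 1 \<Longrightarrow> f z = z ^ Suc d * E2 z"
    and eT: "norm z \<noteq> 1 \<Longrightarrow> z \<noteq> 0 \<Longrightarrow> z ^ k * e z = T (1 / z)"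
    and fT: "norm z \<noteq> 1 \<Longrightarrow> z \<noteq> 0 \<Longrightarrow> z ^ k * f z = T2 (1 / z)"
    and nondegenerate: "coeff q (Suc n) * T 0 \<noteq> 0"
begin

lemma field_deriv: "g holomorphic_on - circle \<Longrightarrow> norm z \<noteq> 1 \<Longrightarrow> (g has_field_derivative deriv g z) (at z)"
  by (rule holomorphic_derivI[of g "- circle"]) (auto intro: open_Compl)

lemma e_derivative:
  assumes "norm z \<noteq> 1"
  shows "deriv e z = poly (pderiv \<psi>) z + deriv G z * poly p z + G z * poly (pderiv p) z"
proof -
  have "((\<lambda>z. poly \<psi> z + G z * poly p z) has_field_derivative
      poly (pderiv \<psi>) z + deriv G z * poly p z + G z * poly (pderiv p) z) (at z)"
    using field_deriv[OF G assms] by (auto intro!: derivative_eq_intros)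
  then have "(e has_field_derivative
      poly (pderiv \<psi>) z + deriv G z * poly p z + G z * poly (pderiv p) z) (at z)"
    by (rule has_field_derivative_transform_within_open[of _ _ _ "- circle"])
       (use assms e in \<open>auto intro: open_Compl\<close>)
  then show ?thesis by (rule DERIV_imp_deriv)
qed

lemma e_derivative_field:
  assumes "norm z \<noteq> 1"
  shows "(e has_field_derivative deriv e z) (at z)"
proof -
  have "((\<lambda>z. poly \<psi> z + G z * poly p z) has_field_derivative deriv e z) (at z)"
    unfolding e_derivative[OF assms]
    using field_deriv[OF G assms] by (auto intro!: derivative_eq_intros)
  then show ?thesis
    by (rule has_field_derivative_transform_within_open[of _ _ _ "- circle"])
       (use assms e in \<open>auto intro: open_Compl\<close>)
qed

lemma e_derivative_zero:
  assumes "norm z < 1"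
  shows "z * deriv e z = z ^ d * (of_nat d * E z + z * deriv E z)"
proof -
  have z: "norm z \<noteq> 1" using assms by simp
  have "((\<lambda>z. z ^ d * E z) has_field_derivative
      z ^ d * deriv E z + of_nat d * z ^ (d - 1) * E z) (at z)"
    using field_deriv[OF hol(1) z] by (auto intro!: derivative_eq_intros)
  then have "(e has_field_derivative z ^ d * deriv E z + of_nat d * z ^ (d - 1) * E z) (at z)"
    by (rule has_field_derivative_transform_within_open[of _ _ _ "- circle"])
       (use z e0 in \<open>auto intro: open_Compl\<close>)
  then have "deriv e z = z ^ d * deriv E z + of_nat d * z ^ (d - 1) * E z"
    by (rule DERIV_imp_deriv)
  then show ?thesis
    by (cases d) (simp_all add: algebra_simps)
qed

text \<open>Differentiate \<open>z\<^sup>k e(z) = T(1/z)\<close> in two ways.\<close>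
lemma e_derivative_infinity:
  assumes u: "norm u < 1" "u \<noteq> 0"
  shows "(1 / u) ^ Suc k * deriv e (1 / u) = - (of_nat k * T u + u * deriv T u)"
proof -
  define z where "z = 1 / u"
  have z: "norm z \<noteq> 1" "z \<noteq> 0" "1 / z = u" using u by (auto simp: z_def norm_divide)
  have "((\<lambda>z. T (1 / z)) has_field_derivative deriv T (1 / z) * (- 1 / z\<^sup>2)) (at z)"
  proof (rule DERIV_chain2[where f = T and g = "\<lambda>z. 1 / z"])
    show "(T has_field_derivative deriv T (1 / z)) (at (1 / z))"
      using u z by (intro field_deriv hol) auto
    show "((\<lambda>z. 1 / z) has_field_derivative - 1 / z\<^sup>2) (at z)"
      using z by (auto intro!: derivative_eq_intros simp: power2_eq_square)
  qed
  then have "((\<lambda>z. z ^ k * e z) has_field_derivative deriv T (1 / z) * (- 1 / z\<^sup>2)) (at z)"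
    by (rule has_field_derivative_transform_within_open[of _ _ _ "- circle - {0}"])
       (use z eT in \<open>auto intro!: open_Compl open_Diff\<close>)
  moreover have "((\<lambda>z. z ^ k * e z) has_field_derivative
      z ^ k * deriv e z + of_nat k * z ^ (k - 1) * e z) (at z)"
    using e_derivative_field[OF z(1)] by (auto intro!: derivative_eq_intros)
  ultimately have "z ^ k * deriv e z + of_nat k * z ^ (k - 1) * e z = deriv T u * (- 1 / z\<^sup>2)"
    using DERIV_unique z(3) by metis
  then have "z ^ k * deriv e z = deriv T u * (- 1 / z\<^sup>2) - of_nat k * z ^ (k - 1) * e z"
    by (simp only: eq_diff_eq)
  then have "z * (z ^ k * deriv e z) = - (z * (of_nat k * z ^ (k - 1) * e z)) - deriv T u * (z / z\<^sup>2)"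
    by (simp add: right_diff_distrib)
  also have "z / z\<^sup>2 = u" using z by (simp add: power2_eq_square z_def)
  also have "z * (of_nat k * z ^ (k - 1) * e z) = of_nat k * T u"
    using eT[OF z(1,2)] z(3) by (cases k) (simp_all add: algebra_simps)
  finally show ?thesis by (simp add: z_def mult_ac)
qed

definition W_over_z :: "complex poly" where "W_over_z = poly_shift 1 W"

lemma W_factor: "W = pCons 0 W_over_z"
proof -
  have "coeff W 0 = 0" using W(3) by (simp add: poly_0_coeff_0)
  then show ?thesis
    by (intro poly_eqI) (auto simp: W_over_z_def coeff_poly_shift coeff_pCons split: nat.split)
qed

lemma poly_W: "poly W z = z * poly W_over_z z"
  by (subst W_factor) simp

text \<open>\<open>X\<close> is the known side \<open>W p' + V p\<close> of the relation for \<open>p\<close>; the known side \<open>W e' - V e\<close> of the relation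
for \<open>e\<close> is \<open>Y + G X\<close>, so that \<open>Y\<close> is its part free of \<open>G\<close>.\<close>
abbreviation X :: "complex poly" where "X \<equiv> W * pderiv p + V * p"
abbreviation Y :: "complex poly" where "Y \<equiv> W * pderiv \<psi> + U * p - V * \<psi>"

lemma Y_function:
  assumes z: "norm z \<noteq> 1"
  shows "poly W z * deriv e z - poly V z * e z = poly Y z + G z * poly X z"
proof -
  have "poly W z * deriv e z = poly W z * poly (pderiv \<psi>) z
      + (poly W z * deriv G z) * poly p z + poly W z * G z * poly (pderiv p) z"
    unfolding e_derivative[OF z] by (simp add: algebra_simps)
  then show ?thesis
    unfolding G_ode[OF z] e[OF z] by (simp add: algebra_simps)
qed

text \<open>The determinant and the two Cramer numerators of the linear system for the coefficient functions, in the form from which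
\<open>G\<close> has been eliminated.\<close>
definition casoratian :: "complex poly" where "casoratian = q * \<psi> - p * \<psi>2"
definition numerator_P :: "complex poly" where "numerator_P = X * \<psi> - Y * p"
definition numerator_Q :: "complex poly" where "numerator_Q = X * \<psi>2 - Y * q"

lemma function_forms:
  assumes "norm z \<noteq> 1"
  shows "poly casoratian z = poly q z * e z - poly p z * f z"
    "poly numerator_P z = poly X z * e z - (poly W z * deriv e z - poly V z * e z) * poly p z"
    "poly numerator_Q z = poly X z * f z - (poly W z * deriv e z - poly V z * e z) * poly q z"
  unfolding Y_function[OF assms] casoratian_def numerator_P_def numerator_Q_def
  unfolding e[OF assms] f[OF assms]
  by (simp_all add: algebra_simps)

text \<open>Local factor of \<open>W e' - V e\<close> at \<open>0\<close>. The vanishing of \<open>W\<close> at \<open>0\<close> makes it regular.\<close>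
definition Y_zero where "Y_zero z = poly W_over_z z * (of_nat d * E z + z * deriv E z) - poly V z * E z" for z

lemma zero_form:
  assumes "norm z < 1"
  shows "poly W z * deriv e z - poly V z * e z = z ^ d * Y_zero z"
proof -
  have "poly W z * deriv e z = poly W_over_z z * (z * deriv e z)"
    by (simp add: poly_W)
  then show ?thesis
    using assms e_derivative_zero[OF assms] by (simp add: Y_zero_def e0 algebra_simps)
qed

text \<open>The operator \<open>z d/dz\<close> preserves the degree bound, so its reversal avoids derivatives with respect to \<open>1/z\<close>.\<close>
definition euler_flip where "euler_flip = flip n (pCons 0 (pderiv p))"
definition X_infinity where "X_infinity u = poly (flip m W) u * poly euler_flip u + poly (flip (m - 1) V) u * poly (flip n p) u" for u
definition Y_infinity where "Y_infinity u = poly (flip m W) u * - (of_nat k * T u + u * deriv T u) - poly (flip (m - 1) V) u * T u" for u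

lemma degree_euler: "degree (pCons 0 (pderiv p)) \<le> n"
  using p by (cases "pderiv p = 0") (auto simp: degree_pderiv pderiv_eq_0_iff)

lemma infinity_forms:
  assumes u: "norm u < 1" "u \<noteq> 0"
  shows "u ^ (m + n) * (1 / u * poly X (1 / u)) = X_infinity u"
    and "u ^ m * (1 / u) ^ Suc k * (poly W (1 / u) * deriv e (1 / u) - poly V (1 / u) * e (1 / u)) = Y_infinity u"
proof -
  have m1: "u ^ m = u * u ^ (m - 1)"
    using m by (cases m) auto
  have W': "poly (flip m W) u = u ^ m * poly W (1 / u)"
    and V': "poly (flip (m - 1) V) u = u ^ (m - 1) * poly V (1 / u)"
    and p': "poly (flip n p) u = u ^ n * poly p (1 / u)"
    and euler_flip': "poly euler_flip u = u ^ n * (1 / u * poly (pderiv p) (1 / u))"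
    using W V p u degree_euler by (simp_all add: poly_flip euler_flip_def)
  show "u ^ (m + n) * (1 / u * poly X (1 / u)) = X_infinity u"
    unfolding X_infinity_def W' V' p' euler_flip' power_add m1 using u by (simp add: algebra_simps)
  have z: "norm (1 / u) \<noteq> 1" "1 / u \<noteq> 0" using u by (auto simp: norm_divide)
  have T': "T u = (1 / u) ^ k * e (1 / u)" using eT[OF z] by simp
  show "u ^ m * (1 / u) ^ Suc k * (poly W (1 / u) * deriv e (1 / u) - poly V (1 / u) * e (1 / u)) = Y_infinity u"
    unfolding Y_infinity_def W' V' e_derivative_infinity[OF u, symmetric]
    unfolding T' m1 using u by (simp add: algebra_simps)
qed

text \<open>The order \<open>d\<close> at \<open>0\<close> and the growth at infinity meet, leaving a single monomial.\<close>
lemma determinant: "casoratian = monom (coeff q (Suc n) * T 0) d"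
proof -
  have "\<exists>B. casoratian = monom 1 d * B"
  proof (rule monom_factor_from_zero[where h = "\<lambda>z. poly q z * E z - poly p z * (z * E2 z)"])
    fix z :: complex assume "norm z < 1"
    then show "poly casoratian z = z ^ d * (poly q z * E z - poly p z * (z * E2 z))"
      by (simp add: function_forms e0 f0 algebra_simps)
  next
    show "((\<lambda>z. poly q z * E z - poly p z * (z * E2 z)) \<longlongrightarrow>
        coeff q 0 * E 0 - coeff p 0 * (0 * E2 0)) (at 0)"
      by (intro tendsto_intros jet_tendsto[OF jet_poly] jet_tendsto[OF jet_holomorphic] hol)
  qed
  then obtain B where B: "casoratian = monom 1 d * B" by blast
  have "degree casoratian \<le> d \<and> coeff casoratian d = coeff q (Suc n) * T 0"
  proof (rule degree_le_from_infinity[where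
        h = "\<lambda>u. poly (flip (Suc n) q) u * T u - poly (flip n p) u * (u * T2 u)"])
    fix u :: complex assume u: "u \<noteq> 0" "norm u < 1"
    have z: "norm (1 / u) \<noteq> 1" "1 / u \<noteq> 0" using u by (auto simp: norm_divide)
    have q': "poly (flip (Suc n) q) u = u ^ Suc n * poly q (1 / u)"
      and p': "poly (flip n p) u = u ^ n * poly p (1 / u)"
      by (rule poly_flip[OF q u(1)] poly_flip[OF p u(1)])+
    have "u ^ Suc n = u ^ d * u ^ k" by (simp only: dk[symmetric] power_add)
    then have ud: "u ^ d = u ^ Suc n * (1 / u) ^ k"
      using u by (simp add: power_divide)
    have T': "T u = (1 / u) ^ k * e (1 / u)" "T2 u = (1 / u) ^ k * f (1 / u)"
      using eT[OF z] fT[OF z] by simp_all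
    show "u ^ d * poly casoratian (1 / u) = poly (flip (Suc n) q) u * T u - poly (flip n p) u * (u * T2 u)"
      unfolding q' p' function_forms[OF z(1)] T' ud
      by (simp only: power_Suc right_diff_distrib mult_ac)
  next
    show "((\<lambda>u. poly (flip (Suc n) q) u * T u - poly (flip n p) u * (u * T2 u)) \<longlongrightarrow>
        coeff q (Suc n) * T 0) (at 0)"
    proof -
      have "((\<lambda>u. poly (flip (Suc n) q) u * T u - poly (flip n p) u * (u * T2 u)) \<longlongrightarrow>
        lead (Suc n) q 0 * T 0 - lead n p 0 * (0 * T2 0)) (at 0)"
        by (intro tendsto_diff tendsto_mult tendsto_ident_at jet_tendsto[OF jet_poly]
            jet_tendsto[OF jet_holomorphic] hol)
      then show ?thesis by (simp add: coeff_flip)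
    qed
  qed
  then have deg: "degree casoratian \<le> d" and top: "coeff casoratian d = coeff q (Suc n) * T 0" by auto
  show ?thesis
  proof (rule poly_eqI)
    fix i
    consider "i < d" | "i = d" | "i > d" by linarith
    then show "coeff casoratian i = coeff (monom (coeff q (Suc n) * T 0) d) i"
    proof cases
      case 1
      then show ?thesis by (simp add: B coeff_monom_mult)
    next
      case 2
      then show ?thesis by (simp add: top)
    next
      case 3
      then show ?thesis using deg by (simp add: coeff_eq_0)
    qed
  qed
qed

lemmas jet_X_infinity = jet_add[OF jet_mult[OF jet_poly[of "flip m W"] jet_poly[of euler_flip]]
    jet_mult[OF jet_poly[of "flip (m - 1) V"] jet_poly[of "flip n p"]], folded X_infinity_def]

lemma jet_Y_infinity: "jet Y_infinity
   (lead m W 0 * (- of_nat k * T 0) - lead (m - 1) V 0 * T 0)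
   (lead m W 0 * - (of_nat k * deriv T 0 + deriv T 0) + - of_nat k * T 0 * lead m W 1
     - (lead (m - 1) V 0 * deriv T 0 + T 0 * lead (m - 1) V 1))"
proof -
  have "jet (\<lambda>u. - 1 * (of_nat k * T u + u * deriv T u)) (- 1 * (of_nat k * T 0 + 0))
      (- 1 * (of_nat k * deriv T 0 + T 0 * 0 + deriv T 0) + (of_nat k * T 0 + 0) * 0)"
    by (intro jet_intros hol)
  then have "jet (\<lambda>u. - (of_nat k * T u + u * deriv T u)) (- of_nat k * T 0)
      (- (of_nat k * deriv T 0 + deriv T 0))" by simp
  from jet_diff[OF jet_mult[OF jet_poly[of "flip m W"] this]
      jet_mult[OF jet_poly[of "flip (m - 1) V"] jet_holomorphic[OF hol(3)]]]
  show ?thesis by (simp add: Y_infinity_def[abs_def])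
qed

lemma jet_Y_zero: "jet Y_zero
   (coeff W_over_z 0 * (of_nat d * E 0) - coeff V 0 * E 0)
   (coeff W_over_z 0 * (of_nat d * deriv E 0 + deriv E 0) + of_nat d * E 0 * coeff W_over_z 1
     - (coeff V 0 * deriv E 0 + E 0 * coeff V 1))"
proof -
  have "jet (\<lambda>u. of_nat d * E u + u * deriv E u) (of_nat d * E 0 + 0)
      (of_nat d * deriv E 0 + E 0 * 0 + deriv E 0)"
    by (intro jet_intros hol)
  then have "jet (\<lambda>u. of_nat d * E u + u * deriv E u) (of_nat d * E 0)
      (of_nat d * deriv E 0 + deriv E 0)" by simp
  from jet_diff[OF jet_mult[OF jet_poly[of W_over_z] this] jet_mult[OF jet_poly[of V] jet_holomorphic[OF hol(1)]]]
  show ?thesis by (simp add: Y_zero_def[abs_def])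
qed

lemma power_infinity:
  fixes u :: complex
  assumes "u \<noteq> 0"
  shows "u ^ (m + d - 2) = u ^ (m + n) * (1 / u) ^ Suc k"
    and "u ^ (m + d - 1) = u * (u ^ (m + n) * (1 / u) ^ Suc k)"
proof -
  have "m + n = m + d - 2 + Suc k" "m + d - 1 = Suc (m + d - 2)" using m dk by auto
  then have "u ^ (m + n) = u ^ (m + d - 2) * u ^ Suc k" "u ^ (m + d - 1) = u * u ^ (m + d - 2)"
    by (simp_all only: power_add[symmetric] power_Suc[symmetric])
  with assms show "u ^ (m + d - 2) = u ^ (m + n) * (1 / u) ^ Suc k"
    "u ^ (m + d - 1) = u * (u ^ (m + n) * (1 / u) ^ Suc k)"
    by (simp_all add: power_divide)
qed

text \<open>A polynomial with a zero of order \<open>d\<close> at \<open>0\<close> and controlled growth is divisible by the determinant.\<close>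
lemma factor_and_degree:
  assumes zero: "\<And>z. z \<noteq> 0 \<Longrightarrow> norm z < 1 \<Longrightarrow> poly A z = z ^ d * h z" "(h \<longlongrightarrow> a) (at 0)"
    and inf: "\<And>u. u \<noteq> 0 \<Longrightarrow> norm u < 1 \<Longrightarrow> u ^ (d + N) * poly A (1 / u) = h' u" "(h' \<longlongrightarrow> b) (at 0)"
  shows "\<exists>B. A = casoratian * B \<and> degree B \<le> N"
proof -
  define c where "c = coeff q (Suc n) * T 0"
  have c: "c \<noteq> 0" using nondegenerate by (simp add: c_def)
  obtain B where B: "A = monom 1 d * B"
    using monom_factor_from_zero[OF zero] by blast
  have "degree A \<le> d + N"
    using degree_le_from_infinity[OF inf] by simp
  then have "degree B \<le> N"
    by (cases "B = 0") (simp_all add: B degree_mult_eq degree_monom_eq monom_eq_0_iff)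
  moreover have "A = casoratian * smult (1 / c) B"
    using c by (simp add: B determinant c_def[symmetric] mult_smult_right smult_monom_mult
        mult_smult_left[symmetric] smult_monom del: mult_smult_left)
  ultimately show ?thesis by (intro exI[of _ "smult (1 / c) B"]) auto
qed

text \<open>Cramer's rule. Off the circle the numerators equal expressions in \<open>e\<close> and \<open>f\<close>, which are divisible by \<open>z\<^sup>d\<close> and
grow at most like \<open>z\<^sup>d\<^sup>+\<^sup>m\<^sup>-\<^sup>2\<close> and \<open>z\<^sup>d\<^sup>+\<^sup>m\<^sup>-\<^sup>1\<close>. The relations then hold as polynomial identities after cancelling the
determinant, hence also at \<open>0\<close>, where the determinant may vanish.\<close>
lemma coefficients_exist:
  "\<exists>P Q. degree P \<le> m - 2 \<and> degree Q \<le> m - 1 \<and> X = P * q - Q * p \<and> Y = P * \<psi>2 - Q * \<psi>"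
proof -
  have "\<exists>P. numerator_P = casoratian * P \<and> degree P \<le> m - 2"
  proof (rule factor_and_degree)
    show "poly numerator_P z = z ^ d * (poly X z * E z - Y_zero z * poly p z)" if "norm z < 1" for z
      unfolding function_forms(2)[OF less_imp_neq[OF that]] zero_form[OF that]
      unfolding e0[OF less_imp_neq[OF that]] by (simp add: algebra_simps)
    show "((\<lambda>z. poly X z * E z - Y_zero z * poly p z) \<longlongrightarrow>
        coeff X 0 * E 0 - (coeff W_over_z 0 * (of_nat d * E 0) - coeff V 0 * E 0) * coeff p 0) (at 0)"
      by (intro tendsto_diff tendsto_mult jet_tendsto[OF jet_poly] jet_tendsto[OF jet_Y_zero]
          jet_tendsto[OF jet_holomorphic] hol)
    show "u ^ (d + (m - 2)) * poly numerator_P (1 / u) = X_infinity u * T u - Y_infinity u * poly (flip n p) u"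
      if u: "u \<noteq> 0" "norm u < 1" for u
    proof -
      have z: "norm (1 / u) \<noteq> 1" "1 / u \<noteq> 0" using u by (auto simp: norm_divide)
      have dm: "d + (m - 2) = m + d - 2" using m by simp
      have p': "poly (flip n p) u = u ^ n * poly p (1 / u)"
        using poly_flip[OF p u(1)] .
      have T': "T u = (1 / u) ^ k * e (1 / u)" using eT[OF z] by simp
      show ?thesis
        unfolding dm power_infinity[OF u(1)] infinity_forms[OF u(2,1), symmetric] p' T'
          function_forms(2)[OF z(1)]
        by (simp only: power_add power_Suc right_diff_distrib mult_ac)
    qed
    show "((\<lambda>u. X_infinity u * T u - Y_infinity u * poly (flip n p) u) \<longlongrightarrow>
       (lead m W 0 * coeff euler_flip 0 + lead (m - 1) V 0 * lead n p 0) * T 0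
       - (lead m W 0 * (- of_nat k * T 0) - lead (m - 1) V 0 * T 0) * lead n p 0) (at 0)"
      by (intro tendsto_diff tendsto_mult jet_tendsto[OF jet_poly] jet_tendsto[OF jet_X_infinity]
          jet_tendsto[OF jet_Y_infinity] jet_tendsto[OF jet_holomorphic] hol)
  qed
  then obtain P where P: "numerator_P = casoratian * P" "degree P \<le> m - 2" by blast
  have "\<exists>Q. numerator_Q = casoratian * Q \<and> degree Q \<le> m - 1"
  proof (rule factor_and_degree)
    show "poly numerator_Q z = z ^ d * (poly X z * (z * E2 z) - Y_zero z * poly q z)" if "norm z < 1" for z
      unfolding function_forms(3)[OF less_imp_neq[OF that]] zero_form[OF that]
      unfolding f0[OF less_imp_neq[OF that]] by (simp add: algebra_simps)
    show "((\<lambda>z. poly X z * (z * E2 z) - Y_zero z * poly q z) \<longlongrightarrow>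
        coeff X 0 * (0 * E2 0) - (coeff W_over_z 0 * (of_nat d * E 0) - coeff V 0 * E 0) * coeff q 0) (at 0)"
      by (intro tendsto_diff tendsto_mult tendsto_ident_at jet_tendsto[OF jet_poly] jet_tendsto[OF jet_Y_zero]
          jet_tendsto[OF jet_holomorphic] hol)
    show "u ^ (d + (m - 1)) * poly numerator_Q (1 / u) = u * X_infinity u * T2 u - Y_infinity u * poly (flip (Suc n) q) u"
      if u: "u \<noteq> 0" "norm u < 1" for u
    proof -
      have z: "norm (1 / u) \<noteq> 1" "1 / u \<noteq> 0" using u by (auto simp: norm_divide)
      have dm: "d + (m - 1) = m + d - 1" using m by simp
      have q': "poly (flip (Suc n) q) u = u ^ Suc n * poly q (1 / u)"
        using poly_flip[OF q u(1)] .
      have T': "T2 u = (1 / u) ^ k * f (1 / u)" using fT[OF z] by simp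
      show ?thesis
        unfolding dm power_infinity[OF u(1)] infinity_forms[OF u(2,1), symmetric] q' T'
          function_forms(3)[OF z(1)]
        by (simp only: power_add power_Suc right_diff_distrib mult_ac)
    qed
    show "((\<lambda>u. u * X_infinity u * T2 u - Y_infinity u * poly (flip (Suc n) q) u) \<longlongrightarrow>
       0 * (lead m W 0 * coeff euler_flip 0 + lead (m - 1) V 0 * lead n p 0) * T2 0
       - (lead m W 0 * (- of_nat k * T 0) - lead (m - 1) V 0 * T 0) * lead (Suc n) q 0) (at 0)"
      by (intro tendsto_diff tendsto_mult tendsto_ident_at jet_tendsto[OF jet_poly] jet_tendsto[OF jet_X_infinity]
          jet_tendsto[OF jet_Y_infinity] jet_tendsto[OF jet_holomorphic] hol)
  qed
  then obtain Q where Q: "numerator_Q = casoratian * Q" "degree Q \<le> m - 1" by blast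
  have nz: "casoratian \<noteq> 0" using nondegenerate by (simp add: determinant monom_eq_0_iff)
  have "casoratian * X = numerator_P * q - numerator_Q * p" "casoratian * Y = numerator_P * \<psi>2 - numerator_Q * \<psi>"
    unfolding casoratian_def numerator_P_def numerator_Q_def by (simp_all only: algebra_simps)
  then have "casoratian * X = casoratian * (P * q - Q * p)" "casoratian * Y = casoratian * (P * \<psi>2 - Q * \<psi>)"
    unfolding P Q by (simp_all only: right_diff_distrib mult.assoc)
  then have "X = P * q - Q * p" "Y = P * \<psi>2 - Q * \<psi>"
    using nz by (simp_all only: mult_cancel_left simp_thms)
  with P Q show ?thesis by blast
qed

lemma coefficients_unique:
  assumes z: "norm z \<noteq> 1" "z \<noteq> 0"
    and "poly W z * poly (pderiv p) z = \<theta> * poly q z - (\<omega> + poly V z) * poly p z"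
    and "poly W z * deriv e z = \<theta> * f z - (\<omega> - poly V z) * e z"
    and "poly W z * poly (pderiv p) z = \<theta>' * poly q z - (\<omega>' + poly V z) * poly p z"
    and "poly W z * deriv e z = \<theta>' * f z - (\<omega>' - poly V z) * e z"
  shows "\<theta> = \<theta>' \<and> \<omega> = \<omega>'"
proof -
  have D: "poly q z * e z - poly p z * f z \<noteq> 0"
    using nondegenerate z(2) unfolding function_forms(1)[OF z(1), symmetric] determinant
    by (simp add: poly_monom)
  have 1: "(\<theta> - \<theta>') * poly q z = (\<omega> - \<omega>') * poly p z" "(\<theta> - \<theta>') * f z = (\<omega> - \<omega>') * e z"
    using assms(3-6) by algebra+
  have "(\<theta> - \<theta>') * (poly q z * e z - poly p z * f z) = 0"
    "(\<omega> - \<omega>') * (poly q z * e z - poly p z * f z) = 0"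
    using 1 by algebra+
  then show ?thesis using D by simp
qed

context
  fixes P Q
  assumes P: "degree P \<le> m - 2" and Q: "degree Q \<le> m - 1"
    and PQ: "X = P * q - Q * p" "Y = P * \<psi>2 - Q * \<psi>"
begin

lemma first_relation: "poly W z * poly (pderiv p) z = poly P z * poly q z - (poly Q z + poly V z) * poly p z"
  using arg_cong[OF PQ(1), of "\<lambda>A. poly A z"] by (simp add: algebra_simps)

lemma second_relation:
  assumes "norm z \<noteq> 1"
  shows "poly W z * deriv e z = poly P z * f z - (poly Q z - poly V z) * e z"
proof -
  have "poly W z * deriv e z - poly V z * e z = poly P z * f z - poly Q z * e z"
    unfolding Y_function[OF assms] PQ
    unfolding e[OF assms] f[OF assms] by (simp add: algebra_simps)
  then show ?thesis by (simp add: algebra_simps)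
qed

lemma second_relation': 
  "norm z \<noteq> 1 \<Longrightarrow> poly W z * deriv e z - poly V z * e z = poly P z * f z - poly Q z * e z"
  using second_relation by (simp add: algebra_simps)

text \<open>The next four lemmas compare the first two orders of both relations at \<open>0\<close> and at infinity. The coefficients of \<open>P\<close> occur one
order later in the relations for \<open>e\<close> than those of \<open>Q\<close>.\<close>
lemma zero_coefficients_p:
  "coeff V 0 * coeff p 0 = coeff P 0 * coeff q 0 - coeff Q 0 * coeff p 0" (is ?first)
  "coeff W 1 * coeff p 1 + coeff V 0 * coeff p 1 + coeff V 1 * coeff p 0
     = coeff P 0 * coeff q 1 + coeff P 1 * coeff q 0 - coeff Q 0 * coeff p 1 - coeff Q 1 * coeff p 0" (is ?second)
proof -
  have W0: "coeff W 0 = 0" by (subst W_factor) simp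
  show ?first
    using arg_cong[OF PQ(1), of "\<lambda>A. coeff A 0"] by (simp add: coeff_mult W0)
  show ?second
    using arg_cong[OF PQ(1), of "\<lambda>A. coeff A 1"]
    by (simp add: coeff_mult W0 coeff_pderiv algebra_simps)
qed

lemma zero_coefficients_e:
  "coeff W 1 * of_nat d * E 0 - coeff V 0 * E 0 = - coeff Q 0 * E 0" (is ?first)
  "coeff W 2 * of_nat d * E 0 + coeff W 1 * (of_nat d + 1) * deriv E 0
      - coeff V 0 * deriv E 0 - coeff V 1 * E 0
     = coeff P 0 * E2 0 - coeff Q 0 * deriv E 0 - coeff Q 1 * E 0" (is ?second)
proof -
  have Wc: "coeff W_over_z 0 = coeff W 1" "coeff W_over_z 1 = coeff W 2"
    by (simp_all add: W_over_z_def coeff_poly_shift numeral_2_eq_2)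
  have "jet (\<lambda>z. poly P z * (z * E2 z) - poly Q z * E z)
     (coeff P 0 * (0 * E2 0) - coeff Q 0 * E 0)
     (coeff P 0 * (0 * deriv E2 0 + E2 0 * 1) + 0 * E2 0 * coeff P 1 - (coeff Q 0 * deriv E 0 + E 0 * coeff Q 1))"
    by (intro jet_intros hol)
  note J = this
  have eq: "Y_zero z = poly P z * (z * E2 z) - poly Q z * E z" if z: "z \<noteq> 0" "norm z < 1" for z
  proof -
    have n1: "norm z \<noteq> 1" using z by simp
    have "z ^ d * Y_zero z = poly P z * f z - poly Q z * e z"
      unfolding zero_form[OF z(2), symmetric] by (rule second_relation'[OF n1])
    also have "\<dots> = z ^ d * (poly P z * (z * E2 z) - poly Q z * E z)"
      unfolding e0[OF n1] f0[OF n1] by (simp add: algebra_simps)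
    finally show ?thesis using z by simp
  qed
  from jet_unique[OF jet_Y_zero J eq] show ?first
    ?second
    unfolding Wc by (simp_all add: algebra_simps)
qed

lemma coeff_flip_W: "lead m W 0 = 1"
  using W by (simp add: coeff_flip)

lemma coeff_euler_flip: "coeff euler_flip 0 = of_nat n * lead n p 0" (is ?first)
    "coeff euler_flip 1 = (of_nat n - 1) * lead n p 1" (is ?second)
proof -
  show ?first
    unfolding euler_flip_def coeff_flip by (cases n) (simp_all add: coeff_pderiv)
  show ?second
  proof (cases n)
    case (Suc n')
    then show ?thesis
      unfolding euler_flip_def coeff_flip by (cases n') (simp_all add: coeff_pderiv)
  next
    case 0
    then show ?thesis
      unfolding euler_flip_def coeff_flip by simp
  qed
qed

lemma infinity_coefficients_p:
  "of_nat n * lead n p 0 + lead (m - 1) V 0 * lead n p 0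
     = lead (m - 2) P 0 * lead (Suc n) q 0 - lead (m - 1) Q 0 * lead n p 0" (is ?first)
  "(of_nat n - 1) * lead n p 1 + lead m W 1 * of_nat n * lead n p 0
      + lead (m - 1) V 0 * lead n p 1 + lead (m - 1) V 1 * lead n p 0
     = lead (m - 2) P 0 * lead (Suc n) q 1 + lead (m - 2) P 1 * lead (Suc n) q 0
       - lead (m - 1) Q 0 * lead n p 1 - lead (m - 1) Q 1 * lead n p 0" (is ?second)
proof -
  note J = jet_diff[OF jet_mult[OF jet_poly[of "flip (m - 2) P"] jet_poly[of "flip (Suc n) q"]]
     jet_mult[OF jet_poly[of "flip (m - 1) Q"] jet_poly[of "flip n p"]]]
  have eq: "X_infinity u = poly (flip (m - 2) P) u * poly (flip (Suc n) q) u - poly (flip (m - 1) Q) u * poly (flip n p) u"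
    if u: "u \<noteq> 0" "norm u < 1" for u
  proof -
    have "m + n = Suc (m - 2) + Suc n" using m by simp
    then have 1: "u ^ (m + n) = u * u ^ (m - 2) * u ^ Suc n" by (simp only: power_add power_Suc)
    have "m - 1 = Suc (m - 2)" using m by simp
    then have 2: "u ^ (m - 1) = u * u ^ (m - 2)" by (simp only: power_Suc)
    show ?thesis
      unfolding infinity_forms(1)[OF u(2,1), symmetric] PQ poly_flip[OF P u(1)] poly_flip[OF Q u(1)]
        poly_flip[OF p u(1)] poly_flip[OF q u(1)] 1 2
      using u by (simp add: algebra_simps)
  qed
  note K = jet_unique[OF jet_X_infinity J eq]
  show ?first
    using conjunct1[OF K] by (simp add: coeff_flip_W coeff_euler_flip)
  show ?second
    using conjunct2[OF K] unfolding coeff_flip_W coeff_euler_flip by (simp add: algebra_simps)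
qed

lemma infinity_coefficients_e:
  "- of_nat k * T 0 - lead (m - 1) V 0 * T 0 = - lead (m - 1) Q 0 * T 0" (is ?first)
  "- of_nat k * lead m W 1 * T 0 - (of_nat k + 1) * deriv T 0
      - lead (m - 1) V 0 * deriv T 0 - lead (m - 1) V 1 * T 0
     = lead (m - 2) P 0 * T2 0
       - lead (m - 1) Q 0 * deriv T 0 - lead (m - 1) Q 1 * T 0" (is ?second)
proof -
  have J: "jet (\<lambda>u. poly (flip (m - 2) P) u * (u * T2 u) - poly (flip (m - 1) Q) u * T u)
     (lead (m - 2) P 0 * (0 * T2 0) - lead (m - 1) Q 0 * T 0)
     (lead (m - 2) P 0 * (0 * deriv T2 0 + T2 0 * 1) + 0 * T2 0 * lead (m - 2) P 1
       - (lead (m - 1) Q 0 * deriv T 0 + T 0 * lead (m - 1) Q 1))"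
    by (intro jet_intros hol)
  have eq: "Y_infinity u = poly (flip (m - 2) P) u * (u * T2 u) - poly (flip (m - 1) Q) u * T u"
    if u: "u \<noteq> 0" "norm u < 1" for u
  proof -
    have z: "norm (1 / u) \<noteq> 1" "1 / u \<noteq> 0" using u by (auto simp: norm_divide)
    have "m = Suc (Suc (m - 2))" using m by simp
    then have 1: "u ^ m = u * (u * u ^ (m - 2))" by (metis power_Suc)
    have "m - 1 = Suc (m - 2)" using m by simp
    then have 2: "u ^ (m - 1) = u * u ^ (m - 2)" by (simp only: power_Suc)
    have T': "T u = (1 / u) ^ k * e (1 / u)" using eT[OF z] by simp
    have T2': "T2 u = (1 / u) ^ k * f (1 / u)" using fT[OF z] by simp
    show ?thesis
      unfolding infinity_forms(2)[OF u(2,1), symmetric] second_relation'[OF z(1)]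
        poly_flip[OF P u(1)] poly_flip[OF Q u(1)] 1 2 T' T2'
      using u by (simp add: algebra_simps)
  qed
  note K = jet_unique[OF jet_Y_infinity J eq]
  show ?first
    using conjunct1[OF K] by (simp add: coeff_flip_W)
  show ?second
    using conjunct2[OF K] by (simp add: coeff_flip_W algebra_simps)
qed

end
end

section \<open>Solving for the leading and trailing coefficients\<close>

text \<open>In this and the following three lemmas the unknowns \<open>\<pi>0\<close>, \<open>\<pi>1\<close>, \<open>\<omega>0\<close>, \<open>\<omega>1\<close> are the first two coefficients of \<open>P\<close> and \<open>Q\<close>,
obtained in the order \<open>\<omega>0\<close>, \<open>\<pi>0\<close>, \<open>\<omega>1\<close>, \<open>\<pi>1\<close>. The letters \<open>a\<close>, \<open>b\<close>, \<open>c\<close> are consecutive \<open>\<kappa>\<close>'s starting with \<open>\<kappa>\<^sub>n\<close>, a prime marks the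
index \<open>n - 1\<close>, and \<open>T\<close> and \<open>E\<close> are expansion coefficients of the associated functions at infinity and at \<open>0\<close>. The starred
versions conclude about negatives, because \<open>P = - \<Theta>\<^sub>n\<^sup>*\<close> and \<open>Q = - \<Omega>\<^sub>n\<^sup>*\<close> there.\<close>
lemma top_coefficients:
  fixes a b c x y ln l1 yb N r S R T0 T1 T20 \<omega>0 \<omega>1 \<pi>0 \<pi>1 :: complex
  assumes nz: "a \<noteq> 0" "b \<noteq> 0" "c \<noteq> 0" "x \<noteq> 0"
    and rec: "a * l1 = b * ln + x * yb"
    and T: "T0 = 2 * x / (a * b)" "T1 = - 2 * (x * l1 / (a * b) - a * y / (b * c)) / b" "T20 = 2 * y / (b * c)"
    and e0: "- T0 - r / 2 * T0 = - \<omega>0 * T0"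
    and e1: "S * T0 - 2 * T1 - r / 2 * T1 - (R - r * S) / 2 * T0 = \<pi>0 * T20 - \<omega>0 * T1 - \<omega>1 * T0"
    and p0: "N * a + r / 2 * a = \<pi>0 * b - \<omega>0 * a"
    and p1: "(N - 1) * ln - S * N * a + r / 2 * ln + (R - r * S) / 2 * a
       = \<pi>0 * l1 + \<pi>1 * b - \<omega>0 * ln - \<omega>1 * a"
  shows "\<omega>0 = 1 + r / 2" "\<pi>0 = (N + 1 + r) * (a / b)"
    "\<omega>1 = - 1/2 * r * S + 1/2 * R - S + (N + 2 + r) * (a ^ 2 / (c * b)) * (y / x) - l1 / b" (is "_ = ?w1")
    "\<pi>1 = - ((N + 1 + r) * S - R) * (a / b) + (N + 2 + r) * (a ^ 3 / (b ^ 2 * c)) * (y / x)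
        - (N + r) * (x * yb / b ^ 2) - 2 * (a * l1 / b ^ 2)" (is "_ = ?p1")
proof -
  have T0: "T0 \<noteq> 0" using nz by (simp add: T)
  have "T0 * (\<omega>0 * 2) = T0 * (r + 2)" using e0 by (simp add: field_simps)
  then have "\<omega>0 * 2 = r + 2" using T0 mult_left_cancel by blast
  then show w0: "\<omega>0 = 1 + r / 2" by (simp add: field_simps)
  have "\<pi>0 * b = (N + 1 + r) * a" using p0 unfolding w0 by (simp add: algebra_simps)
  then show p0': "\<pi>0 = (N + 1 + r) * (a / b)" using nz by (simp add: field_simps)
  have "\<omega>1 * T0 = \<pi>0 * T20 + T1 - S * T0 + (R - r * S) / 2 * T0"
    using e1 unfolding w0 by (simp add: algebra_simps)
  also have "\<dots> = ?w1 * T0"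
    unfolding p0' T using nz by (simp add: field_simps power2_eq_square)
  finally show w1: "\<omega>1 = ?w1"
    using T0 mult_right_cancel by blast
  have ln: "ln = (a * l1 - x * yb) / b" using rec nz by (simp add: field_simps)
  have "\<pi>1 * b = (N + r) * ln - S * N * a + (R - r * S) / 2 * a - \<pi>0 * l1 + \<omega>1 * a"
    using p1 unfolding w0 by (simp add: algebra_simps)
  also have "\<dots> = ?p1 * b"
    unfolding p0' w1 ln using nz by (simp add: field_simps power2_eq_square power3_eq_cube)
  finally show "\<pi>1 = ?p1"
    using nz mult_right_cancel by blast
qed

text \<open>The last formula involves \<open>db0\<close>, the coefficient of \<open>z\<^sup>n\<^sup>-\<^sup>1\<close> in the reversed polynomial of index \<open>n\<close>. It is expressed through
the index \<open>n - 1\<close>, and this is where \<open>n \<ge> 1\<close> is required.\<close>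
lemma star_top_coefficients:
  fixes a b a' x1 y0 y1 y' l0 l1 l' db0 db1 N r S R T0 T1 T20 \<omega>0 \<omega>1 \<pi>0 \<pi>1 :: complex
  assumes nz: "a \<noteq> 0" "b \<noteq> 0" "y1 \<noteq> 0"
    and T: "T0 = 2 / a" "T1 = - 2 * l1 / (a * b)" "T20 = 2 / b"
    and e0: "- r / 2 * T0 = - \<omega>0 * T0"
    and e1: "- T1 - r / 2 * T1 - (R - r * S) / 2 * T0 = \<pi>0 * T20 - \<omega>0 * T1 - \<omega>1 * T0"
    and p0: "N * y0 + r / 2 * y0 = \<pi>0 * y1 - \<omega>0 * y0"
    and p1: "(N - 1) * db0 - S * N * y0 + r / 2 * db0 + (R - r * S) / 2 * y0
       = \<pi>0 * db1 + \<pi>1 * y1 - \<omega>0 * db0 - \<omega>1 * y0"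
  shows "- \<omega>0 = - r / 2" "- \<pi>0 = - (N + r) * (y0 / y1)"
    "- \<omega>1 = 1/2 * r * S - 1/2 * R - (N + r) * (a / b) * (y0 / y1) + l1 / b" (is "_ = ?w1")
    "a' \<noteq> 0 \<Longrightarrow> a' * db0 = a * y' + y0 * l' \<Longrightarrow> a * db1 = b * y0 + y1 * l0 \<Longrightarrow> a * l1 = b * l0 + x1 * y0
      \<Longrightarrow> b ^ 2 - a ^ 2 = x1 * y1 \<Longrightarrow>
      - \<pi>1 = ((N + r) * S - R) * (y0 / y1) + (N + 1 + r) * (y0 / y1) * (l1 / b)
        - (N - 1 + r) * ((a * y' + y0 * l') / (a' * y1))"
proof -
  have T0: "T0 \<noteq> 0" using nz by (simp add: T)
  have "(r / 2 - \<omega>0) * T0 = 0" using e0 by (simp add: algebra_simps)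
  then have w0: "\<omega>0 = r / 2" using T0 by simp
  then show "- \<omega>0 = - r / 2" by simp
  have "\<pi>0 * y1 = (N + r) * y0" using p0 unfolding w0 by (simp add: algebra_simps)
  then have p0': "\<pi>0 = (N + r) * (y0 / y1)" using nz by (simp add: field_simps)
  then show "- \<pi>0 = - (N + r) * (y0 / y1)" by (simp only: mult_minus_left)
  have "- \<omega>1 * T0 = - T1 - (R - r * S) / 2 * T0 - \<pi>0 * T20"
    using e1 unfolding w0 by (simp add: algebra_simps)
  also have "\<dots> = ?w1 * T0"
    unfolding p0' T using nz by (simp add: field_simps power2_eq_square)
  finally show w1: "- \<omega>1 = ?w1"
    using T0 mult_right_cancel by blast
  assume a': "a' \<noteq> 0" "a' * db0 = a * y' + y0 * l'" and d1: "a * db1 = b * y0 + y1 * l0"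
    and l0: "a * l1 = b * l0 + x1 * y0" and sq: "b ^ 2 - a ^ 2 = x1 * y1"
  have db0: "(a * y' + y0 * l') / a' = db0" using a' by (simp add: field_simps)
  have "a * b * db1 = b * b * y0 + y1 * (b * l0)" using d1 by algebra
  also have "\<dots> = a * (y1 * l1 + a * y0)"
    using l0 sq unfolding power2_eq_square by algebra
  finally have "b * db1 = y1 * l1 + a * y0" using nz by simp
  then have db1: "db1 = (y1 * l1 + a * y0) / b" using nz by (simp add: field_simps)
  have "- \<pi>1 * y1 = - (N - 1 + r) * db0 + S * N * y0 - (R - r * S) / 2 * y0 + \<pi>0 * db1 + (- \<omega>1) * y0"
    using p1 unfolding w0 by (simp add: algebra_simps)
  also have "\<dots> = (((N + r) * S - R) * (y0 / y1) + (N + 1 + r) * (y0 / y1) * (l1 / b)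
        - (N - 1 + r) * (db0 / y1)) * y1"
    unfolding p0' w1 db1 using nz by (simp add: field_simps power2_eq_square power3_eq_cube)
  finally have "- \<pi>1 = ((N + r) * S - R) * (y0 / y1) + (N + 1 + r) * (y0 / y1) * (l1 / b)
        - (N - 1 + r) * (db0 / y1)"
    using nz mult_right_cancel by blast
  then show "- \<pi>1 = ((N + r) * S - R) * (y0 / y1) + (N + 1 + r) * (y0 / y1) * (l1 / b)
        - (N - 1 + r) * ((a * y' + y0 * l') / (a' * y1))"
    by (simp only: db0[symmetric] divide_divide_eq_left)
qed

text \<open>The equations first produce \<open>\<omega>1\<close> in terms of \<open>b1\<close> alone. The stated form with \<open>b0\<close> and \<open>b1\<close> follows from the
recurrence for subleading coefficients and \<open>b\<^sup>2 - a\<^sup>2 = x1 y1\<close>.\<close>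
lemma low_coefficients:
  fixes a b a' x0 x1 x' y1 b0 b1 b' d0 d1 N V0 V1 W1 W2 E0 E1 E20 \<omega>0 \<omega>1 \<pi>0 \<pi>1 :: complex
  assumes nz: "a \<noteq> 0" "b \<noteq> 0" "x1 \<noteq> 0"
    and rec: "a * b1 = b * b0 + y1 * x0" "b ^ 2 - a ^ 2 = x1 * y1" "a * d1 = b * x0 + x1 * b0"
    and E: "E0 = 2 / a" "E1 = - 2 * b1 / (a * b)" "E20 = 2 / b"
    and e0: "W1 * N * E0 - V0 * E0 = - \<omega>0 * E0"
    and e1: "W2 / 2 * N * E0 + W1 * (N + 1) * E1 - V0 * E1 - V1 * E0 = \<pi>0 * E20 - \<omega>0 * E1 - \<omega>1 * E0"
    and p0: "V0 * x0 = \<pi>0 * x1 - \<omega>0 * x0"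
    and p1: "W1 * d0 + V0 * d0 + V1 * x0 = \<pi>0 * d1 + \<pi>1 * x1 - \<omega>0 * d0 - \<omega>1 * x0"
  shows "\<omega>0 = V0 - N * W1" "\<pi>0 = (2 * V0 - N * W1) * (x0 / x1)"
    "\<omega>1 = V1 - 1/2 * N * W2 + (V0 * (a / b) + (V0 - N * W1) * (b / a)) * (x0 / x1)
        + (V0 - N * W1) * (b0 / a) - (V0 - (N + 1) * W1) * (b1 / b)"
    "a' \<noteq> 0 \<Longrightarrow> a' * d0 = a * x' + x0 * b' \<Longrightarrow>
     \<pi>1 = (2 * V1 - 1/2 * N * W2) * (x0 / x1) + (2 * V0 - (N - 1) * W1) * (a * x' / (a' * x1))
        + (((N + 1) * W1 - 2 * V0) * (b1 / b) - ((N - 1) * W1 - 2 * V0) * (b' / a')) * (x0 / x1)" (is "_ \<Longrightarrow> _ \<Longrightarrow> _ = ?p1")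
proof -
  have E0: "E0 \<noteq> 0" using nz by (simp add: E)
  have "(V0 - N * W1 - \<omega>0) * E0 = 0" using e0 by (simp add: algebra_simps)
  then show w0: "\<omega>0 = V0 - N * W1" using E0 by simp
  have "\<pi>0 * x1 = (2 * V0 - N * W1) * x0" using p0 unfolding w0 by (simp add: algebra_simps)
  then show p0': "\<pi>0 = (2 * V0 - N * W1) * (x0 / x1)" using nz by (simp add: field_simps)
  have "\<omega>1 * E0 = \<pi>0 * E20 - W1 * E1 - W2 / 2 * N * E0 + V1 * E0"
    using e1 unfolding w0 by (simp add: algebra_simps)
  also have "\<dots> = (V1 - 1/2 * N * W2 + (2 * V0 - N * W1) * (a / b) * (x0 / x1) + W1 * (b1 / b)) * E0"
    unfolding p0' E using nz by (simp add: field_simps power2_eq_square)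
  finally have w1: "\<omega>1 = V1 - 1/2 * N * W2 + (2 * V0 - N * W1) * (a / b) * (x0 / x1) + W1 * (b1 / b)"
    using E0 mult_right_cancel by blast
  have "(b1 * a - b0 * b) * x1 = (b * b - a * a) * x0"
    using rec(1,2) unfolding power2_eq_square by algebra
  then have "(b1 * a - b0 * b) * x1 / (a * b * x1) = (b * b - a * a) * x0 / (a * b * x1)"
    by simp
  moreover have "(b1 * a - b0 * b) * x1 / (a * b * x1) = b1 / b - b0 / a"
    using nz by (simp add: diff_divide_distrib)
  moreover have "(b * b - a * a) * x0 / (a * b * x1) = (b / a - a / b) * (x0 / x1)"
    using nz by (simp add: diff_divide_distrib left_diff_distrib)
  ultimately have "b1 / b - b0 / a = (b / a - a / b) * (x0 / x1)"
    by simp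
  then have b0: "b0 / a = b1 / b - (b / a - a / b) * (x0 / x1)" by (simp add: algebra_simps)
  show "\<omega>1 = V1 - 1/2 * N * W2 + (V0 * (a / b) + (V0 - N * W1) * (b / a)) * (x0 / x1)
        + (V0 - N * W1) * (b0 / a) - (V0 - (N + 1) * W1) * (b1 / b)"
  proof -
    have "V1 - 1/2 * N * W2 + (2 * V0 - N * W1) * s * v + W1 * t
        = V1 - 1/2 * N * W2 + (V0 * s + (V0 - N * W1) * s') * v
          + (V0 - N * W1) * (t - (s' - s) * v) - (V0 - (N + 1) * W1) * t" for s s' t v
      by (simp add: algebra_simps)
    then show ?thesis unfolding w1 b0 .
  qed
  assume a': "a' \<noteq> 0" "a' * d0 = a * x' + x0 * b'"
  have "a * b * d1 = b * b * x0 + x1 * (b * b0)" using rec(3) by algebra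
  also have "\<dots> = a * (a * x0 + x1 * b1)"
    using rec(1,2) unfolding power2_eq_square by algebra
  finally have "b * d1 = a * x0 + x1 * b1" using nz by simp
  then have d1: "d1 = (a * x0 + x1 * b1) / b" using nz by (simp add: field_simps)
  have d0: "d0 = (a * x' + x0 * b') / a'" using a' by (simp add: field_simps)
  have "\<pi>1 * x1 = (2 * V0 - (N - 1) * W1) * d0 + V1 * x0 - \<pi>0 * d1 + \<omega>1 * x0"
    using p1 unfolding w0 by (simp add: algebra_simps)
  also have "\<dots> = ?p1 * x1"
    unfolding p0' w1 d1 d0 using nz a' by (simp add: field_simps power2_eq_square)
  finally show "\<pi>1 = ?p1"
    using nz mult_right_cancel by blast
qed

lemma star_low_coefficients:
  fixes a b c y1 y2 b0 b1 N V0 V1 W1 W2 E0 E1 E20 \<omega>0 \<omega>1 \<pi>0 \<pi>1 :: complex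
  assumes nz: "a \<noteq> 0" "b \<noteq> 0" "c \<noteq> 0" "y1 \<noteq> 0"
    and E: "E0 = 2 * y1 / (a * b)" "E1 = - 2 * (y1 * b1 / (a * b) - a * y2 / (b * c)) / b" "E20 = 2 * y2 / (b * c)"
    and e0: "W1 * (N + 1) * E0 - V0 * E0 = - \<omega>0 * E0"
    and e1: "W2 / 2 * (N + 1) * E0 + W1 * (N + 2) * E1 - V0 * E1 - V1 * E0 = \<pi>0 * E20 - \<omega>0 * E1 - \<omega>1 * E0"
    and p0: "V0 * a = \<pi>0 * b - \<omega>0 * a"
    and p1: "W1 * b0 + V0 * b0 + V1 * a = \<pi>0 * b1 + \<pi>1 * b - \<omega>0 * b0 - \<omega>1 * a"
  shows "- \<omega>0 = (N + 1) * W1 - V0" "- \<pi>0 = - (2 * V0 - (N + 1) * W1) * (a / b)"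
    "- \<omega>1 = 1/2 * (N + 1) * W2 - V1 + ((N + 2) * W1 - 2 * V0) * (a ^ 2 / (c * b)) * (y2 / y1)
        - W1 * (b1 / b)" (is "_ = ?w1")
    "- \<pi>1 = - (2 * V1 - 1/2 * (N + 1) * W2) * (a / b) - (2 * V0 - N * W1) * (b0 / b)
        + ((N + 2) * W1 - 2 * V0) * (a ^ 3 / (c * b ^ 2) * (y2 / y1) - a / b * (b1 / b))" (is "_ = ?p1")
proof -
  have E0: "E0 \<noteq> 0" using nz by (simp add: E)
  have "(V0 - (N + 1) * W1 - \<omega>0) * E0 = 0" using e0 by (simp add: algebra_simps)
  then have w0: "\<omega>0 = V0 - (N + 1) * W1" using E0 by simp
  then show "- \<omega>0 = (N + 1) * W1 - V0" by simp
  have "\<pi>0 * b = (2 * V0 - (N + 1) * W1) * a" using p0 unfolding w0 by (simp add: algebra_simps)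
  then have p0': "\<pi>0 = (2 * V0 - (N + 1) * W1) * (a / b)" using nz by (simp add: field_simps)
  then show "- \<pi>0 = - (2 * V0 - (N + 1) * W1) * (a / b)" by (simp only: mult_minus_left)
  have "- \<omega>1 * E0 = W2 / 2 * (N + 1) * E0 + W1 * E1 - V1 * E0 - \<pi>0 * E20"
    using e1 unfolding w0 by (simp add: algebra_simps)
  also have "\<dots> = ?w1 * E0"
    unfolding p0' E using nz by (simp add: field_simps power2_eq_square)
  finally show w1: "- \<omega>1 = ?w1"
    using E0 mult_right_cancel by blast
  have "- \<pi>1 * b = \<pi>0 * b1 - (2 * V0 - N * W1) * b0 - V1 * a + (- \<omega>1) * a"
    using p1 unfolding w0 by (simp add: algebra_simps)
  also have "\<dots> = ?p1 * b"
    unfolding p0' w1 using nz by (simp add: field_simps power2_eq_square power3_eq_cube)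
  finally show "- \<pi>1 = ?p1"
    using nz mult_right_cancel by blast
qed

section \<open>Coefficients of the given polynomials and their expansions\<close>

lemma degree_coeffs_prod_linear:
  fixes zs :: "nat \<Rightarrow> complex"
  assumes "finite A"
  shows "degree (\<Prod>i\<in>A. [:- zs i, 1:]) = card A \<and> coeff (\<Prod>i\<in>A. [:- zs i, 1:]) (card A) = 1
    \<and> coeff (pCons 0 (\<Prod>i\<in>A. [:- zs i, 1:])) (card A) = - (\<Sum>i\<in>A. zs i)"
  using assms
proof (induction A rule: finite_induct)
  case (insert x A)
  let ?p = "\<Prod>i\<in>A. [:- zs i, 1:]"
  have top: "coeff ?p (card A) = 1" and deg: "degree ?p = card A"
    and sub: "coeff (pCons 0 ?p) (card A) = - (\<Sum>i\<in>A. zs i)" using insert.IH by auto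
  have "?p \<noteq> 0" using top by auto
  then have "degree ([:- zs x, 1:] * ?p) = Suc (card A)"
    by (subst degree_mult_eq) (auto simp: deg)
  moreover have "coeff ([:- zs x, 1:] * ?p) (Suc (card A)) = 1"
    using top deg by (simp add: coeff_eq_0)
  moreover have "coeff (pCons 0 ([:- zs x, 1:] * ?p)) (Suc (card A)) = - zs x - (\<Sum>i\<in>A. zs i)"
    using sub by (simp add: top)
  ultimately show ?case using insert.hyps by simp
qed simp

lemma coeff_flip_one: "N \<ge> 1 \<Longrightarrow> lead N A 1 = coeff A (N - 1)"
  by (simp add: coeff_flip)

lemma coeff_pCons_pos: "N \<ge> 1 \<Longrightarrow> coeff (pCons 0 A) N = coeff A (N - 1)"
  by (cases N) auto

lemma W_poly_coeffs:
  assumes "m \<ge> 1"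
  shows "degree (W_poly m zs) = m" "lead_coeff (W_poly m zs) = 1"
    "lead m (W_poly m zs) 1 = - (\<Sum>j=1..m. zs j)"
  using degree_coeffs_prod_linear[of "{1..m}" zs] assms
  by (simp_all add: W_poly_def coeff_flip_one coeff_pCons_pos del: One_nat_def)

lemma V_poly_coeffs:
  assumes m: "m \<ge> 2"
  shows "degree (V_poly m zs \<rho>) \<le> m - 1"
    "lead (m - 1) (V_poly m zs \<rho>) 0 = (\<Sum>j=1..m. \<rho> j) / 2"
    "lead (m - 1) (V_poly m zs \<rho>) 1
       = ((\<Sum>j=1..m. \<rho> j * zs j) - (\<Sum>j=1..m. \<rho> j) * (\<Sum>j=1..m. zs j)) / 2"
proof -
  define p where "p j = (\<Prod>i\<in>{1..m} - {j}. [:- zs i, 1:])" for j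
  have p: "degree (p j) = m - 1" "coeff (p j) (m - 1) = 1"
    "coeff (p j) (m - 1 - 1) = zs j - (\<Sum>j=1..m. zs j)" if "j \<in> {1..m}" for j
  proof -
    have c: "card ({1..m} - {j}) = m - 1" using that by simp
    show "degree (p j) = m - 1" "coeff (p j) (m - 1) = 1"
      "coeff (p j) (m - 1 - 1) = zs j - (\<Sum>j=1..m. zs j)"
      using degree_coeffs_prod_linear[of "{1..m} - {j}" zs] that m
      unfolding c p_def[symmetric] by (simp_all add: coeff_pCons_pos sum_diff1)
  qed
  have V: "V_poly m zs \<rho> = smult (1/2) (\<Sum>j=1..m. smult (\<rho> j) (p j))"
    by (simp add: V_poly_def p_def)
  show "degree (V_poly m zs \<rho>) \<le> m - 1"
    unfolding V using p(1)
    by (intro order.trans[OF degree_smult_le] degree_sum_le) (auto intro: order.trans[OF degree_smult_le])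
  show "lead (m - 1) (V_poly m zs \<rho>) 0 = (\<Sum>j=1..m. \<rho> j) / 2"
    unfolding V by (simp add: coeff_flip coeff_sum p(2) del: One_nat_def)
  have "lead (m - 1) (V_poly m zs \<rho>) 1 = coeff (V_poly m zs \<rho>) (m - 1 - 1)"
    using m by (intro coeff_flip_one) simp
  also have "\<dots> = (\<Sum>j=1..m. \<rho> j * (zs j - (\<Sum>j=1..m. zs j))) / 2"
    unfolding V using p(3) by (simp add: coeff_sum del: One_nat_def diff_diff_left)
  also have "(\<Sum>j=1..m. \<rho> j * (zs j - (\<Sum>j=1..m. zs j)))
      = (\<Sum>j=1..m. \<rho> j * zs j) - (\<Sum>j=1..m. \<rho> j) * (\<Sum>j=1..m. zs j)"
    by (simp add: right_diff_distrib sum_subtractf sum_distrib_right)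
  finally show "lead (m - 1) (V_poly m zs \<rho>) 1
       = ((\<Sum>j=1..m. \<rho> j * zs j) - (\<Sum>j=1..m. \<rho> j) * (\<Sum>j=1..m. zs j)) / 2" .
qed

lemma low_expansion_poly: "low_expansion (poly A) (coeff A 0) (coeff A 1)"
proof -
  obtain a B where A: "A = pCons a B" by (rule pCons_cases)
  obtain b C where B: "B = pCons b C" by (rule pCons_cases)
  have "poly A z - (coeff A 0 + coeff A 1 * z) = poly C z * z ^ 2" for z
    by (simp add: A B algebra_simps power2_eq_square)
  moreover have "(\<lambda>z. poly C z * z ^ 2) \<in> O[at 0](\<lambda>z. 1 * z ^ 2)"
    using jet_tendsto[OF jet_poly[of C]]
    by (intro landau_o.big.mult landau_o.big_refl bigoI_tendsto[where c = "coeff C 0"]) auto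
  ultimately show ?thesis
    unfolding low_expansion_def by simp
qed

text \<open>After two terms \<open>A\<close> equals \<open>z\<^sup>N\<^sup>-\<^sup>2\<close> times a polynomial in \<open>1/z\<close>, which stays bounded.\<close>
lemma top_expansion_poly:
  assumes "degree A \<le> N"
  shows "top_expansion (poly A) (int N) (lead N A 0) (lead N A 1)"
proof -
  obtain a B where A: "flip N A = pCons a B" by (rule pCons_cases)
  obtain b C where B: "B = pCons b C" by (rule pCons_cases)
  have nz: "\<forall>\<^sub>F z in at_infinity. z \<noteq> (0::complex)"
    by (rule eventually_not_equal_at_infinity)
  have "\<forall>\<^sub>F z in at_infinity. poly A z - (lead N A 0 * z powi int N
      + lead N A 1 * z powi (int N - 1)) = poly C (inverse z) * z powi (int N - 2)"
    using nz
  proof (rule eventually_mono)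
    fix z :: complex assume z: "z \<noteq> 0"
    have "poly (flip N A) (1 / z) = (1 / z) ^ N * poly A z"
      using poly_flip[OF assms, of "1 / z"] z by simp
    then have "poly A z = z ^ N * poly (flip N A) (1 / z)"
      using z by (simp add: power_divide)
    then show "poly A z - (lead N A 0 * z powi int N
      + lead N A 1 * z powi (int N - 1)) = poly C (inverse z) * z powi (int N - 2)"
      using z by (simp add: A B power_int_diff field_simps power2_eq_square)
  qed
  moreover have "(\<lambda>z. poly C (inverse z) * z powi (int N - 2))
      \<in> O[at_infinity](\<lambda>z. 1 * z powi (int N - 2))"
  proof (intro landau_o.big.mult landau_o.big_refl bigoI_tendsto[where c = "poly C 0"])
    have "((\<lambda>z::complex. poly C (inverse z)) \<longlongrightarrow> poly C 0) at_infinity"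
      by (intro tendsto_intros tendsto_inverse_0)
    then show "((\<lambda>z::complex. poly C (inverse z) / 1) \<longlongrightarrow> poly C 0) at_infinity" by simp
  qed auto
  ultimately show ?thesis
    unfolding top_expansion_def by (subst landau_o.big.in_cong) simp_all
qed


section \<open>The associated functions of a semi-classical weight\<close>

locale semi_classical_pair =
  fixes m :: nat and zs \<rho> :: "nat \<Rightarrow> complex" and w :: "complex \<Rightarrow> complex"
    and \<phi> \<phi>b :: "nat \<Rightarrow> complex poly"
  assumes weight: "semi_classical_weight m zs \<rho> w"
    and biorthonormal_weight: "biorthonormal w \<phi> \<phi>b"
    and W_zero: "poly (W_poly m zs) 0 = 0"
begin

abbreviation W where "W \<equiv> W_poly m zs"
abbreviation V where "V \<equiv> V_poly m zs \<rho>"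
abbreviation L where "L \<equiv> weighted_mean w"

end

sublocale semi_classical_pair \<subseteq> biorthogonal_pair "weighted_mean w" \<phi> \<phi>b
proof -
  interpret circle_functional "weighted_mean w"
    by (rule weighted_mean_functional[OF weight_integrable(1)[OF weight]])
  show "biorthogonal_pair (weighted_mean w) \<phi> \<phi>b"
    using biorthonormal_weight
    unfolding biorthonormal_def by unfold_locales (blast, blast, blast, simp add: weighted_mean_def mult.assoc)
qed

context semi_classical_pair
begin

interpretation R: biorthogonal_pair "reflected L" \<phi>b \<phi> by (rule reflected_pair)

lemma m2: "m \<ge> 2"
  using weight by (simp add: semi_classical_weight_def)

text \<open>The transform with the kernel of \<open>F\<close>, \<open>\<psi>\<^sub>n\<close> and \<open>\<psi>\<^sub>n\<^sup>*\<close>; in particular \<open>F\<close> is the transform of \<open>1\<close>.\<close>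
definition herglotz :: "(complex \<Rightarrow> complex) \<Rightarrow> complex \<Rightarrow> complex" where
  "herglotz g z = L (\<lambda>\<zeta>. (\<zeta> + z) / (\<zeta> - z) * g \<zeta>)"

lemma herglotz_continuous:
  "continuous_on circle g \<Longrightarrow> norm z \<noteq> 1 \<Longrightarrow> continuous_on circle (\<lambda>\<zeta>. (\<zeta> + z) / (\<zeta> - z) * g \<zeta>)"
  by (intro continuous_intros) auto

lemma herglotz_eq:
  assumes g: "continuous_on circle g" and z: "norm z \<noteq> 1"
  shows "herglotz g z = 2 * cauchy L (\<lambda>\<zeta>. \<zeta> * g \<zeta>) z - L g"
proof -
  have g': "continuous_on circle (\<lambda>\<zeta>. \<zeta> * g \<zeta>)" by (intro continuous_intros g)
  have "herglotz g z = L (\<lambda>\<zeta>. 2 * (\<zeta> * g \<zeta> / (\<zeta> - z)) - g \<zeta>)"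
    unfolding herglotz_def
  proof (rule L_cong[OF herglotz_continuous[OF g z]])
    fix \<zeta> :: complex assume "norm \<zeta> = 1"
    then have "\<zeta> - z \<noteq> 0" using z by auto
    then have "(\<zeta> + z) / (\<zeta> - z) = 2 * \<zeta> / (\<zeta> - z) - 1" by (simp add: field_simps)
    then show "(\<zeta> + z) / (\<zeta> - z) * g \<zeta> = 2 * (\<zeta> * g \<zeta> / (\<zeta> - z)) - g \<zeta>"
      by (simp add: left_diff_distrib)
  qed
  also have "\<dots> = L (\<lambda>\<zeta>. 2 * (\<zeta> * g \<zeta> / (\<zeta> - z))) - L g"
    by (intro diff continuous_on_mult continuous_on_const continuous_on_circle_kernel g' g z)
  also have "L (\<lambda>\<zeta>. 2 * (\<zeta> * g \<zeta> / (\<zeta> - z))) = 2 * cauchy L (\<lambda>\<zeta>. \<zeta> * g \<zeta>) z"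
    unfolding cauchy_def by (rule scale[OF continuous_on_circle_kernel[OF g' z]])
  finally show ?thesis .
qed

lemma herglotz_sub_const:
  assumes g: "continuous_on circle g" and z: "norm z \<noteq> 1"
  shows "L (\<lambda>\<zeta>. (\<zeta> + z) / (\<zeta> - z) * (g \<zeta> - c)) = herglotz g z - c * herglotz (\<lambda>_. 1) z"
proof -
  have "L (\<lambda>\<zeta>. (\<zeta> + z) / (\<zeta> - z) * (g \<zeta> - c))
      = L (\<lambda>\<zeta>. (\<zeta> + z) / (\<zeta> - z) * g \<zeta> - c * ((\<zeta> + z) / (\<zeta> - z) * 1))"
    by (simp add: right_diff_distrib diff_divide_distrib mult.commute)
  also have "\<dots> = herglotz g z - L (\<lambda>\<zeta>. c * ((\<zeta> + z) / (\<zeta> - z) * 1))"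
    unfolding herglotz_def by (intro diff herglotz_continuous g z continuous_on_mult continuous_on_const)
  also have "L (\<lambda>\<zeta>. c * ((\<zeta> + z) / (\<zeta> - z) * 1)) = c * herglotz (\<lambda>_. 1) z"
    unfolding herglotz_def by (intro scale herglotz_continuous z continuous_on_const)
  finally show ?thesis .
qed

lemma F_eq_herglotz: "F_fun w z = herglotz (\<lambda>_. 1) z"
  by (simp add: F_fun_def herglotz_def weighted_mean_def mult.commute)

lemma F_eq:
  assumes "norm z \<noteq> 1"
  shows "F_fun w z = 2 * cauchy L (\<lambda>\<zeta>. \<zeta>) z - L (\<lambda>_. 1)"
  using herglotz_eq[OF continuous_on_const assms, of 1] by (simp add: F_eq_herglotz)

lemma F_eq':
  assumes "norm z \<noteq> 1"
  shows "F_fun w z = 2 * z * cauchy L (\<lambda>_. 1) z + L (\<lambda>_. 1)"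
  using F_eq[OF assms] cauchy_mult_var[OF continuous_on_const assms, of 1] by simp

lemma constant_polys: "poly (\<phi> 0) z = \<kappa> 0" "poly (\<phi>b 0) z = \<kappa> 0"
proof -
  show "poly (\<phi> 0) z = \<kappa> 0"
    using degree_p[of 0] by (auto elim!: degree_eq_zeroE)
  show "poly (\<phi>b 0) z = \<kappa> 0"
    unfolding lead_coeff_eq using degree_q[of 0] by (auto elim!: degree_eq_zeroE)
qed

text \<open>Normalisation at index \<open>0\<close>, which makes the convention \<open>\<psi>\<^sub>0 = 1/\<kappa>\<^sub>0\<close> fit the general formulas.\<close>
lemma moment_zero: "\<kappa> 0 * L (\<lambda>_. 1) = 1 / \<kappa> 0"
  using orthogonal_top[of 0] scale[OF continuous_on_const[of circle 1], of "\<kappa> 0"]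
  by (simp add: constant_polys)

lemma eps_eq_second:
  assumes z: "norm z \<noteq> 1"
  shows "eps w \<phi> n z = second_solution n z"
proof (cases "n = 0")
  case True
  have "second_solution 0 z = 2 * cauchy L (\<lambda>\<zeta>. \<kappa> 0 * \<zeta>) z"
    by (simp add: second_solution_def constant_polys mult.commute)
  also have "\<dots> = \<kappa> 0 * (2 * cauchy L (\<lambda>\<zeta>. \<zeta>) z)"
    using cauchy_scale[OF continuous_on_id z, of "\<kappa> 0"] by simp
  also have "2 * cauchy L (\<lambda>\<zeta>. \<zeta>) z = F_fun w z + L (\<lambda>_. 1)"
    by (simp add: F_eq[OF z])
  finally show ?thesis
    using moment_zero True by (simp add: eps_def psi_def constant_polys algebra_simps)
next
  case False
  have "psi w \<phi> n z = L (\<lambda>\<zeta>. (\<zeta> + z) / (\<zeta> - z) * (poly (\<phi> n) \<zeta> - poly (\<phi> n) z))"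
    using False by (simp add: psi_def weighted_mean_def mult_ac)
  also have "\<dots> = herglotz (poly (\<phi> n)) z - poly (\<phi> n) z * F_fun w z"
    unfolding F_eq_herglotz by (rule herglotz_sub_const[OF continuous_on_circle_poly z])
  also have "herglotz (poly (\<phi> n)) z = second_solution n z"
    unfolding herglotz_eq[OF continuous_on_circle_poly z] second_solution_def
    using orthogonal_lower[of 0 n] False by simp
  finally show ?thesis by (simp add: eps_def)
qed

lemma eps_star_eq:
  assumes z: "norm z \<noteq> 1"
  shows "eps_star w \<phi>b n z = - 2 * z ^ Suc n * cauchy L (\<lambda>\<zeta>. poly (\<phi>b n) (1 / \<zeta>)) z"
proof (cases "n = 0")
  case True
  have "cauchy L (\<lambda>\<zeta>. poly (\<phi>b 0) (1 / \<zeta>)) z = \<kappa> 0 * cauchy L (\<lambda>_. 1) z"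
    using cauchy_scale[OF continuous_on_const z, of "\<kappa> 0" 1] by (simp add: constant_polys)
  moreover have "poly (recip \<phi>b 0) z = \<kappa> 0"
    using poly_reflect_poly_0 degree_q[of 0] lead_coeff_eq[of 0] constant_polys(2)
    by (auto simp: recip_def elim!: degree_eq_zeroE)
  ultimately show ?thesis
    using True moment_zero lead_coeff_eq[of 0]
    by (simp add: eps_star_def psi_star_def F_eq'[OF z] algebra_simps)
next
  case False
  note c = continuous_on_circle_poly_reflect[of "\<phi>b n"]
  have "psi_star w \<phi>b n z
      = - L (\<lambda>\<zeta>. (\<zeta> + z) / (\<zeta> - z) * (z ^ n * poly (\<phi>b n) (1 / \<zeta>) - poly (recip \<phi>b n) z))"
    using False by (simp add: psi_star_def weighted_mean_def mult_ac)
  also have "\<dots> = - (herglotz (\<lambda>\<zeta>. z ^ n * poly (\<phi>b n) (1 / \<zeta>)) z - poly (recip \<phi>b n) z * F_fun w z)"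
    unfolding F_eq_herglotz by (subst herglotz_sub_const) (intro continuous_intros c z refl)+
  also have "herglotz (\<lambda>\<zeta>. z ^ n * poly (\<phi>b n) (1 / \<zeta>)) z = z ^ n * herglotz (\<lambda>\<zeta>. poly (\<phi>b n) (1 / \<zeta>)) z"
    using scale[OF herglotz_continuous[OF c z], of "z ^ n"] by (simp add: herglotz_def mult.left_commute)
  also have "herglotz (\<lambda>\<zeta>. poly (\<phi>b n) (1 / \<zeta>)) z = 2 * (z * cauchy L (\<lambda>\<zeta>. poly (\<phi>b n) (1 / \<zeta>)) z)"
    unfolding herglotz_eq[OF c z] cauchy_mult_var[OF c z]
    using reflected_orthogonal(1)[of 0 n] False by simp
  finally show ?thesis by (simp add: eps_star_def algebra_simps)
qed

text \<open>Reversal: \<open>\<epsilon>\<^sub>n\<^sup>*\<close> is to the second solution of the reflected pair what \<open>\<phi>\<^sub>n\<^sup>*\<close> is to the barred polynomial.\<close>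
lemma eps_star_eq_second:
  assumes z: "norm z \<noteq> 1" "z \<noteq> 0"
  shows "eps_star w \<phi>b n z = z ^ n * R.second_solution n (1 / z)"
proof -
  have "eps_star w \<phi>b n z = - 2 * z ^ n * (z * cauchy L (\<lambda>\<zeta>. poly (\<phi>b n) (1 / \<zeta>)) z)"
    by (simp add: eps_star_eq[OF z(1)])
  also have "z * cauchy L (\<lambda>\<zeta>. poly (\<phi>b n) (1 / \<zeta>)) z
      = - cauchy (reflected L) (\<lambda>\<zeta>. \<zeta> * poly (\<phi>b n) (1 / (1 / \<zeta>))) (1 / z)"
    by (rule cauchy_reflected[OF continuous_on_circle_poly_reflect z])
  finally show ?thesis by (simp add: R.second_solution_def)
qed

lemma F_holomorphic: "F_fun w holomorphic_on - circle"
proof -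
  have "(\<lambda>z. 2 * cauchy L (\<lambda>\<zeta>. \<zeta>) z - L (\<lambda>_. 1)) holomorphic_on - circle"
    by (intro holomorphic_intros cauchy_holomorphic continuous_on_id)
  then show ?thesis
    by (rule holomorphic_transform) (simp add: F_eq)
qed

lemma F_ode: "\<exists>U. \<forall>z. norm z \<noteq> 1 \<longrightarrow> poly W z * deriv (F_fun w) z = 2 * poly V z * F_fun w z + poly U z"
proof -
  obtain U where U: "\<And>z. norm z \<noteq> 1 \<Longrightarrow>
      poly W z * deriv (cauchy L (\<lambda>\<zeta>. \<zeta>)) z = 2 * poly V z * cauchy L (\<lambda>\<zeta>. \<zeta>) z + poly U z"
    using cauchy_first_order_ode[OF weighted_integration_by_parts[OF weight]] by blast
  have "poly W z * deriv (F_fun w) z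
      = 2 * poly V z * F_fun w z + poly (smult 2 U + smult (2 * L (\<lambda>_. 1)) V) z"
    if z: "norm z \<noteq> 1" for z
  proof -
    have "(cauchy L (\<lambda>\<zeta>. \<zeta>) has_field_derivative deriv (cauchy L (\<lambda>\<zeta>. \<zeta>)) z) (at z)"
      by (rule holomorphic_derivI[OF cauchy_holomorphic[OF continuous_on_id]])
         (use z in \<open>auto intro: open_Compl\<close>)
    then have "((\<lambda>z. 2 * cauchy L (\<lambda>\<zeta>. \<zeta>) z - L (\<lambda>_. 1)) has_field_derivative
        2 * deriv (cauchy L (\<lambda>\<zeta>. \<zeta>)) z) (at z)"
      by (auto intro!: derivative_eq_intros)
    then have "(F_fun w has_field_derivative 2 * deriv (cauchy L (\<lambda>\<zeta>. \<zeta>)) z) (at z)"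
      by (rule has_field_derivative_transform_within_open[of _ _ _ "- circle"])
         (use z F_eq in \<open>auto intro: open_Compl\<close>)
    then have "deriv (F_fun w) z = 2 * deriv (cauchy L (\<lambda>\<zeta>. \<zeta>)) z"
      by (rule DERIV_imp_deriv)
    then have "poly W z * deriv (F_fun w) z = 2 * (poly W z * deriv (cauchy L (\<lambda>\<zeta>. \<zeta>)) z)"
      by simp
    then show ?thesis
      unfolding U[OF z] F_eq[OF z] by (simp add: algebra_simps)
  qed
  then show ?thesis by blast
qed

lemma eps_polynomial_part:
  "\<exists>\<psi>. \<forall>z. norm z \<noteq> 1 \<longrightarrow> eps w \<phi> n z = poly \<psi> z + F_fun w z * poly (\<phi> n) z"
proof -
  obtain U where U: "\<And>z. norm z \<noteq> 1 \<Longrightarrow>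
      cauchy L (\<lambda>\<zeta>. poly (\<phi> n) \<zeta> * \<zeta>) z = poly (\<phi> n) z * cauchy L (\<lambda>\<zeta>. \<zeta>) z + poly U z"
    using cauchy_mult_poly[OF continuous_on_id] by blast
  have "eps w \<phi> n z = poly (smult 2 U + smult (L (\<lambda>_. 1)) (\<phi> n)) z + F_fun w z * poly (\<phi> n) z"
    if z: "norm z \<noteq> 1" for z
  proof -
    have "second_solution n z = 2 * (poly (\<phi> n) z * cauchy L (\<lambda>\<zeta>. \<zeta>) z + poly U z)"
      unfolding second_solution_def U[OF z, symmetric] by (simp only: mult.commute)
    then show ?thesis
      unfolding eps_eq_second[OF z] F_eq[OF z] by (simp add: algebra_simps)
  qed
  then show ?thesis by blast
qed

text \<open>On the circle the barred polynomial at \<open>1/\<zeta>\<close> is \<open>\<phi>\<^sub>n\<^sup>*(\<zeta>) / \<zeta>\<^sup>n\<close>. Both the division by \<open>\<zeta>\<^sup>n\<close>, compensated by \<open>z\<^sup>n\<close>, and the factor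
\<open>\<phi>\<^sub>n\<^sup>*(\<zeta>)\<close> pass through the Cauchy transform up to polynomials.\<close>
lemma eps_star_polynomial_part:
  "\<exists>\<psi>. \<forall>z. norm z \<noteq> 1 \<longrightarrow> eps_star w \<phi>b n z = poly \<psi> z + (- F_fun w z) * poly (recip \<phi>b n) z"
proof -
  define g where "g = poly (recip \<phi>b n)"
  have g: "continuous_on circle g" unfolding g_def by (rule continuous_on_circle_poly)
  obtain U where U: "\<And>z. norm z \<noteq> 1 \<Longrightarrow>
      z ^ n * cauchy L (\<lambda>\<zeta>. g \<zeta> / \<zeta> ^ n) z = cauchy L g z + poly U z"
    using cauchy_polynomial_tail[OF g] by blast
  obtain U2 where U2: "\<And>z. norm z \<noteq> 1 \<Longrightarrow>
      cauchy L (\<lambda>\<zeta>. poly (recip \<phi>b n) \<zeta> * 1) z = poly (recip \<phi>b n) z * cauchy L (\<lambda>_. 1) z + poly U2 z"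
    using cauchy_mult_poly[OF continuous_on_const[of circle "1::complex"]] by blast
  have "eps_star w \<phi>b n z
      = poly (smult (L (\<lambda>_. 1)) (recip \<phi>b n) - smult 2 (pCons 0 (U + U2))) z
        + (- F_fun w z) * poly (recip \<phi>b n) z"
    if z: "norm z \<noteq> 1" for z
  proof -
    have "cauchy L (\<lambda>\<zeta>. poly (\<phi>b n) (1 / \<zeta>)) z = cauchy L (\<lambda>\<zeta>. g \<zeta> / \<zeta> ^ n) z"
      unfolding cauchy_def
    proof (rule L_cong[OF continuous_on_circle_kernel[OF continuous_on_circle_poly_reflect z]])
      fix \<zeta> :: complex assume "norm \<zeta> = 1"
      then have "\<zeta> \<noteq> 0" by auto
      then show "poly (\<phi>b n) (1 / \<zeta>) / (\<zeta> - z) = g \<zeta> / \<zeta> ^ n / (\<zeta> - z)"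
        by (simp add: g_def recip_def poly_reflect_q)
    qed
    then have "eps_star w \<phi>b n z = - 2 * z * (z ^ n * cauchy L (\<lambda>\<zeta>. g \<zeta> / \<zeta> ^ n) z)"
      by (simp add: eps_star_eq[OF z])
    also have "\<dots> = - 2 * z * (poly (recip \<phi>b n) z * cauchy L (\<lambda>_. 1) z + poly U2 z + poly U z)"
      unfolding U[OF z] using U2[OF z] by (simp add: g_def)
    finally show ?thesis
      by (simp add: F_eq'[OF z] algebra_simps)
  qed
  then show ?thesis by blast
qed

end

section \<open>The two systems of derivative relations\<close>

context semi_classical_pair
begin

interpretation R: biorthogonal_pair "reflected L" \<phi>b \<phi> by (rule reflected_pair)

abbreviation x where "x k \<equiv> coeff (\<phi> k) 0"
abbreviation y where "y k \<equiv> coeff (\<phi>b k) 0"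
abbreviation lx where "lx \<equiv> sub_coeff \<phi>"
abbreviation ly where "ly \<equiv> sub_coeff \<phi>b"

lemma W_coeff_2: "coeff W 2 = poly (pderiv (pderiv W)) 0 / 2"
  by (simp add: poly_0_coeff_0 coeff_pderiv numeral_2_eq_2)

lemma coeff_1_pderiv: "coeff A 1 = poly (pderiv A) 0"
  by (simp add: poly_0_coeff_0 coeff_pderiv)

text \<open>\<open>derivative_pair\<close> with \<open>d = n\<close> and \<open>k = 1\<close>: the orders of \<open>\<epsilon>\<^sub>n\<close> that orthogonality provides at \<open>0\<close> and at infinity.\<close>
lemma unstarred_coefficients:
  fixes n :: nat and r S R V0 V1 W1 W2 :: complex
  assumes nz: "x (Suc n) \<noteq> 0"
    and r: "r = (\<Sum>j=1..m. \<rho> j)" and S: "S = (\<Sum>j=1..m. zs j)" and R: "R = (\<Sum>j=1..m. \<rho> j * zs j)"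
    and V01: "V0 = coeff V 0" "V1 = coeff V 1" and W12: "W1 = coeff W 1" "W2 / 2 = coeff W 2"
  obtains P Q where "degree P \<le> m - 2" "degree Q \<le> m - 1"
    "\<And>z. poly W z * poly (pderiv (\<phi> n)) z
        = poly P z * poly (\<phi> (Suc n)) z - (poly Q z + poly V z) * poly (\<phi> n) z"
    "\<And>z. norm z \<noteq> 1 \<Longrightarrow> poly W z * deriv (eps w \<phi> n) z
        = poly P z * eps w \<phi> (Suc n) z - (poly Q z - poly V z) * eps w \<phi> n z"
    "\<And>z \<theta> \<omega>. norm z \<noteq> 1 \<Longrightarrow> z \<noteq> 0 \<Longrightarrow>
        poly W z * poly (pderiv (\<phi> n)) z = \<theta> * poly (\<phi> (Suc n)) z - (\<omega> + poly V z) * poly (\<phi> n) z \<Longrightarrow>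
        poly W z * deriv (eps w \<phi> n) z = \<theta> * eps w \<phi> (Suc n) z - (\<omega> - poly V z) * eps w \<phi> n z \<Longrightarrow>
        \<theta> = poly P z \<and> \<omega> = poly Q z"
    "lead (m - 2) P 0 = (of_nat n + 1 + r) * (\<kappa> n / \<kappa> (Suc n))"
    "lead (m - 2) P 1 = - ((of_nat n + 1 + r) * S - R) * (\<kappa> n / \<kappa> (Suc n))
        + (of_nat n + 2 + r) * (\<kappa> n ^ 3 / (\<kappa> (Suc n) ^ 2 * \<kappa> (Suc (Suc n))))
            * (x (Suc (Suc n)) / x (Suc n))
        - (of_nat n + r) * (x (Suc n) * y n / \<kappa> (Suc n) ^ 2)
        - 2 * (\<kappa> n * lx (Suc n) / \<kappa> (Suc n) ^ 2)"
    "coeff P 0 = (2 * V0 - of_nat n * W1) * (x n / x (Suc n))"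
    "n \<ge> 1 \<Longrightarrow> coeff P 1 = (2 * V1 - 1/2 * of_nat n * W2) * (x n / x (Suc n))
        + (2 * V0 - (of_nat n - 1) * W1) * (\<kappa> n * x (n - 1) / (\<kappa> (n - 1) * x (Suc n)))
        + (((of_nat n + 1) * W1 - 2 * V0) * (ly (Suc n) / \<kappa> (Suc n))
           - ((of_nat n - 1) * W1 - 2 * V0) * (ly (n - 1) / \<kappa> (n - 1)))
            * (x n / x (Suc n))"
    "lead (m - 1) Q 0 = 1 + r / 2"
    "lead (m - 1) Q 1 = - 1/2 * r * S + 1/2 * R - S
        + (of_nat n + 2 + r) * (\<kappa> n ^ 2 / (\<kappa> (Suc (Suc n)) * \<kappa> (Suc n)))
            * (x (Suc (Suc n)) / x (Suc n))
        - lx (Suc n) / \<kappa> (Suc n)"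
    "coeff Q 0 = V0 - of_nat n * W1"
    "coeff Q 1 = V1 - 1/2 * of_nat n * W2
        + (V0 * (\<kappa> n / \<kappa> (Suc n)) + (V0 - of_nat n * W1) * (\<kappa> (Suc n) / \<kappa> n))
            * (x n / x (Suc n))
        + (V0 - of_nat n * W1) * (ly n / \<kappa> n)
        - (V0 - (of_nat n + 1) * W1) * (ly (Suc n) / \<kappa> (Suc n))"
proof -
  obtain U where U: "\<And>z. norm z \<noteq> 1 \<Longrightarrow>
      poly W z * deriv (F_fun w) z = 2 * poly V z * F_fun w z + poly U z"
    using F_ode by blast
  obtain \<psi> \<psi>2 where \<psi>: "\<And>z. norm z \<noteq> 1 \<Longrightarrow> eps w \<phi> n z = poly \<psi> z + F_fun w z * poly (\<phi> n) z"
    "\<And>z. norm z \<noteq> 1 \<Longrightarrow> eps w \<phi> (Suc n) z = poly \<psi>2 z + F_fun w z * poly (\<phi> (Suc n)) z"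
    using eps_polynomial_part by metis
  obtain E where E: "E holomorphic_on - circle" "\<And>z. norm z \<noteq> 1 \<Longrightarrow> second_solution n z = z ^ n * E z"
    "E 0 = 2 / \<kappa> n" "deriv E 0 = - 2 * ly (Suc n) / (\<kappa> n * \<kappa> (Suc n))"
    using second_solution_at_zero by blast
  obtain E2 where E2: "E2 holomorphic_on - circle"
    "\<And>z. norm z \<noteq> 1 \<Longrightarrow> second_solution (Suc n) z = z ^ Suc n * E2 z" "E2 0 = 2 / \<kappa> (Suc n)"
    using second_solution_at_zero[of "Suc n"] by blast
  obtain T where T: "T holomorphic_on - circle"
    "\<And>z. norm z \<noteq> 1 \<Longrightarrow> z \<noteq> 0 \<Longrightarrow> z * second_solution n z = T (1 / z)"
    "T 0 = 2 * x (Suc n) / (\<kappa> n * \<kappa> (Suc n))"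
    "deriv T 0 = - 2 * (x (Suc n) * lx (Suc n) / (\<kappa> n * \<kappa> (Suc n))
        - \<kappa> n * x (Suc (Suc n)) / (\<kappa> (Suc n) * \<kappa> (Suc (Suc n)))) / \<kappa> (Suc n)"
    using second_solution_at_infinity by blast
  obtain T2 where T2: "T2 holomorphic_on - circle"
    "\<And>z. norm z \<noteq> 1 \<Longrightarrow> z \<noteq> 0 \<Longrightarrow> z * second_solution (Suc n) z = T2 (1 / z)"
    "T2 0 = 2 * x (Suc (Suc n)) / (\<kappa> (Suc n) * \<kappa> (Suc (Suc n)))"
    using second_solution_at_infinity[of "Suc n"] by blast
  have m1: "m \<ge> 1" using m2 by simp
  have top: "coeff (\<phi> k) k = \<kappa> k" for k by (simp add: degree_p)
  interpret D: derivative_pair W V U "\<phi> n" "\<phi> (Suc n)" \<psi> \<psi>2 "F_fun w"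
    "eps w \<phi> n" "eps w \<phi> (Suc n)" E E2 T T2 m n n 1
  proof
    show "coeff (\<phi> (Suc n)) (Suc n) * T 0 \<noteq> 0"
      using nz \<kappa>_nonzero unfolding top T(3) by simp
    show "eps w \<phi> n z = z ^ n * E z" "eps w \<phi> (Suc n) z = z ^ Suc n * E2 z" if "norm z \<noteq> 1" for z
      unfolding eps_eq_second[OF that] by (rule E(2)[OF that] E2(2)[OF that])+
    show "z ^ 1 * eps w \<phi> n z = T (1 / z)" "z ^ 1 * eps w \<phi> (Suc n) z = T2 (1 / z)"
      if "norm z \<noteq> 1" "z \<noteq> 0" for z
      unfolding eps_eq_second[OF that(1)] power_one_right by (rule T(2)[OF that] T2(2)[OF that])+
    show "n + 1 = Suc n" by simp
  qed (rule m2 W_poly_coeffs(1,2)[OF m1] W_zero V_poly_coeffs(1)[OF m2] eq_refl[OF degree_p]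
        F_holomorphic U \<psi> E(1) E2(1) T(1) T2(1); assumption?)+
  obtain P Q where PQ: "degree P \<le> m - 2" "degree Q \<le> m - 1"
    "W * pderiv (\<phi> n) + V * \<phi> n = P * \<phi> (Suc n) - Q * \<phi> n"
    "W * pderiv \<psi> + U * \<phi> n - V * \<psi> = P * \<psi>2 - Q * \<psi>"
    using D.coefficients_exist by blast
  have f0: "lead k (\<phi> k) 0 = \<kappa> k" and f1: "lead k (\<phi> k) 1 = lx k" for k
    by (auto simp: coeff_flip sub_coeff_def top simp del: One_nat_def)
  have Sf: "lead m W 1 = - S"
    and v0: "lead (m - 1) V 0 = r / 2" and v1: "lead (m - 1) V 1 = (R - r * S) / 2"
    using W_poly_coeffs[OF m1] V_poly_coeffs[OF m2] by (simp_all add: r S R)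
  note inf_p = D.infinity_coefficients_p[OF PQ, unfolded f0 f1 Sf v0 v1]
  note inf_e = D.infinity_coefficients_e[OF PQ, unfolded Sf v0 v1]
  note zero_p = D.zero_coefficients_p[OF PQ, folded V01 W12]
  note zero_e = D.zero_coefficients_e[OF PQ, folded V01 W12]
  have \<kappa>: "\<kappa> n \<noteq> 0" "\<kappa> (Suc n) \<noteq> 0" "\<kappa> (Suc (Suc n)) \<noteq> 0" by (rule \<kappa>_nonzero)+
  have top_eqs:
    "- T 0 - r / 2 * T 0 = - lead (m - 1) Q 0 * T 0"
    "S * T 0 - 2 * deriv T 0 - r / 2 * deriv T 0 - (R - r * S) / 2 * T 0
       = lead (m - 2) P 0 * T2 0 - lead (m - 1) Q 0 * deriv T 0 - lead (m - 1) Q 1 * T 0"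
    "of_nat n * \<kappa> n + r / 2 * \<kappa> n
       = lead (m - 2) P 0 * \<kappa> (Suc n) - lead (m - 1) Q 0 * \<kappa> n"
    "(of_nat n - 1) * lx n - S * of_nat n * \<kappa> n + r / 2 * lx n + (R - r * S) / 2 * \<kappa> n
       = lead (m - 2) P 0 * lx (Suc n) + lead (m - 2) P 1 * \<kappa> (Suc n)
         - lead (m - 1) Q 0 * lx n - lead (m - 1) Q 1 * \<kappa> n"
    using inf_p inf_e by simp_all
  note tops = top_coefficients[OF \<kappa> nz coeff_recurrence(2) T(3,4) T2(3) top_eqs]
  have low_eqs:
    "W1 * of_nat n * E 0 - V0 * E 0 = - coeff Q 0 * E 0"
    "W2 / 2 * of_nat n * E 0 + W1 * (of_nat n + 1) * deriv E 0 - V0 * deriv E 0 - V1 * E 0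
       = coeff P 0 * E2 0 - coeff Q 0 * deriv E 0 - coeff Q 1 * E 0"
    "V0 * x n = coeff P 0 * x (Suc n) - coeff Q 0 * x n"
    "W1 * coeff (\<phi> n) 1 + V0 * coeff (\<phi> n) 1 + V1 * x n
       = coeff P 0 * coeff (\<phi> (Suc n)) 1 + coeff P 1 * x (Suc n)
         - coeff Q 0 * coeff (\<phi> n) 1 - coeff Q 1 * x n"
    using zero_p zero_e by simp_all
  have rec: "\<kappa> n * ly (Suc n) = \<kappa> (Suc n) * ly n + y (Suc n) * x n"
    using R.coeff_recurrence(2)[of n] unfolding lead_coeff_eq[symmetric] .
  note lows = low_coefficients[OF \<kappa>(1,2) nz rec \<kappa>_square coeff_recurrence(1) E(3,4) E2(3) low_eqs]
  have d0: "\<kappa> (n - 1) * coeff (\<phi> n) 1 = \<kappa> n * x (n - 1) + x n * ly (n - 1)" if "n \<ge> 1"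
    using coeff_recurrence(1)[of "n - 1"] that by simp
  note low_P1 = lows(4)[OF \<kappa>_nonzero d0]
  have unique: "\<theta> = poly P z \<and> \<omega> = poly Q z"
    if "norm z \<noteq> 1" "z \<noteq> 0"
      "poly W z * poly (pderiv (\<phi> n)) z = \<theta> * poly (\<phi> (Suc n)) z - (\<omega> + poly V z) * poly (\<phi> n) z"
      "poly W z * deriv (eps w \<phi> n) z = \<theta> * eps w \<phi> (Suc n) z - (\<omega> - poly V z) * eps w \<phi> n z" for z \<theta> \<omega>
    by (rule D.coefficients_unique[OF that D.first_relation[OF PQ] D.second_relation[OF PQ that(1)]])
  show thesis
    by (rule that[OF PQ(1,2) D.first_relation[OF PQ] D.second_relation[OF PQ] unique
          tops(2,4) lows(2) low_P1 tops(1,3) lows(1,3)])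
qed

text \<open>\<open>derivative_pair\<close> with \<open>d = n + 1\<close> and \<open>k = 0\<close>. The local factors at \<open>0\<close> and at infinity are those of the reflected pair,
interchanged. The coefficients of the relations are the negatives of those that the locale provides.\<close>
lemma starred_coefficients:
  fixes n :: nat and r S R V0 V1 W1 W2 :: complex
  assumes nz: "y (Suc n) \<noteq> 0"
    and r: "r = (\<Sum>j=1..m. \<rho> j)" and S: "S = (\<Sum>j=1..m. zs j)" and R: "R = (\<Sum>j=1..m. \<rho> j * zs j)"
    and V01: "V0 = coeff V 0" "V1 = coeff V 1" and W12: "W1 = coeff W 1" "W2 / 2 = coeff W 2"
  obtains P Q where "degree P \<le> m - 2" "degree Q \<le> m - 1"
    "\<And>z. poly W z * poly (pderiv (recip \<phi>b n)) z
        = - poly P z * poly (recip \<phi>b (Suc n)) z + (poly Q z - poly V z) * poly (recip \<phi>b n) z"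
    "\<And>z. norm z \<noteq> 1 \<Longrightarrow> poly W z * deriv (eps_star w \<phi>b n) z
        = - poly P z * eps_star w \<phi>b (Suc n) z + (poly Q z + poly V z) * eps_star w \<phi>b n z"
    "\<And>z \<theta> \<omega>. norm z \<noteq> 1 \<Longrightarrow> z \<noteq> 0 \<Longrightarrow>
        poly W z * poly (pderiv (recip \<phi>b n)) z
          = - \<theta> * poly (recip \<phi>b (Suc n)) z + (\<omega> - poly V z) * poly (recip \<phi>b n) z \<Longrightarrow>
        poly W z * deriv (eps_star w \<phi>b n) z
          = - \<theta> * eps_star w \<phi>b (Suc n) z + (\<omega> + poly V z) * eps_star w \<phi>b n z \<Longrightarrow>
        \<theta> = poly P z \<and> \<omega> = poly Q z"
    "lead (m - 2) P 0 = - (of_nat n + r) * (y n / y (Suc n))"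
    "n \<ge> 1 \<Longrightarrow> lead (m - 2) P 1
      = ((of_nat n + r) * S - R) * (y n / y (Suc n))
        + (of_nat n + 1 + r) * (y n / y (Suc n)) * (lx (Suc n) / \<kappa> (Suc n))
        - (of_nat n - 1 + r) * ((\<kappa> n * y (n - 1) + y n * lx (n - 1))
            / (\<kappa> (n - 1) * y (Suc n)))"
    "coeff P 0 = - (2 * V0 - (of_nat n + 1) * W1) * (\<kappa> n / \<kappa> (Suc n))"
    "coeff P 1 = - (2 * V1 - 1/2 * (of_nat n + 1) * W2) * (\<kappa> n / \<kappa> (Suc n))
        - (2 * V0 - of_nat n * W1) * (ly n / \<kappa> (Suc n))
        + ((of_nat n + 2) * W1 - 2 * V0)
          * (\<kappa> n ^ 3 / (\<kappa> (Suc (Suc n)) * \<kappa> (Suc n) ^ 2)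
               * (y (Suc (Suc n)) / y (Suc n))
             - \<kappa> n / \<kappa> (Suc n) * (ly (Suc n) / \<kappa> (Suc n)))"
    "lead (m - 1) Q 0 = - r / 2"
    "lead (m - 1) Q 1 = 1/2 * r * S - 1/2 * R
        - (of_nat n + r) * (\<kappa> n / \<kappa> (Suc n)) * (y n / y (Suc n))
        + lx (Suc n) / \<kappa> (Suc n)"
    "coeff Q 0 = (of_nat n + 1) * W1 - V0"
    "coeff Q 1 = 1/2 * (of_nat n + 1) * W2 - V1
        + ((of_nat n + 2) * W1 - 2 * V0) * (\<kappa> n ^ 2 / (\<kappa> (Suc (Suc n)) * \<kappa> (Suc n)))
            * (y (Suc (Suc n)) / y (Suc n))
        - W1 * (ly (Suc n) / \<kappa> (Suc n))"
proof -
  obtain U where U: "\<And>z. norm z \<noteq> 1 \<Longrightarrow>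
      poly W z * deriv (F_fun w) z = 2 * poly V z * F_fun w z + poly U z"
    using F_ode by blast
  obtain \<psi> \<psi>2 where \<psi>:
    "\<And>z. norm z \<noteq> 1 \<Longrightarrow> eps_star w \<phi>b n z = poly \<psi> z + (- F_fun w z) * poly (recip \<phi>b n) z"
    "\<And>z. norm z \<noteq> 1 \<Longrightarrow> eps_star w \<phi>b (Suc n) z = poly \<psi>2 z + (- F_fun w z) * poly (recip \<phi>b (Suc n)) z"
    using eps_star_polynomial_part by metis
  obtain T where T: "T holomorphic_on - circle" "\<And>z. norm z \<noteq> 1 \<Longrightarrow> R.second_solution n z = z ^ n * T z"
    "T 0 = 2 / \<kappa> n" "deriv T 0 = - 2 * lx (Suc n) / (\<kappa> n * \<kappa> (Suc n))"
    using R.second_solution_at_zero unfolding lead_coeff_eq[symmetric] by blast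
  obtain T2 where T2: "T2 holomorphic_on - circle"
    "\<And>z. norm z \<noteq> 1 \<Longrightarrow> R.second_solution (Suc n) z = z ^ Suc n * T2 z" "T2 0 = 2 / \<kappa> (Suc n)"
    using R.second_solution_at_zero[of "Suc n"] unfolding lead_coeff_eq[symmetric] by blast
  obtain E where E: "E holomorphic_on - circle"
    "\<And>z. norm z \<noteq> 1 \<Longrightarrow> z \<noteq> 0 \<Longrightarrow> z * R.second_solution n z = E (1 / z)"
    "E 0 = 2 * y (Suc n) / (\<kappa> n * \<kappa> (Suc n))"
    "deriv E 0 = - 2 * (y (Suc n) * ly (Suc n) / (\<kappa> n * \<kappa> (Suc n))
        - \<kappa> n * y (Suc (Suc n)) / (\<kappa> (Suc n) * \<kappa> (Suc (Suc n)))) / \<kappa> (Suc n)"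
    using R.second_solution_at_infinity unfolding lead_coeff_eq[symmetric] by blast
  obtain E2 where E2: "E2 holomorphic_on - circle"
    "\<And>z. norm z \<noteq> 1 \<Longrightarrow> z \<noteq> 0 \<Longrightarrow> z * R.second_solution (Suc n) z = E2 (1 / z)"
    "E2 0 = 2 * y (Suc (Suc n)) / (\<kappa> (Suc n) * \<kappa> (Suc (Suc n)))"
    using R.second_solution_at_infinity[of "Suc n"] unfolding lead_coeff_eq[symmetric] by blast
  have m1: "m \<ge> 1" using m2 by simp
  have inverse_off: "norm (1 / z) \<noteq> 1" "1 / z \<noteq> 0" if "norm z \<noteq> 1" "z \<noteq> 0" for z :: complex
    using that by (auto simp: norm_divide)
  have star_zero: "eps_star w \<phi>b k z = z ^ Suc k * H z"
    if H: "\<And>z. norm z \<noteq> 1 \<Longrightarrow> z \<noteq> 0 \<Longrightarrow> z * R.second_solution k z = H (1 / z)" and z: "norm z \<noteq> 1" for k z H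
  proof (cases "z = 0")
    case True
    then show ?thesis using z by (simp add: eps_star_eq)
  next
    case False
    have "R.second_solution k (1 / z) = z * H z"
      using H[OF inverse_off[OF z False]] False by (simp add: field_simps)
    then show ?thesis using eps_star_eq_second[OF z False] by simp
  qed
  have star_inf: "eps_star w \<phi>b k z = H (1 / z)"
    if H: "\<And>z. norm z \<noteq> 1 \<Longrightarrow> R.second_solution k z = z ^ k * H z" and z: "norm z \<noteq> 1" "z \<noteq> 0" for k z H
    using H[OF inverse_off(1)[OF z]] eps_star_eq_second[OF z] z by (simp add: power_divide)
  have top: "coeff (recip \<phi>b k) k = y k" and deg: "degree (recip \<phi>b k) \<le> k"
    and bottom: "coeff (recip \<phi>b k) 0 = \<kappa> k" "coeff (recip \<phi>b k) 1 = ly k" for k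
    using degree_reflect_poly_le[of "\<phi>b k"]
    by (auto simp: recip_def coeff_reflect_poly degree_q sub_coeff_def coeff_q_top simp del: One_nat_def)
  have F': "deriv (\<lambda>z. - F_fun w z) z = - deriv (F_fun w) z" if "norm z \<noteq> 1" for z
    by (intro DERIV_imp_deriv DERIV_minus holomorphic_derivI[OF F_holomorphic])
       (use that in \<open>auto intro: open_Compl\<close>)
  interpret D: derivative_pair W V "- U" "recip \<phi>b n" "recip \<phi>b (Suc n)" \<psi> \<psi>2 "\<lambda>z. - F_fun w z"
    "eps_star w \<phi>b n" "eps_star w \<phi>b (Suc n)" E E2 T T2 m n "Suc n" 0
  proof
    show "coeff (recip \<phi>b (Suc n)) (Suc n) * T 0 \<noteq> 0"
      using nz \<kappa>_nonzero unfolding top T(3) by simp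
    show "(\<lambda>z. - F_fun w z) holomorphic_on - circle"
      by (intro holomorphic_intros F_holomorphic)
    show "eps_star w \<phi>b n z = z ^ Suc n * E z" if "norm z \<noteq> 1" for z
      by (rule star_zero[OF E(2) that])
    show "eps_star w \<phi>b (Suc n) z = z ^ Suc (Suc n) * E2 z" if "norm z \<noteq> 1" for z
      by (rule star_zero[OF E2(2) that])
    show "z ^ 0 * eps_star w \<phi>b n z = T (1 / z)" if "norm z \<noteq> 1" "z \<noteq> 0" for z
      using star_inf[OF T(2) that] by simp
    show "z ^ 0 * eps_star w \<phi>b (Suc n) z = T2 (1 / z)" if "norm z \<noteq> 1" "z \<noteq> 0" for z
      using star_inf[OF T2(2) that] by simp
    show "poly W z * deriv (\<lambda>z. - F_fun w z) z = 2 * poly V z * - F_fun w z + poly (- U) z"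
      if "norm z \<noteq> 1" for z
      using U[OF that] by (simp add: F'[OF that])
    show "Suc n + 0 = Suc n" by simp
  qed (rule m2 W_poly_coeffs(1,2)[OF m1] W_zero V_poly_coeffs(1)[OF m2] deg
        \<psi> E(1) E2(1) T(1) T2(1); assumption?)+
  obtain P Q where PQ: "degree P \<le> m - 2" "degree Q \<le> m - 1"
    "W * pderiv (recip \<phi>b n) + V * recip \<phi>b n = P * recip \<phi>b (Suc n) - Q * recip \<phi>b n"
    "W * pderiv \<psi> + (- U) * recip \<phi>b n - V * \<psi> = P * \<psi>2 - Q * \<psi>"
    using D.coefficients_exist by blast
  define db where "db = lead n (recip \<phi>b n) 1"
  have f0: "lead k (recip \<phi>b k) 0 = y k" for k
    by (simp add: coeff_flip top)
  have f1: "lead k (recip \<phi>b k) 1 = coeff (\<phi>b k) 1" if "k \<ge> 1" for k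
    using that by (simp add: coeff_flip recip_def coeff_reflect_poly degree_q)
  have Sf: "lead m W 1 = - S"
    and v0: "lead (m - 1) V 0 = r / 2" and v1: "lead (m - 1) V 1 = (R - r * S) / 2"
    using W_poly_coeffs[OF m1] V_poly_coeffs[OF m2] by (simp_all add: r S R)
  have f1': "lead (Suc n) (recip \<phi>b (Suc n)) 1 = coeff (\<phi>b (Suc n)) 1" by (rule f1) simp
  note inf_p = D.infinity_coefficients_p[OF PQ, unfolded f0 f1' Sf v0 v1, folded db_def]
  note inf_e = D.infinity_coefficients_e[OF PQ, unfolded Sf v0 v1]
  note zero_p = D.zero_coefficients_p[OF PQ, folded V01 W12, unfolded bottom]
  note zero_e = D.zero_coefficients_e[OF PQ, folded V01 W12]
  have \<kappa>: "\<kappa> n \<noteq> 0" "\<kappa> (Suc n) \<noteq> 0" "\<kappa> (Suc (Suc n)) \<noteq> 0" by (rule \<kappa>_nonzero)+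
  have top_eqs:
    "- r / 2 * T 0 = - lead (m - 1) Q 0 * T 0"
    "- deriv T 0 - r / 2 * deriv T 0 - (R - r * S) / 2 * T 0
       = lead (m - 2) P 0 * T2 0 - lead (m - 1) Q 0 * deriv T 0 - lead (m - 1) Q 1 * T 0"
    "of_nat n * y n + r / 2 * y n
       = lead (m - 2) P 0 * y (Suc n) - lead (m - 1) Q 0 * y n"
    "(of_nat n - 1) * db - S * of_nat n * y n + r / 2 * db + (R - r * S) / 2 * y n
       = lead (m - 2) P 0 * coeff (\<phi>b (Suc n)) 1 + lead (m - 2) P 1 * y (Suc n)
         - lead (m - 1) Q 0 * db - lead (m - 1) Q 1 * y n"
    using inf_p inf_e by simp_all
  note tops = star_top_coefficients[OF \<kappa>(1,2) nz T(3,4) T2(3) top_eqs]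
  have low_eqs:
    "W1 * (of_nat n + 1) * E 0 - V0 * E 0 = - coeff Q 0 * E 0"
    "W2 / 2 * (of_nat n + 1) * E 0 + W1 * (of_nat n + 2) * deriv E 0 - V0 * deriv E 0 - V1 * E 0
       = coeff P 0 * E2 0 - coeff Q 0 * deriv E 0 - coeff Q 1 * E 0"
    "V0 * \<kappa> n = coeff P 0 * \<kappa> (Suc n) - coeff Q 0 * \<kappa> n"
    "W1 * ly n + V0 * ly n + V1 * \<kappa> n
       = coeff P 0 * ly (Suc n) + coeff P 1 * \<kappa> (Suc n)
         - coeff Q 0 * ly n - coeff Q 1 * \<kappa> n"
    using zero_p zero_e by (simp_all add: algebra_simps)
  note lows = star_low_coefficients[OF \<kappa> nz E(3,4) E2(3) low_eqs]
  have db0: "\<kappa> (n - 1) * db = \<kappa> n * y (n - 1) + y n * lx (n - 1)" if "n \<ge> 1"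
    using R.coeff_recurrence(1)[of "n - 1"] that unfolding lead_coeff_eq[symmetric] db_def f1[OF that] by simp
  note top_P1 = tops(4)[OF \<kappa>_nonzero db0 R.coeff_recurrence(1)[of n, folded lead_coeff_eq]
      coeff_recurrence(2) \<kappa>_square]
  have unique: "\<theta> = poly (- P) z \<and> \<omega> = poly (- Q) z"
    if "norm z \<noteq> 1" "z \<noteq> 0"
      "poly W z * poly (pderiv (recip \<phi>b n)) z
          = - \<theta> * poly (recip \<phi>b (Suc n)) z + (\<omega> - poly V z) * poly (recip \<phi>b n) z"
      "poly W z * deriv (eps_star w \<phi>b n) z
          = - \<theta> * eps_star w \<phi>b (Suc n) z + (\<omega> + poly V z) * eps_star w \<phi>b n z" for z \<theta> \<omega>
  proof -
    have "poly W z * poly (pderiv (recip \<phi>b n)) z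
        = (- \<theta>) * poly (recip \<phi>b (Suc n)) z - (- \<omega> + poly V z) * poly (recip \<phi>b n) z"
      "poly W z * deriv (eps_star w \<phi>b n) z
        = (- \<theta>) * eps_star w \<phi>b (Suc n) z - (- \<omega> - poly V z) * eps_star w \<phi>b n z"
      unfolding that(3,4) by (simp_all add: algebra_simps)
    then have "- \<theta> = poly P z \<and> - \<omega> = poly Q z"
      by (rule D.coefficients_unique[OF that(1,2) _ _ D.first_relation[OF PQ] D.second_relation[OF PQ that(1)]])
    then show ?thesis by (metis minus_minus poly_minus)
  qed
  have neg: "lead k (- A) i = - lead k A i" for k A i
    by (simp add: coeff_flip)
  have rel1: "poly W z * poly (pderiv (recip \<phi>b n)) z
        = - poly (- P) z * poly (recip \<phi>b (Suc n)) z + (poly (- Q) z - poly V z) * poly (recip \<phi>b n) z" for z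
    using D.first_relation[OF PQ, of z] by (simp add: algebra_simps)
  have rel2: "poly W z * deriv (eps_star w \<phi>b n) z
        = - poly (- P) z * eps_star w \<phi>b (Suc n) z + (poly (- Q) z + poly V z) * eps_star w \<phi>b n z"
    if "norm z \<noteq> 1" for z
    using D.second_relation[OF PQ that] by (simp add: algebra_simps)
  show thesis
    by (rule that[of "- P" "- Q", unfolded neg coeff_minus degree_minus,
          OF PQ(1,2) rel1 rel2 unique tops(2) top_P1 lows(2,4) tops(1,3) lows(1,3)])
qed

end

lemma degree_leadI:
  assumes "degree A \<le> d" "lead d A 0 = c"
  shows "degree_lead A d c"
  using assms by (auto simp: degree_lead_def coeff_flip intro!: le_antisym le_degree)

theorem proposition3p1:
  fixes m n :: nat
    and zs \<rho> :: "nat \<Rightarrow> complex"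
    and w :: "complex \<Rightarrow> complex"
    and \<phi> \<phi>b :: "nat \<Rightarrow> complex poly"
    and W V :: "complex poly"
    and \<Theta> \<Omega> \<Theta>s \<Omega>s :: "complex \<Rightarrow> complex"
    and \<kappa> l lb \<phi>0 \<phi>b0 :: "nat \<Rightarrow> complex"
    and r S R V0 V1 W1 W2 :: complex
  assumes weight: "semi_classical_weight m zs \<rho> w"
    and W: "W = W_poly m zs" and V: "V = V_poly m zs \<rho>"
    and W_zero: "poly W 0 = 0"
    and biorth: "biorthonormal w \<phi> \<phi>b"
    and \<kappa>: "\<kappa> = (\<lambda>k. lead_coeff (\<phi> k))"
    and l: "l = sub_coeff \<phi>" and lb: "lb = sub_coeff \<phi>b"
    and \<phi>0: "\<phi>0 = (\<lambda>k. poly (\<phi> k) 0)" and \<phi>b0: "\<phi>b0 = (\<lambda>k. poly (\<phi>b k) 0)"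
    and r: "r = (\<Sum>j=1..m. \<rho> j)" and S: "S = (\<Sum>j=1..m. zs j)"
    and R: "R = (\<Sum>j=1..m. \<rho> j * zs j)"
    and V0: "V0 = poly V 0" and V1: "V1 = poly (pderiv V) 0"
    and W1: "W1 = poly (pderiv W) 0" and W2: "W2 = poly (pderiv (pderiv W)) 0"
    and nondegenerate: "\<phi>0 (n + 1) \<noteq> 0" "\<phi>b0 (n + 1) \<noteq> 0"
    and relations: "derivative_relations w \<phi> \<phi>b W V n \<Theta> \<Omega> \<Theta>s \<Omega>s"
  shows "\<exists>P Q Ps Qs :: complex poly.
    (\<forall>z. cmod z \<noteq> 1 \<and> z \<noteq> 0 \<longrightarrow>
        \<Theta> z = poly P z \<and> \<Omega> z = poly Q z \<and> \<Theta>s z = poly Ps z \<and> \<Omega>s z = poly Qs z) \<and>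
    derivative_relations w \<phi> \<phi>b W V n (poly P) (poly Q) (poly Ps) (poly Qs) \<and>
    degree_lead P (m - 2) ((of_nat n + 1 + r) * (\<kappa> n / \<kappa> (n + 1))) \<and>
    degree_lead Ps (m - 2) (- (of_nat n + r) * (\<phi>b0 n / \<phi>b0 (n + 1))) \<and>
    degree_lead Q (m - 1) (1 + r / 2) \<and>
    degree_lead Qs (m - 1) (- r / 2) \<and>
    top_expansion (poly P) (int m - 2)
      ((of_nat n + 1 + r) * (\<kappa> n / \<kappa> (n + 1)))
      (- ((of_nat n + 1 + r) * S - R) * (\<kappa> n / \<kappa> (n + 1))
        + (of_nat n + 2 + r) * (\<kappa> n ^ 3 / (\<kappa> (n + 1) ^ 2 * \<kappa> (n + 2))) * (\<phi>0 (n + 2) / \<phi>0 (n + 1))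
        - (of_nat n + r) * (\<phi>0 (n + 1) * \<phi>b0 n / \<kappa> (n + 1) ^ 2)
        - 2 * (\<kappa> n * l (n + 1) / \<kappa> (n + 1) ^ 2)) \<and>
    coeff P 0 = (2 * V0 - of_nat n * W1) * (\<phi>0 n / \<phi>0 (n + 1)) \<and>
    (n \<ge> 1 \<longrightarrow> low_expansion (poly P)
      ((2 * V0 - of_nat n * W1) * (\<phi>0 n / \<phi>0 (n + 1)))
      ((2 * V1 - 1/2 * of_nat n * W2) * (\<phi>0 n / \<phi>0 (n + 1))
        + (2 * V0 - (of_nat n - 1) * W1) * (\<kappa> n * \<phi>0 (n - 1) / (\<kappa> (n - 1) * \<phi>0 (n + 1)))
        + (((of_nat n + 1) * W1 - 2 * V0) * (lb (n + 1) / \<kappa> (n + 1))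
           - ((of_nat n - 1) * W1 - 2 * V0) * (lb (n - 1) / \<kappa> (n - 1))) * (\<phi>0 n / \<phi>0 (n + 1)))) \<and>
    (n \<ge> 1 \<longrightarrow> top_expansion (poly Ps) (int m - 2)
      (- (of_nat n + r) * (\<phi>b0 n / \<phi>b0 (n + 1)))
      (((of_nat n + r) * S - R) * (\<phi>b0 n / \<phi>b0 (n + 1))
        + (of_nat n + 1 + r) * (\<phi>b0 n / \<phi>b0 (n + 1)) * (l (n + 1) / \<kappa> (n + 1))
        - (of_nat n - 1 + r) * ((\<kappa> n * \<phi>b0 (n - 1) + \<phi>b0 n * l (n - 1)) / (\<kappa> (n - 1) * \<phi>b0 (n + 1))))) \<and>
    low_expansion (poly Ps)
      (- (2 * V0 - (of_nat n + 1) * W1) * (\<kappa> n / \<kappa> (n + 1)))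
      (- (2 * V1 - 1/2 * (of_nat n + 1) * W2) * (\<kappa> n / \<kappa> (n + 1))
        - (2 * V0 - of_nat n * W1) * (lb n / \<kappa> (n + 1))
        + ((of_nat n + 2) * W1 - 2 * V0)
          * (\<kappa> n ^ 3 / (\<kappa> (n + 2) * \<kappa> (n + 1) ^ 2) * (\<phi>b0 (n + 2) / \<phi>b0 (n + 1))
             - \<kappa> n / \<kappa> (n + 1) * (lb (n + 1) / \<kappa> (n + 1)))) \<and>
    top_expansion (poly Q) (int m - 1)
      (1 + r / 2)
      (- 1/2 * r * S + 1/2 * R - S
        + (of_nat n + 2 + r) * (\<kappa> n ^ 2 / (\<kappa> (n + 2) * \<kappa> (n + 1))) * (\<phi>0 (n + 2) / \<phi>0 (n + 1))
        - l (n + 1) / \<kappa> (n + 1)) \<and>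
    low_expansion (poly Q)
      (V0 - of_nat n * W1)
      (V1 - 1/2 * of_nat n * W2
        + (V0 * (\<kappa> n / \<kappa> (n + 1)) + (V0 - of_nat n * W1) * (\<kappa> (n + 1) / \<kappa> n)) * (\<phi>0 n / \<phi>0 (n + 1))
        + (V0 - of_nat n * W1) * (lb n / \<kappa> n)
        - (V0 - (of_nat n + 1) * W1) * (lb (n + 1) / \<kappa> (n + 1))) \<and>
    top_expansion (poly Qs) (int m - 1)
      (- r / 2)
      (1/2 * r * S - 1/2 * R
        - (of_nat n + r) * (\<kappa> n / \<kappa> (n + 1)) * (\<phi>b0 n / \<phi>b0 (n + 1))
        + l (n + 1) / \<kappa> (n + 1)) \<and>
    low_expansion (poly Qs)
      ((of_nat n + 1) * W1 - V0)
      (1/2 * (of_nat n + 1) * W2 - V1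
        + ((of_nat n + 2) * W1 - 2 * V0) * (\<kappa> n ^ 2 / (\<kappa> (n + 2) * \<kappa> (n + 1))) * (\<phi>b0 (n + 2) / \<phi>b0 (n + 1))
        - W1 * (lb (n + 1) / \<kappa> (n + 1)))"
proof -
  interpret semi_classical_pair m zs \<rho> w \<phi> \<phi>b
    using weight biorth W_zero by unfold_locales (simp_all add: W)
  have m2: "m \<ge> 2" by (rule m2)
  have nats: "n + 1 = Suc n" "n + 2 = Suc (Suc n)" by simp_all
  have dims: "int m - 2 = int (m - 2)" "int m - 1 = int (m - 1)" using m2 by auto
  have names: "\<kappa> k = lead_coeff (\<phi> k)" "l k = sub_coeff \<phi> k" "lb k = sub_coeff \<phi>b k"
    "\<phi>0 k = coeff (\<phi> k) 0" "\<phi>b0 k = coeff (\<phi>b k) 0" for k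
    by (simp_all add: \<kappa> l lb \<phi>0 \<phi>b0 poly_0_coeff_0)
  have W12: "W1 = coeff (W_poly m zs) 1" "W2 / 2 = coeff (W_poly m zs) 2"
    and V01: "V0 = coeff (V_poly m zs \<rho>) 0" "V1 = coeff (V_poly m zs \<rho>) 1"
    by (simp_all only: W1 W2 V0 V1 W V W_coeff_2 coeff_1_pderiv poly_0_coeff_0[symmetric])
  have nz: "coeff (\<phi> (Suc n)) 0 \<noteq> 0" "coeff (\<phi>b (Suc n)) 0 \<noteq> 0"
    using nondegenerate by (simp_all add: names)
  note rel = relations[unfolded derivative_relations_def W V nats, rule_format]
  show ?thesis
  proof (rule unstarred_coefficients[OF nz(1) r S R V01 W12], goal_cases)
    case (1 P Q)
    note u = this
    show ?case
    proof (rule starred_coefficients[OF nz(2) r S R V01 W12], goal_cases)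
      case (1 Ps Qs)
      note s = this
      have agree: "\<Theta> z = poly P z \<and> \<Omega> z = poly Q z \<and> \<Theta>s z = poly Ps z \<and> \<Omega>s z = poly Qs z"
        if "cmod z \<noteq> 1 \<and> z \<noteq> 0" for z
        using u(5)[of z "\<Theta> z" "\<Omega> z"] s(5)[of z "\<Theta>s z" "\<Omega>s z"] rel[of z] that by blast
      have rels: "derivative_relations w \<phi> \<phi>b W V n (poly P) (poly Q) (poly Ps) (poly Qs)"
        unfolding derivative_relations_def W V nats using u(3,4) s(3,4) by blast
      note tops = top_expansion_poly[OF u(1), unfolded u(6,7)] top_expansion_poly[OF u(2), unfolded u(10,11)]
        top_expansion_poly[OF s(1), unfolded s(6)] top_expansion_poly[OF s(2), unfolded s(10,11)]
      note lows = low_expansion_poly[of P, unfolded u(8)] low_expansion_poly[of Q, unfolded u(12,13)]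
        low_expansion_poly[of Ps, unfolded s(8,9)] low_expansion_poly[of Qs, unfolded s(12,13)]
      show ?case
        unfolding names nats dims
      proof (intro exI conjI allI impI)
        show "\<Theta> z = poly P z" "\<Omega> z = poly Q z" "\<Theta>s z = poly Ps z" "\<Omega>s z = poly Qs z"
          if "cmod z \<noteq> 1 \<and> z \<noteq> 0" for z
          using agree[OF that] by blast+
      qed ((subst u(9)[symmetric], assumption, rule lows(1))
        | (subst s(7)[symmetric], assumption, rule tops(3))
        | rule rels degree_leadI[OF u(1) u(6)] degree_leadI[OF s(1) s(6)] degree_leadI[OF u(2) u(10)]
          degree_leadI[OF s(2) s(10)] tops(1,2,4) lows(2,3,4) u(8))+
    qed
  qed
qed

end
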